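(* Assume the Riemann Hypothesis. There is an absolute constant $K>0$ such that the following holds. Let $\rho'=\beta'+i\gamma'$ be a zero of $\zeta'(s)$ with $\beta'>1/2$ and $\gamma'$ sufficiently large, and let $1/2+i\gamma$ be a zero of $\zeta(s)$ with $\gamma\le\gamma'<\gamma^+$. Then $$\gamma^+-\gamma\le K\sqrt{(\beta'-1/2)\log\gamma'}.$$ In particular, $$\liminf_{\substack{\gamma'\to\infty\\ \beta'>1/2}}(\beta'-1/2)(\log\gamma')^3=0\ \Longrightarrow\ \liminf_{\gamma\to\infty}(\gamma^+-\gamma)\log\gamma=0,$$ where the first liminf is over zeros $\beta'+i\gamma'$ of $\zeta'(s)$ with $\beta'>1/2$ and the second over ordinates $\gamma>0$ of zeros $1/2+i\gamma$ of $\zeta(s)$.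
   Context: If $\zeta(1/2+i\gamma)=0$ with $\gamma>0$, then $\gamma^+$ denotes the smallest $t>\gamma$ with $\zeta(1/2+it)=0$. *)

theory Defs
  imports "HOL-Complex_Analysis.Complex_Analysis"
begin

section \<open>The Riemann zeta function\<close>

text \<open>
  The zeta function is the analytic continuation of the Dirichlet series
  $\sum_{n \ge 1} n^{-s}$ to the complex plane without the point 1. The value at the
  pole is fixed to 0 so that the function is determined as a total function.
\<close>

definition is_zeta :: "(complex \<Rightarrow> complex) \<Rightarrow> bool" where
  "is_zeta f \<longleftrightarrow> f holomorphic_on (- {1}) \<and> f 1 = 0 \<and>
     (\<forall>s. Re s > 1 \<longrightarrow> (\<lambda>n. of_nat (Suc n) powr (- s)) sums f s)"

definition zeta :: "complex \<Rightarrow> complex" where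
  "zeta = (THE f. is_zeta f)"

subsection \<open>The continuation exists and is unique\<close>

lemma holomorphic_suminf:
  fixes f :: "nat \<Rightarrow> complex \<Rightarrow> complex"
  assumes S: "open S" and hol: "\<And>n. f n holomorphic_on S"
    and bound: "\<And>K. compact K \<Longrightarrow> K \<subseteq> S \<Longrightarrow>
                  \<exists>M. summable M \<and> (\<forall>n. \<forall>s\<in>K. norm (f n s) \<le> M n)"
  shows "(\<lambda>s. \<Sum>n. f n s) holomorphic_on S"
proof (rule holomorphic_uniform_sequence[where f = "\<lambda>N s. \<Sum>n<N. f n s"])
  show "open S" by fact
  show "(\<lambda>s. \<Sum>n<N. f n s) holomorphic_on S" for N
    by (intro holomorphic_intros hol)
next
  fix z assume "z \<in> S"
  then obtain d where d: "d > 0" "cball z d \<subseteq> S"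
    using S open_contains_cball by blast
  then obtain M where M: "summable M" "\<And>n s. s \<in> cball z d \<Longrightarrow> norm (f n s) \<le> M n"
    using bound[of "cball z d"] by auto
  then have "uniform_limit (cball z d) (\<lambda>N s. \<Sum>n<N. f n s) (\<lambda>s. \<Sum>n. f n s) sequentially"
    by (intro Weierstrass_m_test)
  with d show "\<exists>d>0. cball z d \<subseteq> S \<and>
      uniform_limit (cball z d) (\<lambda>N s. \<Sum>n<N. f n s) (\<lambda>s. \<Sum>n. f n s) sequentially"
    by blast
qed

lemma norm_Suc_powr: "norm (of_nat (Suc n) powr (s::complex)) = real (Suc n) powr Re s"
  by (subst norm_powr_real_powr) auto

lemma summable_Suc_powr: "a < -1 \<Longrightarrow> summable (\<lambda>n. real (Suc n) powr a)"
  using summable_real_powr_iff[of a] summable_Suc_iff[of "\<lambda>n. real n powr a"] by simp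

definition dirichlet_zeta :: "complex \<Rightarrow> complex" where
  "dirichlet_zeta s = (\<Sum>n. of_nat (Suc n) powr (- s))"

lemma dirichlet_zeta_sums:
  assumes "Re s > 1"
  shows "(\<lambda>n. of_nat (Suc n) powr (- s)) sums dirichlet_zeta s"
proof -
  have "summable (\<lambda>n. norm (of_nat (Suc n) powr (- s)))"
    unfolding norm_Suc_powr using assms by (intro summable_Suc_powr) auto
  then show ?thesis
    unfolding dirichlet_zeta_def by (rule summable_sums[OF summable_norm_cancel])
qed

lemma compact_halfplane_gap:
  assumes "compact K" "K \<subseteq> {s. Re s > a}"
  shows "\<exists>b>a. \<forall>s\<in>K. Re s \<ge> b"
proof (cases "K = {}")
  case True
  then show ?thesis by (intro exI[of _ "a + 1"]) simp
next
  case False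
  have "continuous_on K Re" by (intro continuous_intros)
  from continuous_attains_inf[OF assms(1) False this]
  obtain x where x: "x \<in> K" "\<forall>s\<in>K. Re x \<le> Re s" by (elim bexE)
  from x(1) assms(2) have "Re x > a" by auto
  with x(2) show ?thesis by (intro exI[of _ "Re x"] conjI)
qed

lemma open_Re_greater: "open {s. Re s > a}"
  by (rule open_halfspace_Re_gt)

lemma dirichlet_zeta_holomorphic: "dirichlet_zeta holomorphic_on {s. Re s > 1}"
proof -
  have "(\<lambda>s. \<Sum>n. complex_of_nat (Suc n) powr (- s)) holomorphic_on {s. Re s > 1}"
  proof (rule holomorphic_suminf[OF open_Re_greater])
    show "(\<lambda>s. complex_of_nat (Suc n) powr (- s)) holomorphic_on {s. Re s > 1}" for n
      by (intro holomorphic_intros)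
  next
    fix K :: "complex set" assume "compact K" "K \<subseteq> {s. Re s > 1}"
    then obtain b where b: "b > 1" "\<And>s. s \<in> K \<Longrightarrow> Re s \<ge> b"
      using compact_halfplane_gap[of K 1] by metis
    have "norm (of_nat (Suc n) powr (- s)) \<le> real (Suc n) powr (- b)" if "s \<in> K" for n s
      unfolding norm_Suc_powr using b(2)[OF that] by (intro powr_mono) auto
    moreover have "summable (\<lambda>n. real (Suc n) powr (- b))"
      using b(1) by (intro summable_Suc_powr) auto
    ultimately show "\<exists>M. summable M \<and>
        (\<forall>n. \<forall>s\<in>K. norm (complex_of_nat (Suc n) powr (- s)) \<le> M n)"
      by (intro exI[of _ "\<lambda>n. real (Suc n) powr (- b)"] conjI allI ballI)
  qed
  then show ?thesis by (simp add: dirichlet_zeta_def[abs_def])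
qed

definition falling :: "nat \<Rightarrow> complex \<Rightarrow> complex" where
  "falling j s = (\<Prod>i<j. 1 - s - of_nat i)"

definition taylor_rem :: "nat \<Rightarrow> nat \<Rightarrow> complex \<Rightarrow> complex" where
  "taylor_rem m n s = of_nat (Suc (Suc n)) powr (1 - s) -
     (\<Sum>i\<le>m. falling i s * of_nat (Suc n) powr (1 - s - of_nat i) / fact i)"

lemma falling_holomorphic: "falling j holomorphic_on S"
  unfolding falling_def[abs_def] by (intro holomorphic_intros)

lemma taylor_rem_holomorphic: "taylor_rem m n holomorphic_on S"
  unfolding taylor_rem_def[abs_def]
  by (intro holomorphic_intros falling_holomorphic) auto

lemma taylor_rem_bound:
  assumes "Re s + real m \<ge> 2"
  shows "norm (taylor_rem m n s) \<le> norm (falling (Suc m) s) * real (Suc n) powr (- 2)"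
proof -
  let ?f = "\<lambda>i w. falling i s * w powr (1 - s - of_nat i)"
  let ?S = "of_real ` {real (Suc n)..real (Suc (Suc n))} :: complex set"
  let ?B = "norm (falling (Suc m) s) * real (Suc n) powr (- 2)"
  have "norm (?f 0 (of_nat (Suc (Suc n))) -
          (\<Sum>i\<le>m. ?f i (of_nat (Suc n)) * (of_nat (Suc (Suc n)) - of_nat (Suc n)) ^ i / fact i))
        \<le> ?B * norm (of_nat (Suc (Suc n)) - of_nat (Suc n) :: complex) ^ Suc m / fact m"
  proof (rule complex_Taylor[of ?S])
    show "convex ?S"
      by (intro convex_linear_image convex_real_interval linear_of_real)
    show "of_nat (Suc n) \<in> ?S"
      by (rule image_eqI[of _ _ "real (Suc n)"]) auto
    show "of_nat (Suc (Suc n)) \<in> ?S"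
      by (rule image_eqI[of _ _ "real (Suc (Suc n))"]) auto
  next
    fix i x assume "x \<in> ?S"
    then have "x \<notin> \<real>\<^sub>\<le>\<^sub>0" by auto
    from DERIV_cmult[OF has_field_derivative_powr[OF this], of "falling i s" "1 - s - of_nat i"]
    have "(?f i has_field_derivative ?f (Suc i) x) (at x)"
      by (simp add: falling_def algebra_simps)
    then show "(?f i has_field_derivative ?f (Suc i) x) (at x within ?S)"
      by (rule has_field_derivative_at_within)
  next
    fix x assume "x \<in> ?S"
    then obtain r where r: "x = of_real r" "r \<ge> real (Suc n)" by auto
    have "norm (x powr (1 - s - of_nat (Suc m))) = r powr (- Re s - real m)"
      using r by (subst norm_powr_real_powr) auto
    also have "\<dots> \<le> r powr (- 2)"
      using assms r by (intro powr_mono) auto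
    also have "\<dots> \<le> real (Suc n) powr (- 2)"
      using r by (intro powr_mono2') auto
    finally show "norm (?f (Suc m) x) \<le> ?B"
      by (simp add: norm_mult mult_left_mono)
  qed
  also have "\<dots> = ?B / fact m" by simp
  also have "\<dots> \<le> ?B / 1"
    by (rule divide_left_mono) auto
  finally show ?thesis
    by (simp add: taylor_rem_def falling_def)
qed

lemma taylor_rem_suminf_holomorphic:
  "(\<lambda>s. \<Sum>n. taylor_rem (k + 2) n s) holomorphic_on {s. Re s > - real k}"
proof (rule holomorphic_suminf[OF open_Re_greater taylor_rem_holomorphic])
  fix K :: "complex set" assume K: "compact K" "K \<subseteq> {s. Re s > - real k}"
  have "continuous_on K (falling (Suc (k + 2)))"
    by (intro holomorphic_on_imp_continuous_on falling_holomorphic)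
  then have "bounded (falling (Suc (k + 2)) ` K)"
    using K compact_continuous_image compact_imp_bounded by blast
  then obtain B where B: "\<And>s. s \<in> K \<Longrightarrow> norm (falling (Suc (k + 2)) s) \<le> B"
    by (auto simp: bounded_iff)
  have "norm (taylor_rem (k + 2) n s) \<le> B * real (Suc n) powr (- 2)" if "s \<in> K" for n s
  proof -
    have "norm (taylor_rem (k + 2) n s) \<le>
            norm (falling (Suc (k + 2)) s) * real (Suc n) powr (- 2)"
      using K that by (intro taylor_rem_bound) auto
    also have "\<dots> \<le> B * real (Suc n) powr (- 2)"
      using B[OF that] by (intro mult_right_mono) auto
    finally show ?thesis .
  qed
  moreover have "summable (\<lambda>n. B * real (Suc n) powr (- 2))"
    by (intro summable_mult summable_Suc_powr) auto
  ultimately show "\<exists>M. summable M \<and> (\<forall>n. \<forall>s\<in>K. norm (taylor_rem (k + 2) n s) \<le> M n)"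
    by (intro exI[of _ "\<lambda>n. B * real (Suc n) powr (- 2)"] conjI allI ballI)
qed

lemma taylor_rem_sums:
  assumes s: "Re s > 1"
  shows "(\<lambda>n. taylor_rem m n s) sums
           (- 1 + (\<Sum>i<m. falling i s / fact (Suc i) *
                    ((s + of_nat i - 1) * dirichlet_zeta (s + of_nat i))))"
proof -
  have "(\<lambda>n. complex_of_nat (Suc n) powr (1 - s)) \<longlonglongrightarrow> 0"
  proof (rule tendsto_norm_zero_cancel)
    have "(\<lambda>n. real (Suc n) powr (1 - Re s)) \<longlonglongrightarrow> 0"
      using s by (intro tendsto_neg_powr filterlim_compose[OF filterlim_real_sequentially]
                    filterlim_Suc) auto
    then show "(\<lambda>n. norm (complex_of_nat (Suc n) powr (1 - s))) \<longlonglongrightarrow> 0"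
      by (simp add: norm_Suc_powr del: of_nat_Suc)
  qed
  from telescope_sums[OF this]
  have 1: "(\<lambda>n. complex_of_nat (Suc (Suc n)) powr (1 - s) - of_nat (Suc n) powr (1 - s)) sums (- 1)"
    by simp
  have 2: "(\<lambda>n. \<Sum>i<m. - (falling i s / fact (Suc i) * (s + of_nat i - 1) *
               of_nat (Suc n) powr (- (s + of_nat i)))) sums
           (\<Sum>i<m. - (falling i s / fact (Suc i) * (s + of_nat i - 1) *
               dirichlet_zeta (s + of_nat i)))"
    using s by (intro sums_sum sums_minus sums_mult dirichlet_zeta_sums) auto
  have "taylor_rem m n s = (of_nat (Suc (Suc n)) powr (1 - s) - of_nat (Suc n) powr (1 - s)) -
          (\<Sum>i<m. - (falling i s / fact (Suc i) * (s + of_nat i - 1) *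
               of_nat (Suc n) powr (- (s + of_nat i))))" for n
  proof -
    have "(\<Sum>i\<le>m. falling i s * of_nat (Suc n) powr (1 - s - of_nat i) / fact i) =
          of_nat (Suc n) powr (1 - s) + (\<Sum>i<m. falling (Suc i) s *
             of_nat (Suc n) powr (1 - s - of_nat (Suc i)) / fact (Suc i))"
      by (subst sum.atMost_shift) (simp add: falling_def)
    also have "(\<Sum>i<m. falling (Suc i) s * of_nat (Suc n) powr (1 - s - of_nat (Suc i)) / fact (Suc i)) =
          (\<Sum>i<m. - (falling i s / fact (Suc i) * (s + of_nat i - 1) *
               of_nat (Suc n) powr (- (s + of_nat i))))"
    proof (rule sum.cong[OF refl])
      fix i
      have e: "1 - s - of_nat (Suc i) = - (s + of_nat i)" by simp
      have f: "falling (Suc i) s = - (falling i s * (s + of_nat i - 1))"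
        by (simp add: falling_def algebra_simps)
      show "falling (Suc i) s * of_nat (Suc n) powr (1 - s - of_nat (Suc i)) / fact (Suc i) =
            - (falling i s / fact (Suc i) * (s + of_nat i - 1) *
                 of_nat (Suc n) powr (- (s + of_nat i)))"
        unfolding e f by simp
    qed
    finally show ?thesis unfolding taylor_rem_def by (simp only: diff_diff_eq)
  qed
  note rem = this
  have "(\<lambda>n. taylor_rem m n s) sums
          (- 1 - (\<Sum>i<m. - (falling i s / fact (Suc i) * (s + of_nat i - 1) *
               dirichlet_zeta (s + of_nat i))))"
    using sums_diff[OF 1 2] by (simp only: rem)
  then show ?thesis
    by (simp only: sum_negf mult.assoc diff_minus_eq_add)
qed

lemma zeta_continuation_halfplane:
  "\<exists>Z. Z holomorphic_on {s. Re s > 1 - real k} \<and>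
       (\<forall>s. Re s > 1 \<longrightarrow> Z s = (s - 1) * dirichlet_zeta s)"
proof (induction k)
  case 0
  have "(\<lambda>s. (s - 1) * dirichlet_zeta s) holomorphic_on {s. Re s > 1}"
    by (intro holomorphic_intros dirichlet_zeta_holomorphic)
  then show ?case by auto
next
  case (Suc k)
  then obtain Z where Z: "Z holomorphic_on {s. Re s > 1 - real k}"
      "\<And>s. Re s > 1 \<Longrightarrow> Z s = (s - 1) * dirichlet_zeta s" by blast
  let ?W = "\<lambda>s. 1 + (\<Sum>n. taylor_rem (k + 2) n s) -
              (\<Sum>i<k + 1. falling (Suc i) s / fact (Suc (Suc i)) * Z (s + of_nat (Suc i)))"
  have comp: "(\<lambda>s. Z (s + of_nat (Suc i))) holomorphic_on {s. Re s > - real k}" for i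
    by (rule holomorphic_on_compose_gen[OF _ Z(1), unfolded o_def])
       (auto intro!: holomorphic_intros)
  have "?W holomorphic_on {s. Re s > - real k}"
    by (intro holomorphic_intros comp taylor_rem_suminf_holomorphic falling_holomorphic) auto
  moreover have "?W s = (s - 1) * dirichlet_zeta s" if s: "Re s > 1" for s
  proof -
    have "(\<Sum>n. taylor_rem (k + 2) n s) =
            - 1 + (\<Sum>i<k + 2. falling i s / fact (Suc i) *
                    ((s + of_nat i - 1) * dirichlet_zeta (s + of_nat i)))"
      using taylor_rem_sums[OF s] by (rule sums_unique[symmetric])
    also have "(\<Sum>i<k + 2. falling i s / fact (Suc i) *
                    ((s + of_nat i - 1) * dirichlet_zeta (s + of_nat i))) =
               (\<Sum>i<Suc (k + 1). falling i s / fact (Suc i) * Z (s + of_nat i))"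
      using s by (intro sum.cong) (auto simp: Z(2))
    also have "\<dots> = Z s +
        (\<Sum>i<k + 1. falling (Suc i) s / fact (Suc (Suc i)) * Z (s + of_nat (Suc i)))"
      by (subst sum.lessThan_Suc_shift) (simp add: falling_def)
    finally show ?thesis using Z(2)[OF s] by simp
  qed
  ultimately show ?case by auto
qed

lemma zeta_continuation_entire:
  "\<exists>Z. Z holomorphic_on UNIV \<and> (\<forall>s. Re s > 1 \<longrightarrow> Z s = (s - 1) * dirichlet_zeta s)"
proof -
  let ?H = "\<lambda>k::nat. {s. Re s > 1 - real k}"
  obtain Z where Z: "\<And>k. Z k holomorphic_on ?H k"
      "\<And>k s. Re s > 1 \<Longrightarrow> Z k s = (s - 1) * dirichlet_zeta s"
    using zeta_continuation_halfplane by metis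
  have eq: "Z k s = Z l s" if "k \<le> l" "s \<in> ?H k" for k l s
  proof (rule analytic_continuation_open[where s = "{s. Re s > 1}" and s' = "?H k"
          and f = "Z k" and g = "Z l" and z = s])
    show "Z k holomorphic_on ?H k" by (rule Z)
    show "Z l holomorphic_on ?H k"
      using that by (intro holomorphic_on_subset[OF Z(1)]) auto
    show "{s. Re s > 1} \<noteq> {}" by (auto intro: exI[of _ 2])
    show "connected (?H k)" by (intro convex_connected convex_halfspace_Re_gt)
  qed (use that Z(2) in \<open>auto intro: open_Re_greater\<close>)
  define N where "N = (\<lambda>s. nat \<lceil>1 - Re s\<rceil> + 1)"
  have N: "s \<in> ?H (N s)" for s
  proof -
    have "1 - Re s \<le> real (nat \<lceil>1 - Re s\<rceil>)" by (rule real_nat_ceiling_ge)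
    then show ?thesis by (simp add: N_def)
  qed
  define F where "F = (\<lambda>s. Z (N s) s)"
  have F: "F s = Z k s" if "s \<in> ?H k" for k s
    unfolding F_def using eq[OF _ that, of "N s"] eq[OF _ N[of s], of k] linear[of k "N s"]
    by metis
  have "F holomorphic_on ?H k" for k
    by (rule holomorphic_transform[OF Z(1)[of k]]) (use F in auto)
  then have "F field_differentiable at s" for s
    using N[of s] open_Re_greater holomorphic_on_imp_differentiable_at by blast
  then have "F holomorphic_on UNIV"
    by (simp add: holomorphic_on_def)
  moreover have "F s = (s - 1) * dirichlet_zeta s" if "Re s > 1" for s
    unfolding F_def using that by (rule Z(2))
  ultimately show ?thesis by blast
qed

lemma is_zeta_unique:
  assumes f: "is_zeta f" and g: "is_zeta g"
  shows "f = g"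
proof
  fix s
  show "f s = g s"
  proof (cases "s = 1")
    case False
    show ?thesis
    proof (rule analytic_continuation_open[where s = "{s. Re s > 1}" and s' = "- {1}"
            and f = f and g = g and z = s])
      show "{s. Re s > 1} \<noteq> {}" by (auto intro: exI[of _ 2])
      show "connected (- {1 :: complex})"
        by (rule connected_punctured_universe) simp
      show "f z = g z" if "z \<in> {s. Re s > 1}" for z
        using f g that sums_unique2 unfolding is_zeta_def by blast
    qed (use f g False in \<open>auto simp: is_zeta_def open_Re_greater\<close>)
  qed (use f g in \<open>simp add: is_zeta_def\<close>)
qed

lemma is_zeta_exists: "\<exists>f. is_zeta f"
proof -
  obtain Z where Z: "Z holomorphic_on UNIV"
      "\<And>s. Re s > 1 \<Longrightarrow> Z s = (s - 1) * dirichlet_zeta s"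
    using zeta_continuation_entire by blast
  let ?f = "\<lambda>s. if s = 1 then 0 else Z s / (s - 1)"
  have "(\<lambda>s. Z s / (s - 1)) holomorphic_on - {1}"
    by (intro holomorphic_intros holomorphic_on_subset[OF Z(1)]) auto
  then have "?f holomorphic_on - {1}"
    by (rule holomorphic_transform) auto
  moreover have "?f s = dirichlet_zeta s" if "Re s > 1" for s
    using Z(2)[OF that] that by auto
  ultimately have "is_zeta ?f"
    using dirichlet_zeta_sums unfolding is_zeta_def by auto
  then show ?thesis by blast
qed

theorem is_zeta_zeta: "is_zeta zeta"
  unfolding zeta_def using is_zeta_exists is_zeta_unique by (metis theI)

section \<open>Zeros\<close>

text \<open>Only zeros in the open critical strip are constrained, so the trivial zeros and the
  conventional value at the pole play no role.\<close>

definition riemann_hypothesis :: bool where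
  "riemann_hypothesis \<longleftrightarrow> (\<forall>s. zeta s = 0 \<and> 0 < Re s \<and> Re s < 1 \<longrightarrow> Re s = 1 / 2)"

definition zeta_ordinates :: "real set" where
  "zeta_ordinates = {\<gamma>. \<gamma> > 0 \<and> zeta (Complex (1/2) \<gamma>) = 0}"

text \<open>
  The smallest ordinate $\gamma^+$ strictly above $\gamma$; a multiple zero
  contributes its ordinate only once.
\<close>

definition next_ordinate :: "real \<Rightarrow> real" where
  "next_ordinate \<gamma> = (LEAST t. t > \<gamma> \<and> zeta (Complex (1/2) t) = 0)"

definition right_deriv_zeros :: "complex set" where
  "right_deriv_zeros = {\<rho>'. deriv zeta \<rho>' = 0 \<and> Re \<rho>' > 1 / 2}"

end

theory Submission
  imports Defs
begin

text \<open>
  Let $\rho' = 1/2 + \eta + it$ be a zero of $\zeta'$ and $L = \log t$. Landau's lemma gives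
  $\zeta'/\zeta(s) = \sum_\rho 1/(s - \rho) + E(s)$ near $1/2 + it$, where $\rho = 1/2 + iy$ runs through the
  $O(L)$ nearby zeros, $E = O(L)$, and the logarithmic derivative of the functional equation on the
  critical line gives $\mathrm{Re}\, E \le - L/4 + O(1)$ there. Hence, for $\eta$ at most a small multiple of $1/L$,
  at $\rho'$ the sum $\sum_y \eta / (\eta^2 + (t - y)^2)$ has order $L$, and
  $\sum_y (t - y) / (\eta^2 + (t - y)^2)$ is $O(L)$.
  Let $\Delta$ be the length of the gap around $t$ and $d$ the distance from $t$ to its nearer endpoint,
  which by symmetry lies to the left of $t$.
  The zeros on the right contribute at most $O(L/\Delta)$ to the second sum, hence so do those on the left,
  all of which are at distance at least $d$; comparing with the first sum gives $d \Delta = O(\eta)$.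
  A single zero at distance $d$ contributes $\eta / (\eta^2 + d^2) = O(L)$, so $d^2 \gg \eta / L$, and
  therefore $\Delta = O(\eta / d) = O(\sqrt{\eta L})$. If $\eta \gg 1/L$ it suffices that gaps are bounded,
  which follows from a three circles argument for $\log \zeta$, as $|\zeta(-1/2 + iT)| \gg T$.

  The functional equation is proved for $s = -a$ with $0 < a < 1$ from
  $(1 - 2^{-s})(1 - 2^{1-s}) \zeta(s) = \sum_j ((4j+1)^{-s} - 2 (4j+2)^{-s} + (4j+3)^{-s})$:
  this series is a Mellin integral of $(\tanh x - \tanh (x/2))/2$, and the partial fraction expansion of
  $\tanh$ turns it into a multiple of $\zeta(1 - s)$.
\<close>

section \<open>Growth of the zeta function\<close>

text \<open>The sums over zeros have a definite sign only because the Riemann Hypothesis puts every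
  nearby zero on the critical line. On that line each term 1/(s - rho) is purely imaginary, so Re E
  equals the real part of zeta'/zeta there; this is how a one-sided bound of order L is found for an
  E that Landau's lemma controls only in modulus. Cauchy's estimate for E' carries the bound from
  1/2 + it to rho', and taking \<open>\<eta>\<close> at most a small multiple of 1/L keeps the
  change of E bounded.

  In the functional equation s = -a is chosen because all integrands and series terms are then
  nonnegative: every interchange is Tonelli's theorem, with no integrability to check. Second
  differences are used because their terms decay like j^(-Re s - 2), so that the series still
  converges to the left of 0.

  The functional equation serves three times: it confines the nonreal zeros to the open strip, it
  gives the size of zeta at real part -1/2, and its logarithmic derivative gives the sign of Re
  E.\<close>

lemma zeta_holomorphic: "1 \<notin> S \<Longrightarrow> zeta holomorphic_on S"
  using is_zeta_zeta unfolding is_zeta_def by (auto elim: holomorphic_on_subset)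

lemma zeta_eq_dirichlet_zeta: "Re s > 1 \<Longrightarrow> zeta s = dirichlet_zeta s"
  using is_zeta_zeta dirichlet_zeta_sums sums_unique2 unfolding is_zeta_def by blast

lemma zeta_sums: "Re s > 1 \<Longrightarrow> (\<lambda>n. of_nat (Suc n) powr (- s)) sums zeta s"
  using is_zeta_zeta unfolding is_zeta_def by blast

text \<open>The conjugated function again has the defining properties of zeta, so uniqueness
  identifies the two. On the critical line, where \<open>1 - s\<close> is \<open>cnj s\<close>, both
  sides of the functional equation then involve the same value.\<close>

lemma zeta_cnj: "zeta (cnj s) = cnj (zeta s)"
proof -
  have "is_zeta (cnj \<circ> zeta \<circ> cnj)"
    unfolding is_zeta_def
  proof (intro conjI allI impI)
    have "cnj ` (- {1}) = - {1 :: complex}"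
      by (auto simp: image_iff) (metis ComplI complex_cnj_cnj complex_cnj_one singletonD)
    then show "(cnj \<circ> zeta \<circ> cnj) holomorphic_on - {1}"
      by (intro holomorphic_on_compose_cnj_cnj zeta_holomorphic) auto
    show "(cnj \<circ> zeta \<circ> cnj) 1 = 0"
      using is_zeta_zeta by (simp add: is_zeta_def)
    fix s :: complex assume "Re s > 1"
    then have "(\<lambda>n. of_nat (Suc n) powr (- cnj s)) sums zeta (cnj s)"
      by (intro zeta_sums) simp
    then have "(\<lambda>n. cnj (of_nat (Suc n) powr (- cnj s))) sums cnj (zeta (cnj s))"
      by (simp only: sums_cnj)
    then show "(\<lambda>n. of_nat (Suc n) powr (- s)) sums (cnj \<circ> zeta \<circ> cnj) s"
      by (simp add: cnj_powr del: of_nat_Suc)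
  qed
  from is_zeta_unique[OF this is_zeta_zeta] show ?thesis
    by (metis comp_apply complex_cnj_cnj)
qed

text \<open>Growth bounds and identity-theorem arguments are run on such a \<open>Z\<close>, so that
  the pole of zeta needs no exception.\<close>

lemma zeta_times_entire:
  obtains Z where "Z holomorphic_on UNIV" "\<And>s. s \<noteq> 1 \<Longrightarrow> Z s = (s - 1) * zeta s"
proof -
  obtain Z where Z: "Z holomorphic_on UNIV"
      "\<And>s. Re s > 1 \<Longrightarrow> Z s = (s - 1) * dirichlet_zeta s"
    using zeta_continuation_entire by blast
  have "Z s = (s - 1) * zeta s" if "s \<noteq> 1" for s
  proof (rule analytic_continuation_open[where s = "{s. Re s > 1}" and s' = "- {1}"
            and f = Z and g = "\<lambda>s. (s - 1) * zeta s" and z = s])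
    show "{s. Re s > 1} \<noteq> {}" by (auto intro: exI[of _ 2])
    show "connected (- {1 :: complex})"
      by (rule connected_punctured_universe) simp
  qed (use that Z in \<open>auto simp: open_Re_greater zeta_eq_dirichlet_zeta
        intro!: holomorphic_intros zeta_holomorphic intro: holomorphic_on_subset\<close>)
  with Z(1) that show ?thesis by blast
qed

text \<open>Constant and exponent are quantified away: sums, products and shifts stay in the class,
  and an induction over half-planes need not track them.\<close>

definition poly_bounded_on :: "complex set \<Rightarrow> (complex \<Rightarrow> complex) \<Rightarrow> bool" where
  "poly_bounded_on S f \<longleftrightarrow> (\<exists>C N. C \<ge> 0 \<and> (\<forall>s\<in>S. norm (f s) \<le> C * (1 + norm s) ^ N))"

lemma poly_bounded_onI:
  assumes "\<And>s. s \<in> S \<Longrightarrow> norm (f s) \<le> C * (1 + norm s) ^ N"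
  shows "poly_bounded_on S f"
  unfolding poly_bounded_on_def
proof (intro exI[of _ "\<bar>C\<bar>"] exI[of _ N] conjI ballI)
  fix s assume "s \<in> S"
  then have "norm (f s) \<le> C * (1 + norm s) ^ N" by (rule assms)
  also have "\<dots> \<le> \<bar>C\<bar> * (1 + norm s) ^ N" by (intro mult_right_mono) auto
  finally show "norm (f s) \<le> \<bar>C\<bar> * (1 + norm s) ^ N" .
qed simp

lemma poly_bounded_on_cong:
  assumes "poly_bounded_on S g" "\<And>s. s \<in> S \<Longrightarrow> f s = g s"
  shows "poly_bounded_on S f"
  using assms unfolding poly_bounded_on_def by metis

lemma poly_bounded_on_const: "poly_bounded_on S (\<lambda>_. c)"
  by (rule poly_bounded_onI[of _ _ "norm c" 0]) simp

lemma poly_bounded_on_add: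
  assumes "poly_bounded_on S f" "poly_bounded_on S g"
  shows "poly_bounded_on S (\<lambda>s. f s + g s)"
proof -
  obtain C N where f: "C \<ge> 0" "\<And>s. s \<in> S \<Longrightarrow> norm (f s) \<le> C * (1 + norm s) ^ N"
    using assms(1) unfolding poly_bounded_on_def by blast
  obtain D M where g: "D \<ge> 0" "\<And>s. s \<in> S \<Longrightarrow> norm (g s) \<le> D * (1 + norm s) ^ M"
    using assms(2) unfolding poly_bounded_on_def by blast
  have "norm (f s + g s) \<le> (C + D) * (1 + norm s) ^ (N + M)" if "s \<in> S" for s
  proof -
    have "norm (f s + g s) \<le> norm (f s) + norm (g s)" by (rule norm_triangle_ineq)
    also have "\<dots> \<le> C * (1 + norm s) ^ N + D * (1 + norm s) ^ M"
      using f(2)[OF that] g(2)[OF that] by (rule add_mono)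
    also have "\<dots> \<le> C * (1 + norm s) ^ (N + M) + D * (1 + norm s) ^ (N + M)"
      using f(1) g(1) by (intro add_mono mult_left_mono power_increasing) auto
    finally show ?thesis by (simp add: algebra_simps)
  qed
  then show ?thesis by (rule poly_bounded_onI)
qed

lemma poly_bounded_on_mult:
  assumes "poly_bounded_on S f" "poly_bounded_on S g"
  shows "poly_bounded_on S (\<lambda>s. f s * g s)"
proof -
  obtain C N where f: "C \<ge> 0" "\<And>s. s \<in> S \<Longrightarrow> norm (f s) \<le> C * (1 + norm s) ^ N"
    using assms(1) unfolding poly_bounded_on_def by blast
  obtain D M where g: "D \<ge> 0" "\<And>s. s \<in> S \<Longrightarrow> norm (g s) \<le> D * (1 + norm s) ^ M"
    using assms(2) unfolding poly_bounded_on_def by blast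
  have "norm (f s * g s) \<le> (C * D) * (1 + norm s) ^ (N + M)" if "s \<in> S" for s
  proof -
    have "norm (f s * g s) \<le> (C * (1 + norm s) ^ N) * (D * (1 + norm s) ^ M)"
      unfolding norm_mult using f(1) f(2)[OF that] g(2)[OF that] by (intro mult_mono) auto
    then show ?thesis by (simp add: power_add mult_ac)
  qed
  then show ?thesis by (rule poly_bounded_onI)
qed

lemma poly_bounded_on_sum:
  assumes "\<And>i. i \<in> I \<Longrightarrow> poly_bounded_on S (f i)"
  shows "poly_bounded_on S (\<lambda>s. \<Sum>i\<in>I. f i s)"
  using assms by (induction I rule: infinite_finite_induct)
    (auto intro: poly_bounded_on_const poly_bounded_on_add)

lemma poly_bounded_on_shift:
  assumes "poly_bounded_on T f" "\<And>s. s \<in> S \<Longrightarrow> s + c \<in> T"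
  shows "poly_bounded_on S (\<lambda>s. f (s + c))"
proof -
  obtain C N where f: "C \<ge> 0" "\<And>s. s \<in> T \<Longrightarrow> norm (f s) \<le> C * (1 + norm s) ^ N"
    using assms(1) unfolding poly_bounded_on_def by blast
  have "norm (f (s + c)) \<le> (C * (1 + norm c) ^ N) * (1 + norm s) ^ N" if "s \<in> S" for s
  proof -
    have "norm (f (s + c)) \<le> C * (1 + norm (s + c)) ^ N"
      using assms(2)[OF that] by (rule f)
    also have "1 + norm (s + c) \<le> (1 + norm c) * (1 + norm s)"
    proof -
      have "norm (s + c) \<le> norm s + norm c" by (rule norm_triangle_ineq)
      moreover have "0 \<le> norm c * norm s" by simp
      ultimately show ?thesis unfolding ring_distribs mult_1_left mult_1_right by linarith
    qed
    then have "C * (1 + norm (s + c)) ^ N \<le> C * ((1 + norm c) * (1 + norm s)) ^ N"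
      using f(1) by (intro mult_left_mono power_mono) auto
    finally show ?thesis by (simp add: power_mult_distrib mult_ac)
  qed
  then show ?thesis by (rule poly_bounded_onI)
qed

lemma poly_bounded_on_falling: "poly_bounded_on S (falling j)"
proof (rule poly_bounded_onI)
  fix s :: complex
  have "norm (falling j s) \<le> (\<Prod>i<j. real j * (1 + norm s))"
    unfolding falling_def prod_norm[symmetric]
  proof (rule prod_mono, intro conjI)
    fix i assume "i \<in> {..<j}"
    then have i: "1 + real i \<le> real j" by auto
    have "norm (1 - s - of_nat i) \<le> norm (1 - s) + norm (of_nat i :: complex)"
      by (rule norm_triangle_ineq4)
    also have "norm (1 - s) \<le> 1 + norm s" by (metis norm_one norm_triangle_ineq4)
    also have "1 + norm s + norm (of_nat i :: complex) = 1 + real i + norm s" by simp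
    also have "\<dots> \<le> real j * (1 + norm s)"
    proof -
      have "1 * norm s \<le> real j * norm s" using i by (intro mult_right_mono) auto
      then show ?thesis using i by (simp add: algebra_simps)
    qed
    finally show "norm (1 - s - of_nat i) \<le> real j * (1 + norm s)" by simp
  qed simp
  then show "norm (falling j s) \<le> real j ^ j * (1 + norm s) ^ j"
    by (simp add: power_mult_distrib)
qed

text \<open>Summing the Taylor expansions of \<open>(n + 2) powr (1 - s)\<close> around
  \<open>n + 1\<close> telescopes and expresses \<open>Z s\<close> through \<open>Z (s + 1)\<close>,
  \<open>Z (s + 2)\<close> and so on, plus a remainder series that converges in the larger
  half-plane. Information about growth thus moves to the left.\<close>

lemma zeta_functional_recurrence:
  assumes Z: "Z holomorphic_on UNIV" "\<And>s. s \<noteq> 1 \<Longrightarrow> Z s = (s - 1) * zeta s"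
    and s: "Re s > - real k"
  shows "Z s = 1 + (\<Sum>n. taylor_rem (k + 2) n s) -
      (\<Sum>i<k + 1. falling (Suc i) s / fact (Suc (Suc i)) * Z (s + of_nat (Suc i)))"
    (is "_ = ?W s")
proof (rule analytic_continuation_open[where s = "{s. Re s > 1}" and s' = "{s. Re s > - real k}"
          and f = Z and g = ?W and z = s])
  show "{s. Re s > 1} \<noteq> {}" by (auto intro: exI[of _ 2])
  show "connected {s. Re s > - real k}" by (intro convex_connected convex_halfspace_Re_gt)
  have comp: "(\<lambda>s. Z (s + of_nat (Suc i))) holomorphic_on {s. Re s > - real k}" for i
    by (rule holomorphic_on_compose_gen[OF _ Z(1), unfolded o_def])
       (auto intro!: holomorphic_intros)
  show "?W holomorphic_on {s. Re s > - real k}"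
    by (intro holomorphic_intros comp taylor_rem_suminf_holomorphic falling_holomorphic) auto
  show "Z holomorphic_on {s. - real k < Re s}" using Z(1) by (rule holomorphic_on_subset) simp
next
  fix s :: complex assume "s \<in> {s. Re s > 1}"
  then have s: "Re s > 1" by simp
  have Z': "Z (s + of_nat i) = (s + of_nat i - 1) * dirichlet_zeta (s + of_nat i)" for i
    using s by (subst Z(2)) (auto simp: zeta_eq_dirichlet_zeta complex_eq_iff)
  have "(\<Sum>n. taylor_rem (k + 2) n s) =
          - 1 + (\<Sum>i<Suc (k + 1). falling i s / fact (Suc i) * Z (s + of_nat i))"
    using taylor_rem_sums[OF s, of "Suc (k + 1)"]
    by (intro sums_unique[symmetric]) (simp only: Z' add_2_eq_Suc' Suc_eq_plus1[symmetric])
  \<comment> \<open>The summand for \<open>i = 0\<close> is \<open>Z s\<close> itself, since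
    \<open>falling 0 s\<close> is an empty product.\<close>
  also have "(\<Sum>i<Suc (k + 1). falling i s / fact (Suc i) * Z (s + of_nat i)) = Z s +
      (\<Sum>i<k + 1. falling (Suc i) s / fact (Suc (Suc i)) * Z (s + of_nat (Suc i)))"
    by (subst sum.lessThan_Suc_shift) (simp add: falling_def)
  finally show "Z s = ?W s" by simp
qed (use s in \<open>auto simp: open_Re_greater\<close>)

lemma norm_zeta_le:
  assumes s: "Re s \<ge> 3/2"
  shows "norm (zeta s) \<le> (\<Sum>n. real (Suc n) powr (- (3/2)))"
proof -
  have le: "norm (of_nat (Suc n) powr (- s)) \<le> real (Suc n) powr (- (3/2))" for n
    unfolding norm_Suc_powr using s by (intro powr_mono) auto
  have sm: "summable (\<lambda>n. real (Suc n) powr (- (3/2)))" by (rule summable_Suc_powr) simp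
  have "zeta s = (\<Sum>n. of_nat (Suc n) powr (- s))"
    using zeta_sums[of s] s by (simp add: sums_iff)
  then show ?thesis using norm_suminf_le[OF le sm] by (simp only:)
qed

text \<open>Induction moves the half-plane left by one unit. The remainder series is bounded by
  \<open>falling\<close>, a polynomial in \<open>s\<close>, times a convergent sum of inverse
  squares; all other terms involve \<open>Z\<close> only at points shifted right by at least
  1.\<close>

lemma poly_bounded_on_zeta:
  assumes Z: "Z holomorphic_on UNIV" "\<And>s. s \<noteq> 1 \<Longrightarrow> Z s = (s - 1) * zeta s"
  shows "poly_bounded_on {s. Re s \<ge> 3/2 - real k} Z"
proof (induction k)
  case 0
  show ?case
  proof (rule poly_bounded_onI)
    fix s :: complex assume "s \<in> {s. Re s \<ge> 3/2 - real 0}"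
    then have s: "Re s \<ge> 3/2" by simp
    have "norm (zeta s) \<le> (\<Sum>n. real (Suc n) powr (- (3/2)))" using s by (rule norm_zeta_le)
    moreover have "norm (s - 1) \<le> (1 + norm s) ^ 1"
      using norm_triangle_ineq4[of s 1] by simp
    moreover have "Z s = (s - 1) * zeta s" using s by (intro Z) auto
    ultimately show "norm (Z s) \<le> (\<Sum>n. real (Suc n) powr (- (3/2))) * (1 + norm s) ^ 1"
      unfolding mult.commute[of _ "(1 + norm s) ^ 1"] by (simp only: norm_mult) (intro mult_mono, auto)
  qed
next
  case (Suc k)
  let ?S = "{s. Re s \<ge> 3/2 - real (Suc k)}"
  let ?W = "\<lambda>s. 1 + (\<Sum>n. taylor_rem (k + 2) n s) +
      (\<Sum>i<k + 1. ((- 1 / fact (Suc (Suc i))) * falling (Suc i) s) * Z (s + of_nat (Suc i)))"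
  have "poly_bounded_on ?S (\<lambda>s. \<Sum>n. taylor_rem (k + 2) n s)"
  proof -
    obtain C N where f: "\<And>s. norm (falling (Suc (k + 2)) s) \<le> C * (1 + norm s) ^ N"
      using poly_bounded_on_falling[of UNIV "Suc (k + 2)"] unfolding poly_bounded_on_def by blast
    have sm: "summable (\<lambda>n. real (Suc n) powr (- 2))" by (rule summable_Suc_powr) simp
    show ?thesis
    proof (rule poly_bounded_onI)
      fix s assume "s \<in> ?S"
      then have "norm (taylor_rem (k + 2) n s) \<le>
                   norm (falling (Suc (k + 2)) s) * real (Suc n) powr (- 2)" for n
        by (intro taylor_rem_bound) simp
      then have "norm (\<Sum>n. taylor_rem (k + 2) n s) \<le>
              (\<Sum>n. norm (falling (Suc (k + 2)) s) * real (Suc n) powr (- 2))"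
        by (rule norm_suminf_le[OF _ summable_mult[OF sm]])
      also have "\<dots> = norm (falling (Suc (k + 2)) s) * (\<Sum>n. real (Suc n) powr (- 2))"
        by (rule suminf_mult[OF sm])
      also have "\<dots> \<le> (C * (1 + norm s) ^ N) * (\<Sum>n. real (Suc n) powr (- 2))"
        using f suminf_nonneg[OF sm] by (intro mult_right_mono) auto
      finally show "norm (\<Sum>n. taylor_rem (k + 2) n s) \<le>
          (C * (\<Sum>n. real (Suc n) powr (- 2))) * (1 + norm s) ^ N" by (simp add: mult_ac)
    qed
  qed
  then have *: "poly_bounded_on ?S ?W"
    by (intro poly_bounded_on_add poly_bounded_on_const poly_bounded_on_sum poly_bounded_on_mult
          poly_bounded_on_falling poly_bounded_on_shift[OF Suc.IH]) auto
  have "Z s = ?W s" if "s \<in> ?S" for s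
  proof -
    have "Re s > - real k" using that by auto
    from zeta_functional_recurrence[OF Z this] 
    have "Z s = 1 + (\<Sum>n. taylor_rem (k + 2) n s) +
       (\<Sum>i<k + 1. - (falling (Suc i) s / fact (Suc (Suc i)) * Z (s + of_nat (Suc i))))"
      unfolding sum_negf diff_conv_add_uminus .
    then show ?thesis 
      by (simp only: minus_divide_left[symmetric] mult_minus_left times_divide_eq_left mult_1_left)
  qed
  with * show ?case by (rule poly_bounded_on_cong)
qed

section \<open>The Euler product and the line of real part one\<close>

lemma has_sum_Suc_iff: "((\<lambda>n. f (Suc n)) has_sum S) UNIV \<longleftrightarrow> (f has_sum S) {0<..}"
  by (rule has_sum_reindex_bij_betw) (auto simp: bij_betw_def image_iff gr0_conv_Suc)

lemma zeta_has_sum: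
  assumes "Re s > 1"
  shows "((\<lambda>n. of_nat n powr (- s)) has_sum zeta s) {0<..}"
proof -
  have "summable (\<lambda>n. norm (of_nat (Suc n) powr (- s)))"
    unfolding norm_Suc_powr using assms by (intro summable_Suc_powr) auto
  then have "((\<lambda>n. of_nat (Suc n) powr (- s)) has_sum zeta s) UNIV"
    using zeta_sums[OF assms] by (rule norm_summable_imp_has_sum)
  then show ?thesis by (rule has_sum_Suc_iff[where f = "\<lambda>n. of_nat n powr (- s)", THEN iffD1])
qed

definition unsieved :: "nat set \<Rightarrow> nat set" where
  "unsieved P = {n. n > 0 \<and> (\<forall>p\<in>P. \<not> p dvd n)}"

lemma powr_of_nat_mult:
  "of_nat (m * n) powr (s :: complex) = of_nat m powr s * of_nat n powr s"
  unfolding of_nat_mult by (rule powr_times_real) auto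

text \<open>A sieve: multiplying the series by \<open>1 - of_nat q powr (- s)\<close> deletes
  exactly the terms divisible by \<open>q\<close>. Unordered sums allow the index set to be split
  freely.\<close>

lemma euler_product_partial:
  assumes s: "Re s > 1" and P: "finite P" "\<And>p. p \<in> P \<Longrightarrow> prime p"
  shows "((\<lambda>n. of_nat n powr (- s)) has_sum (\<Prod>p\<in>P. 1 - of_nat p powr (- s)) * zeta s) (unsieved P)"
  using P
proof (induction P rule: finite_induct)
  case empty
  have "unsieved {} = {0<..}" by (auto simp: unsieved_def)
  then show ?case using zeta_has_sum[OF s] by simp
next
  case (insert q P)
  let ?f = "\<lambda>n. of_nat n powr (- s) :: complex"
  let ?S = "(\<Prod>p\<in>P. 1 - of_nat p powr (- s)) * zeta s"
  have IH: "(?f has_sum ?S) (unsieved P)" using insert by auto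
  have q: "prime q" using insert by auto
  have "((\<lambda>n. of_nat q powr (- s) * ?f n) has_sum (of_nat q powr (- s) * ?S)) (unsieved P)"
    using IH by (rule has_sum_cmult_right)
  then have "((?f \<circ> (*) q) has_sum (of_nat q powr (- s) * ?S)) (unsieved P)"
    by (simp only: o_def powr_of_nat_mult)
  then have "(?f has_sum (of_nat q powr (- s) * ?S)) ((*) q ` unsieved P)"
    using q by (subst has_sum_reindex) (auto simp: inj_on_def)
  moreover have "(*) q ` unsieved P \<subseteq> unsieved P"
  proof
    fix n assume "n \<in> (*) q ` unsieved P"
    then obtain m where m: "n = q * m" "m \<in> unsieved P" by auto
    have "\<not> p dvd q * m" if "p \<in> P" for p
    proof -
      have "prime p" "p \<noteq> q" using that insert.hyps insert.prems by auto
      then have "\<not> p dvd q" using q primes_dvd_imp_eq by blast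
      moreover have "\<not> p dvd m" using m that by (simp add: unsieved_def)
      ultimately show ?thesis using \<open>prime p\<close> prime_dvd_mult_nat by blast
    qed
    then show "n \<in> unsieved P" using m q by (auto simp: unsieved_def prime_gt_0_nat)
  qed
  ultimately have "(?f has_sum (?S - of_nat q powr (- s) * ?S)) (unsieved P - (*) q ` unsieved P)"
    using IH by (intro has_sum_Diff)
  moreover have "unsieved P - (*) q ` unsieved P = unsieved (insert q P)"
  proof (intro equalityI subsetI)
    fix n assume n: "n \<in> unsieved P - (*) q ` unsieved P"
    have "\<not> q dvd n"
    proof
      assume "q dvd n"
      then obtain m where m: "n = q * m" by (elim dvdE)
      with n have "m \<in> unsieved P" by (auto simp: unsieved_def)
      with m n show False by auto
    qed
    with n show "n \<in> unsieved (insert q P)" by (auto simp: unsieved_def)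
  qed (auto simp: unsieved_def)
  moreover have "?S - of_nat q powr (- s) * ?S =
      (\<Prod>p\<in>insert q P. 1 - of_nat p powr (- s)) * zeta s"
    using insert.hyps by (simp add: algebra_simps)
  ultimately show ?case by simp
qed

text \<open>After sieving by the primes up to \<open>N\<close>, every surviving index other than 1
  exceeds \<open>N\<close>. The distance to 1 is therefore at most a tail of the convergent series
  at \<open>Re s\<close>.\<close>

lemma euler_product_tendsto:
  assumes s: "Re s > 1"
  shows "(\<lambda>N. (\<Prod>p | prime p \<and> p \<le> N. 1 - of_nat p powr (- s)) * zeta s) \<longlonglongrightarrow> 1"
proof -
  let ?f = "\<lambda>n. of_nat n powr (- s) :: complex" and ?h = "\<lambda>n. real n powr (- Re s)"
  let ?E = "\<lambda>N. (\<Prod>p | prime p \<and> p \<le> N. 1 - of_nat p powr (- s)) * zeta s"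
  have h: "norm (?f n) = ?h n" if "n > 0" for n
    using that norm_Suc_powr[of "n - 1" "- s"] by (cases n) auto
  have sm: "summable (\<lambda>n. ?h (Suc n))"
    using s by (intro summable_Suc_powr) auto
  define S where "S = (\<Sum>n. ?h (Suc n))"
  have hs: "(?h has_sum S) {0<..}"
  proof -
    have "((\<lambda>n. ?h (Suc n)) has_sum S) UNIV"
      unfolding S_def using sm by (intro norm_summable_imp_has_sum summable_sums) auto
    then show ?thesis by (rule has_sum_Suc_iff[where f = ?h, THEN iffD1])
  qed
  have "norm (?E N - 1) \<le> S - (\<Sum>n<N. ?h (Suc n))" if "N \<ge> 1" for N
  proof -
    let ?P = "{p. prime p \<and> p \<le> N}"
    have fin: "finite ?P" by (rule finite_subset[of _ "{..N}"]) auto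
    have 1: "1 \<in> unsieved ?P" by (auto simp: unsieved_def)
    have fs: "(?f has_sum (?E N - ?f 1)) (unsieved ?P - {1})"
      by (rule has_sum_Diff[OF euler_product_partial[OF s fin]])
         (use 1 has_sum_finite[of "{1::nat}" ?f] in auto)
    have tail: "(?h has_sum (S - sum ?h {1..N})) ({0<..} - {1..N})"
      by (rule has_sum_Diff[OF hs has_sum_finite]) auto
    have sub: "unsieved ?P - {1} \<subseteq> {0<..} - {1..N}"
    proof
      fix n assume n: "n \<in> unsieved ?P - {1}"
      then have "n \<noteq> 1" by auto
      then obtain p where p: "prime p" "p dvd n" using prime_factor_nat by blast
      with n have "p > N" "n > 0" by (auto simp: unsieved_def)
      moreover have "p \<le> n" using p \<open>n > 0\<close> by (intro dvd_imp_le)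
      ultimately show "n \<in> {0<..} - {1..N}" by auto
    qed
    have "norm (?E N - ?f 1) \<le> S - sum ?h {1..N}"
    proof -
      have "?h summable_on (unsieved ?P - {1})"
        using tail sub summable_on_subset_banach summable_on_def by blast
      then obtain B where B: "(?h has_sum B) (unsieved ?P - {1})"
        by (auto simp: summable_on_def)
      moreover have "((\<lambda>n. norm (?f n)) has_sum B) (unsieved ?P - {1})"
        using B by (subst has_sum_cong[of _ _ ?h]) (auto simp: h unsieved_def)
      ultimately have "norm (?E N - ?f 1) \<le> B"
        using fs by (intro norm_has_sum_bound)
      also have "B \<le> S - sum ?h {1..N}"
        by (rule has_sum_mono_neutral[OF B tail]) (use sub in auto)
      finally show ?thesis .
    qed
    also have "sum ?h {1..N} = (\<Sum>n<N. ?h (Suc n))"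
      by (simp add: sum.atLeast1_atMost_eq)
    finally show ?thesis by simp
  qed
  then have "eventually (\<lambda>N. norm (?E N - 1) \<le> S - (\<Sum>n<N. ?h (Suc n))) sequentially"
    by (rule eventually_sequentiallyI)
  moreover have "(\<lambda>N. S - (\<Sum>n<N. ?h (Suc n))) \<longlonglongrightarrow> S - S"
    unfolding S_def using sm by (intro tendsto_diff tendsto_const summable_LIMSEQ)
  then have "(\<lambda>N. S - (\<Sum>n<N. ?h (Suc n))) \<longlonglongrightarrow> 0" by (simp only: diff_self)
  ultimately have "(\<lambda>N. ?E N - 1) \<longlonglongrightarrow> 0"
    by (rule Lim_null_comparison)
  then show ?thesis by (simp only: LIM_zero_iff)
qed

text \<open>In the series of the logarithms the \<open>n\<close>th term is a nonpositive multiple of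
  3 + 4 cos x + cos 2x = 2 (1 + cos x)^2. The bound is from above because these factors are the
  reciprocals of the Euler factors of zeta.\<close>

lemma three_four_one_factor:
  assumes r: "0 \<le> r" "r < 1" and z: "norm (z::complex) = 1"
  shows "norm (1 - of_real r :: complex) ^ 3 * norm (1 - of_real r * z) ^ 4 * norm (1 - of_real r * z\<^sup>2) \<le> 1"
proof -
  have ln: "(\<lambda>n. Re (- (w ^ n) / of_nat n)) sums Re (Ln (1 - w))" and ex: "norm (1 - w) = exp (Re (Ln (1 - w)))"
    if "norm w < 1" for w :: complex
  proof -
    have "(\<lambda>n. (- 1) ^ Suc n / of_nat n * (- w) ^ n) sums ln (1 + (- w))"
      using that by (intro Ln_series) simp
    moreover have "(- 1) ^ Suc n / of_nat n * (- w) ^ n = - (w ^ n) / of_nat n" for n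
    proof -
      have "(- 1) ^ Suc n / of_nat n * (- w) ^ n = - (((- 1) * (- w)) ^ n) / of_nat n"
        unfolding power_mult_distrib by simp
      then show ?thesis by simp
    qed
    ultimately have "(\<lambda>n. - (w ^ n) / of_nat n) sums Ln (1 - w)"
      by (simp only: diff_conv_add_uminus)
    then show "(\<lambda>n. Re (- (w ^ n) / of_nat n)) sums Re (Ln (1 - w))"
      by (rule sums_Re)
    have "1 - w \<noteq> 0" using that by auto
    then show "norm (1 - w) = exp (Re (Ln (1 - w)))" by (metis exp_Ln norm_exp_eq_Re)
  qed
  have n: "norm (of_real r :: complex) < 1" "norm (of_real r * z) < 1" "norm (of_real r * z\<^sup>2) < 1"
    using r z by (auto simp: norm_mult norm_power)
  let ?A = "3 * Re (Ln (1 - of_real r)) + 4 * Re (Ln (1 - of_real r * z)) + Re (Ln (1 - of_real r * z\<^sup>2))"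
  have gs: "(\<lambda>n. 3 * Re (- (of_real r ^ n) / of_nat n) + 4 * Re (- ((of_real r * z) ^ n) / of_nat n) +
          Re (- ((of_real r * z\<^sup>2) ^ n) / of_nat n)) sums ?A" (is "?g sums _")
    by (intro sums_add sums_mult ln n)
  have g: "?g n \<le> 0" for n
  proof -
    define u where "u = z ^ n"
    have u: "norm u = 1" using z by (simp add: u_def norm_power)
    have uu: "Re u ^ 2 + Im u ^ 2 = 1" using u cmod_power2[of u] by simp
    have e: "of_real r ^ n = (of_real (r ^ n) * 1 :: complex)" "(of_real r * z) ^ n = of_real (r ^ n) * u"
      "(of_real r * z\<^sup>2) ^ n = of_real (r ^ n) * u\<^sup>2"
      by (simp_all add: u_def power_mult_distrib power_mult[symmetric] mult.commute)
    have re: "Re (- (of_real x * v) / of_nat n) = - (x / real n) * Re v" for x v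
      by simp
    have "?g n = 3 * (- (r ^ n / real n) * Re 1) + 4 * (- (r ^ n / real n) * Re u) + - (r ^ n / real n) * Re (u\<^sup>2)"
      unfolding e re ..
    also have "\<dots> = - (r ^ n / real n) * (3 + 4 * Re u + Re (u\<^sup>2))"
      by (simp only: one_complex.sel) algebra
    also have "3 + 4 * Re u + Re (u\<^sup>2) = 2 * (1 + Re u)\<^sup>2"
      using uu by (simp add: power2_eq_square algebra_simps)
    also have "- (r ^ n / real n) * (2 * (1 + Re u)\<^sup>2) \<le> 0"
      using r by (intro mult_nonpos_nonneg) auto
    finally show ?thesis .
  qed
  have A: "?A \<le> 0" by (rule sums_le[OF g gs sums_zero])
  have "exp (3 * a + 4 * b + c) = exp a ^ 3 * exp b ^ 4 * exp c" for a b c :: real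
    by (simp add: exp_add exp_of_nat_mult[symmetric])
  then have "norm (1 - of_real r :: complex) ^ 3 * norm (1 - of_real r * z) ^ 4 *
      norm (1 - of_real r * z\<^sup>2) = exp ?A"
    by (simp only: ex n)
  also have "\<dots> \<le> 1" using A by (simp only: exp_le_one_iff)
  finally show ?thesis .
qed

lemma three_four_one:
  assumes \<sigma>: "\<sigma> > 1"
  shows "norm (zeta (Complex \<sigma> 0)) ^ 3 * norm (zeta (Complex \<sigma> t)) ^ 4 * norm (zeta (Complex \<sigma> (2 * t))) \<ge> 1"
proof -
  let ?E = "\<lambda>s N. (\<Prod>p | prime p \<and> p \<le> N. 1 - of_nat p powr (- s))"
  let ?F = "\<lambda>N. norm (?E (Complex \<sigma> 0) N * zeta (Complex \<sigma> 0)) ^ 3 *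
     norm (?E (Complex \<sigma> t) N * zeta (Complex \<sigma> t)) ^ 4 *
     norm (?E (Complex \<sigma> (2 * t)) N * zeta (Complex \<sigma> (2 * t)))"
  have "?F \<longlonglongrightarrow> norm (1::complex) ^ 3 * norm (1::complex) ^ 4 * norm (1::complex)"
    using \<sigma> by (intro tendsto_intros euler_product_tendsto) auto
  moreover have "?F N \<le> norm (zeta (Complex \<sigma> 0)) ^ 3 * norm (zeta (Complex \<sigma> t)) ^ 4 *
      norm (zeta (Complex \<sigma> (2 * t)))" (is "_ \<le> ?Z") for N
  proof -
    let ?e = "\<lambda>s p. norm (1 - of_nat p powr (- s) :: complex)"
    have "(\<Prod>p | prime p \<and> p \<le> N. ?e (Complex \<sigma> 0) p ^ 3 * ?e (Complex \<sigma> t) p ^ 4 *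
             ?e (Complex \<sigma> (2 * t)) p) \<le> (\<Prod>p | prime p \<and> p \<le> N. 1)"
    proof (intro prod_mono conjI)
      fix p :: nat assume "p \<in> {p. prime p \<and> p \<le> N}"
      then have p: "p > 1" using prime_gt_1_nat by auto
      define z where "z = of_nat p powr (- (\<i> * of_real t))"
      have pw: "of_nat p powr (- Complex \<sigma> (of_nat k * t)) = of_real (real p powr (- \<sigma>)) * z ^ k" for k
      proof -
        have "- Complex \<sigma> (of_nat k * t) = of_real (- \<sigma>) + of_nat k * (- (\<i> * of_real t))"
          by (simp add: complex_eq_iff)
        also have "of_nat p powr \<dots> = of_nat p powr of_real (- \<sigma>) * of_nat p powr (of_nat k * (- (\<i> * of_real t)))"
          using p by (subst powr_add) auto
        also have "of_nat p powr of_real (- \<sigma>) = (of_real (real p powr (- \<sigma>)) :: complex)"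
          using powr_of_real[of "real p" "- \<sigma>"] by simp
        also have "of_nat p powr (of_nat k * (- (\<i> * of_real t))) = z ^ k"
          using p by (simp add: z_def powr_def exp_of_nat_mult[symmetric] mult_ac)
        finally show ?thesis .
      qed
      have "norm z = 1" using p norm_powr_real_powr[of "of_nat p" "- (\<i> * of_real t)"] by (simp add: z_def)
      moreover have "real p powr (- \<sigma>) < 1" using p \<sigma> by (simp add: powr_less_one)
      ultimately show "?e (Complex \<sigma> 0) p ^ 3 * ?e (Complex \<sigma> t) p ^ 4 * ?e (Complex \<sigma> (2 * t)) p \<le> 1"
        using three_four_one_factor[of "real p powr (- \<sigma>)" z] pw[of 0] pw[of 1] pw[of 2] by simp
    qed auto
    then have le: "norm (?E (Complex \<sigma> 0) N) ^ 3 * norm (?E (Complex \<sigma> t) N) ^ 4 *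
        norm (?E (Complex \<sigma> (2 * t)) N) \<le> 1"
      by (simp only: prod.distrib prod_power_distrib[symmetric] prod_norm prod.neutral_const)
    have "?F N = (norm (?E (Complex \<sigma> 0) N) ^ 3 * norm (?E (Complex \<sigma> t) N) ^ 4 *
        norm (?E (Complex \<sigma> (2 * t)) N)) * ?Z"
      by (simp only: norm_mult power_mult_distrib mult_ac)
    also have "\<dots> \<le> 1 * ?Z"
      by (rule mult_right_mono[OF le]) auto
    finally show ?thesis by simp
  qed
  ultimately show ?thesis
    using LIMSEQ_le_const2[of ?F] by force
qed

text \<open>On the line of real part 1, a zero at 1 + it would make the 3-4-1 product tend to 0 as
  the real part decreases to 1: the pole enters to the third power, the zero to the fourth, and zeta
  stays bounded near 1 + 2it.\<close>

theorem zeta_nonzero: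
  assumes s: "Re s \<ge> 1" "s \<noteq> 1"
  shows "zeta s \<noteq> 0"
proof
  assume z: "zeta s = 0"
  show False
  proof (cases "Re s > 1")
    case True
    from euler_product_tendsto[OF this] have "(\<lambda>N::nat. 0 :: complex) \<longlonglongrightarrow> 1"
      unfolding z mult_zero_right .
    then show False using LIMSEQ_unique[OF tendsto_const] zero_neq_one by blast
  next
    case False
    define t where "t = Im s"
    from False s have st: "s = Complex 1 t" "t \<noteq> 0" by (auto simp: t_def complex_eq_iff)
    obtain Z where Z: "Z holomorphic_on UNIV" "\<And>s. s \<noteq> 1 \<Longrightarrow> Z s = (s - 1) * zeta s"
      using zeta_times_entire by metis
    let ?h = "\<lambda>h::real. of_real h :: complex"
    \<comment> \<open>With \<open>Z\<close> in place of the pole and a difference quotient in place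
      of the zero, every factor has a finite limit; what remains of \<open>h ^ 4\<close> against
      \<open>h ^ 3\<close> is the single factor \<open>h\<close>.\<close>
    let ?G = "\<lambda>h. norm (Z (1 + ?h h)) ^ 3 * norm ((zeta (s + ?h h) - zeta s) / ?h h) ^ 4 *
        norm (zeta (Complex 1 (2 * t) + ?h h)) * h"
    have lim0: "(?h \<longlongrightarrow> 0) (at_right 0)"
      using tendsto_of_real[OF tendsto_ident_at, of 0 "{0<..}"] by (simp only: of_real_0)
    have shift: "((\<lambda>h. w + ?h h) \<longlongrightarrow> w) (at_right 0)" for w
      using tendsto_add[OF tendsto_const lim0] by (simp only: add_0_right)
    have lim: "filterlim ?h (at 0) (at_right 0)"
      using lim0 by (auto simp: filterlim_at eventually_at_filter)
    have "isCont Z 1"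
      using Z(1) holomorphic_on_imp_continuous_on continuous_on_eq_continuous_at open_UNIV by blast
    then have l1: "((\<lambda>h. Z (1 + ?h h)) \<longlongrightarrow> Z 1) (at_right 0)"
      by (rule isCont_tendsto_compose) (rule shift)
    have hol: "zeta holomorphic_on - {1}" by (rule zeta_holomorphic) simp
    then have d: "(zeta has_field_derivative deriv zeta s) (at s)"
      by (rule holomorphic_derivI) (use s in auto)
    then have l2: "((\<lambda>h. (zeta (s + ?h h) - zeta s) / ?h h) \<longlongrightarrow> deriv zeta s) (at_right 0)"
      unfolding DERIV_def by (rule filterlim_compose[OF _ lim])
    have "isCont zeta (Complex 1 (2 * t))"
    proof -
      have "Complex 1 (2 * t) \<in> - {1}" using st(2) by (simp add: complex_eq_iff)
      moreover have "continuous_on (- {1}) zeta" using hol by (rule holomorphic_on_imp_continuous_on)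
      ultimately show ?thesis by (simp add: continuous_on_eq_continuous_at open_Compl)
    qed
    then have l3: "((\<lambda>h. zeta (Complex 1 (2 * t) + ?h h)) \<longlongrightarrow> zeta (Complex 1 (2 * t))) (at_right 0)"
      by (rule isCont_tendsto_compose) (rule shift)
    have "(?G \<longlongrightarrow> norm (Z 1) ^ 3 * norm (deriv zeta s) ^ 4 * norm (zeta (Complex 1 (2 * t))) * 0) (at_right 0)"
      by (intro tendsto_mult tendsto_power tendsto_norm l1 l2 l3 tendsto_ident_at)
    moreover have "eventually (\<lambda>h. ?G h \<ge> 1) (at_right 0)"
    proof (rule eventually_at_rightI[of 0 1])
      fix h :: real assume "h \<in> {0<..<1}"
      then have h: "h > 0" by simp
      have c: "1 + ?h h = Complex (1 + h) 0" "s + ?h h = Complex (1 + h) t"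
           "Complex 1 (2 * t) + ?h h = Complex (1 + h) (2 * t)"
        by (auto simp: complex_eq_iff st)
      have Zh: "Z (1 + ?h h) = ?h h * zeta (1 + ?h h)" using h by (subst Z(2)) auto
      have "?G h = norm (zeta (1 + ?h h)) ^ 3 * norm (zeta (s + ?h h)) ^ 4 * norm (zeta (Complex 1 (2 * t) + ?h h))"
      proof -
        have "(h * A) ^ 3 * (B / h) ^ 4 * C * h = A ^ 3 * B ^ 4 * C" for A B C :: real
        proof -
          have "(h * A) ^ 3 * (B / h) ^ 4 * C * h = h ^ 3 * h * inverse (h ^ 4) * (A ^ 3 * B ^ 4 * C)"
            unfolding power_mult_distrib power_divide divide_inverse power_inverse by (simp only: mult_ac)
          also have "h ^ 3 * h = h ^ 4" by (simp add: power4_eq_xxxx power3_eq_cube)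
          also have "h ^ 4 * inverse (h ^ 4) = 1" using h by (intro right_inverse) simp
          finally show ?thesis by (simp only: mult_1_left)
        qed
        moreover have "norm (?h h) = h" using h by simp
        ultimately show ?thesis unfolding Zh z diff_zero norm_mult norm_divide by (simp only:)
      qed
      also have "\<dots> \<ge> 1" unfolding c using h by (intro three_four_one) auto
      finally show "?G h \<ge> 1" .
    qed simp
    ultimately have "1 \<le> norm (Z 1) ^ 3 * norm (deriv zeta s) ^ 4 * norm (zeta (Complex 1 (2 * t))) * 0"
      by (rule tendsto_lowerbound[OF _ _ trivial_limit_at_right_real])
    then show False by simp
  qed
qed

section \<open>The functional equation\<close>

lemma nn_integral_swap:
  fixes f :: "real \<Rightarrow> real \<Rightarrow> ennreal"
  assumes [measurable]: "(\<lambda>(x, u). f x u) \<in> borel_measurable (lborel \<Otimes>\<^sub>M lborel)"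
    and g: "\<And>x. x > 0 \<Longrightarrow> (\<integral>\<^sup>+u. f x u \<partial>lborel) = g x"
  shows "(\<integral>\<^sup>+x\<in>{0<..}. g x \<partial>lborel) = (\<integral>\<^sup>+u. (\<integral>\<^sup>+x\<in>{0<..}. f x u \<partial>lborel) \<partial>lborel)"
proof -
  have "(\<integral>\<^sup>+x\<in>{0<..}. g x \<partial>lborel) = (\<integral>\<^sup>+x. (\<integral>\<^sup>+u. f x u * indicator {0<..} x \<partial>lborel) \<partial>lborel)"
    by (intro nn_integral_cong) (auto simp: indicator_def g)
  also have "\<dots> = (\<integral>\<^sup>+u. (\<integral>\<^sup>+x\<in>{0<..}. f x u \<partial>lborel) \<partial>lborel)"
    by (rule lborel_pair.Fubini') simp
  finally show ?thesis .
qed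

lemma nn_integral_Gamma_scaled:
  fixes p c :: real
  assumes p: "p > 0" and c: "c > 0"
  shows "(\<integral>\<^sup>+x\<in>{0<..}. ennreal (x powr (p - 1) * exp (- (c * x))) \<partial>lborel) =
           ennreal (Gamma p * c powr (- p))"
proof -
  let ?f = "\<lambda>t. ennreal (indicator {0..} t * t powr (p - 1) / exp t)"
  have "(\<integral>\<^sup>+x\<in>{0<..}. ennreal (x powr (p - 1) * exp (- (c * x))) \<partial>lborel) =
      (\<integral>\<^sup>+x. ennreal (c powr (- p)) * (ennreal c * ?f (0 + c * x)) \<partial>lborel)"
  proof (intro nn_integral_cong)
    fix x :: real
    show "ennreal (x powr (p - 1) * exp (- (c * x))) * indicator {0<..} x =
        ennreal (c powr (- p)) * (ennreal c * ?f (0 + c * x))"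
    proof (cases "x > 0")
      case True
      have "c powr (- p) * (c * ((c * x) powr (p - 1) / exp (c * x))) =
            (c powr (- p) * c powr 1 * c powr (p - 1)) * (x powr (p - 1) * exp (- (c * x)))"
        using c True by (simp add: powr_mult exp_minus divide_inverse)
      also have "c powr (- p) * c powr 1 * c powr (p - 1) = 1"
        using c by (simp only: powr_add[symmetric]) simp
      finally show ?thesis using True c by (simp add: ennreal_mult[symmetric])
    next
      case False
      then show ?thesis using c by (cases "x = 0") (auto simp: mult_less_0_iff indicator_def zero_le_mult_iff)
    qed
  qed
  also have "\<dots> = ennreal (c powr (- p)) * (ennreal c * (\<integral>\<^sup>+x. ?f (0 + c * x) \<partial>lborel))"
    by (simp add: nn_integral_cmult)
  also have "ennreal c * (\<integral>\<^sup>+x. ?f (0 + c * x) \<partial>lborel) = ennreal (Gamma p)"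
    using Gamma_conv_nn_integral_real[OF p] nn_integral_real_affine[of ?f c 0] c by simp
  finally show ?thesis
    using Gamma_real_pos[OF p] by (simp add: ennreal_mult[symmetric] mult.commute)
qed

text \<open>A single exponential against \<open>x powr (- a - 1)\<close> diverges at 0, the
  difference does not. Writing the difference as the integral of \<open>x * exp (- (u * x))\<close>
  over \<open>u\<close> from \<open>c\<close> to \<open>c + 1\<close> leaves Gamma integrals of
  positive parameter \<open>1 - a\<close>.\<close>

lemma nn_integral_exp_difference:
  fixes a c :: real
  assumes a: "0 < a" "a < 1" and c: "c > 0"
  shows "(\<integral>\<^sup>+x\<in>{0<..}. ennreal ((exp (- (c * x)) - exp (- ((c + 1) * x))) * x powr (- a - 1)) \<partial>lborel) =
           ennreal (Gamma (1 - a) / a * ((c + 1) powr a - c powr a))"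
proof -
  let ?f = "\<lambda>x u. ennreal (x powr (- a) * exp (- (u * x))) * indicator {c..c + 1} u"
  have "(\<integral>\<^sup>+x\<in>{0<..}. ennreal ((exp (- (c * x)) - exp (- ((c + 1) * x))) * x powr (- a - 1)) \<partial>lborel) =
      (\<integral>\<^sup>+u. (\<integral>\<^sup>+x\<in>{0<..}. ?f x u \<partial>lborel) \<partial>lborel)"
  proof (rule nn_integral_swap)
    show "(\<lambda>(x, u). ?f x u) \<in> borel_measurable (lborel \<Otimes>\<^sub>M lborel)"
      by (auto simp: case_prod_unfold cong: measurable_cong_sets)
    fix x :: real assume x: "x > 0"
    have "(\<integral>\<^sup>+u. ?f x u \<partial>lborel) =
        ennreal (- (x powr (- a - 1) * exp (- ((c + 1) * x))) - - (x powr (- a - 1) * exp (- (c * x))))"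
    proof (rule nn_integral_FTC_Icc)
      fix u :: real
      have "x powr (- a - 1) * x = x powr (- a)"
        using x powr_add[of x "- a - 1" 1] by simp
      then show "((\<lambda>u. - (x powr (- a - 1) * exp (- (u * x)))) has_real_derivative
          x powr (- a) * exp (- (u * x))) (at u)"
        by (auto intro!: derivative_eq_intros simp: mult_ac)
    qed auto
    then show "(\<integral>\<^sup>+u. ?f x u \<partial>lborel) = ennreal ((exp (- (c * x)) - exp (- ((c + 1) * x))) * x powr (- a - 1))"
      by (simp add: algebra_simps)
  qed
  also have "\<dots> = (\<integral>\<^sup>+u. ennreal (Gamma (1 - a) * u powr (a - 1)) * indicator {c..c + 1} u \<partial>lborel)"
  proof (intro nn_integral_cong)
    fix u :: real
    have "(\<integral>\<^sup>+x\<in>{0<..}. ?f x u \<partial>lborel) = (\<integral>\<^sup>+x\<in>{0<..}. ennreal (x powr ((1 - a) - 1) * exp (- (u * x))) \<partial>lborel) *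
          indicator {c..c + 1} u"
      by (auto simp: nn_integral_multc[symmetric] indicator_def intro!: nn_integral_cong)
    also have "\<dots> = ennreal (Gamma (1 - a) * u powr (a - 1)) * indicator {c..c + 1} u"
    proof (cases "u \<in> {c..c + 1}")
      case True
      then show ?thesis using a c by (subst nn_integral_Gamma_scaled) auto
    qed auto
    finally show "(\<integral>\<^sup>+x\<in>{0<..}. ?f x u \<partial>lborel) = ennreal (Gamma (1 - a) * u powr (a - 1)) * indicator {c..c + 1} u" .
  qed
  also have "\<dots> = ennreal (Gamma (1 - a) / a * (c + 1) powr a - Gamma (1 - a) / a * c powr a)"
    using a c Gamma_real_pos[of "1 - a"]
    by (intro nn_integral_FTC_Icc) (auto intro!: derivative_eq_intros)
  finally show ?thesis by (simp add: algebra_simps)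
qed

text \<open>The integrand is the difference of the first-difference integrands at \<open>c\<close>
  and at \<open>c + 1\<close>. The relation is proved as a sum and rearranged only once its terms
  are finite, since the integrals live in \<open>ennreal\<close>; that the sum dominates its summand
  also gives the sign of \<open>D\<close>.\<close>

lemma nn_integral_second_difference:
  fixes a c :: real
  assumes a: "0 < a" "a < 1" and c: "c > 0"
  defines "D \<equiv> (c + 1) powr a - c powr a - ((c + 2) powr a - (c + 1) powr a)"
  shows "(\<integral>\<^sup>+x\<in>{0<..}. ennreal (exp (- (c * x)) * (1 - exp (- x))\<^sup>2 * x powr (- a - 1)) \<partial>lborel) =
           ennreal (Gamma (1 - a) / a * D)" (is "?D = _")
    and "D \<ge> 0"
proof -
  let ?A = "\<lambda>c. (\<integral>\<^sup>+x\<in>{0<..}. ennreal ((exp (- (c * x)) - exp (- ((c + 1) * x))) * x powr (- a - 1)) \<partial>lborel)"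
  define g where "g = Gamma (1 - a) / a"
  have G: "g > 0" unfolding g_def using a by (intro divide_pos_pos Gamma_real_pos) auto
  have "?A c = (\<integral>\<^sup>+x. ennreal (exp (- (c * x)) * (1 - exp (- x))\<^sup>2 * x powr (- a - 1)) * indicator {0<..} x +
       ennreal ((exp (- ((c + 1) * x)) - exp (- ((c + 1 + 1) * x))) * x powr (- a - 1)) * indicator {0<..} x \<partial>lborel)"
  proof (intro nn_integral_cong)
    fix x :: real
    have "(exp (- (c * x)) - exp (- ((c + 1) * x))) * x powr (- a - 1) =
        exp (- (c * x)) * (1 - exp (- x))\<^sup>2 * x powr (- a - 1) +
        (exp (- ((c + 1) * x)) - exp (- ((c + 1 + 1) * x))) * x powr (- a - 1)"
    proof -
      have "exp (- ((c + 1) * x)) = exp (- (c * x)) * exp (- x)"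
           "exp (- ((c + 1 + 1) * x)) = exp (- (c * x)) * exp (- x) * exp (- x)"
        by (simp_all add: exp_add[symmetric] algebra_simps)
      then show ?thesis by (simp add: power2_eq_square algebra_simps)
    qed
    moreover have "(exp (- ((c + 1) * x)) - exp (- ((c + 1 + 1) * x))) * x powr (- a - 1) \<ge> 0" if "x > 0"
      using that by (intro mult_nonneg_nonneg) auto
    ultimately show "ennreal ((exp (- (c * x)) - exp (- ((c + 1) * x))) * x powr (- a - 1)) * indicator {0<..} x =
       ennreal (exp (- (c * x)) * (1 - exp (- x))\<^sup>2 * x powr (- a - 1)) * indicator {0<..} x +
       ennreal ((exp (- ((c + 1) * x)) - exp (- ((c + 1 + 1) * x))) * x powr (- a - 1)) * indicator {0<..} x"
      by (auto simp: indicator_def ennreal_plus[symmetric] simp del: ennreal_plus)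
  qed
  also have "\<dots> = ?D + ?A (c + 1)"
    by (rule nn_integral_add) auto
  finally have eq: "ennreal (g * ((c + 1) powr a - c powr a)) =
      ?D + ennreal (g * ((c + 1 + 1) powr a - (c + 1) powr a))"
    using a c by (simp only: nn_integral_exp_difference add_pos_pos zero_less_one g_def)
  have nn: "(c + 1 + 1) powr a - (c + 1) powr a \<ge> 0" "(c + 1) powr a - c powr a \<ge> 0"
    using a c by (auto intro!: powr_mono2)
  have "ennreal (g * ((c + 1 + 1) powr a - (c + 1) powr a)) \<le> ennreal (g * ((c + 1) powr a - c powr a))"
    unfolding eq by simp
  then have le: "g * ((c + 1 + 1) powr a - (c + 1) powr a) \<le> g * ((c + 1) powr a - c powr a)"
    using G nn by (subst (asm) ennreal_le_iff) auto
  then have "(c + 1 + 1) powr a - (c + 1) powr a \<le> (c + 1) powr a - c powr a"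
    using G by (simp only: mult_le_cancel_left_pos)
  then show "D \<ge> 0" by (simp add: D_def add.assoc)
  have "?D = ennreal (g * ((c + 1) powr a - c powr a)) - ennreal (g * ((c + 1 + 1) powr a - (c + 1) powr a))"
    unfolding eq by simp
  also have "\<dots> = ennreal (g * ((c + 1) powr a - c powr a) - g * ((c + 1 + 1) powr a - (c + 1) powr a))"
    using G nn by (intro ennreal_minus mult_nonneg_nonneg) auto
  finally have "?D = ennreal (g * D)"
    by (simp add: D_def algebra_simps)
  then show "?D = ennreal (Gamma (1 - a) / a * D)" by (simp only: g_def)
qed

text \<open>Tonelli twice. Writing 1/(x^2 + b^2) as the integral of 1/(t + b^2)^2 over t \<ge> x^2
  makes the integral over \<open>x\<close> an elementary power of \<open>t\<close>. A Gamma integral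
  for 1/(t + b^2)^2 then separates \<open>t\<close> from \<open>b\<close> and leaves two Gamma
  integrals, one in \<open>t\<close> and one in \<open>v\<close>.\<close>

lemma nn_integral_powr_over_quadratic:
  fixes a b :: real
  assumes a: "0 < a" "a < 1" and b: "b > 0"
  shows "(\<integral>\<^sup>+x\<in>{0<..}. ennreal (x powr (- a) / (x\<^sup>2 + b\<^sup>2)) \<partial>lborel) =
           ennreal (Gamma ((3 - a) / 2) * Gamma ((1 + a) / 2) / (1 - a) * b powr (- 1 - a))"
proof -
  let ?f = "\<lambda>x t. ennreal (x powr (- a) * (1 / (t + b\<^sup>2)\<^sup>2)) * indicator {x\<^sup>2..} t"
  have "(\<integral>\<^sup>+x\<in>{0<..}. ennreal (x powr (- a) / (x\<^sup>2 + b\<^sup>2)) \<partial>lborel) =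
      (\<integral>\<^sup>+t. (\<integral>\<^sup>+x\<in>{0<..}. ?f x t \<partial>lborel) \<partial>lborel)"
  proof (rule nn_integral_swap)
    have [measurable]: "{z :: real \<times> real. (fst z)\<^sup>2 \<le> snd z} \<in> sets (borel \<Otimes>\<^sub>M borel)"
      unfolding borel_prod by (intro borel_closed closed_Collect_le continuous_intros)
    have "(\<lambda>(x, t). ?f x t) = (\<lambda>z. ennreal (fst z powr (- a) * (1 / (snd z + b\<^sup>2)\<^sup>2)) *
        indicator {z. (fst z)\<^sup>2 \<le> snd z} z)"
      by (auto simp: fun_eq_iff indicator_def)
    then show "(\<lambda>(x, t). ?f x t) \<in> borel_measurable (lborel \<Otimes>\<^sub>M lborel)"
      by (simp cong: measurable_cong_sets)
    fix x :: real assume x: "x > 0"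
    have "(\<integral>\<^sup>+t. ?f x t \<partial>lborel) = ennreal (0 - (- (x powr (- a) / (x\<^sup>2 + b\<^sup>2))))"
    proof (rule nn_integral_FTC_atLeast[where F = "\<lambda>t. - (x powr (- a) / (t + b\<^sup>2))"])
      fix t :: real assume t: "x\<^sup>2 \<le> t"
      moreover have "x\<^sup>2 \<ge> 0" "b\<^sup>2 > 0" using b by auto
      ultimately have "t + b\<^sup>2 > 0" by linarith
      then show "((\<lambda>t. - (x powr (- a) / (t + b\<^sup>2))) has_real_derivative x powr (- a) * (1 / (t + b\<^sup>2)\<^sup>2)) (at t)"
        by (auto intro!: derivative_eq_intros simp: power2_eq_square)
    next
      have "((\<lambda>t. - (x powr (- a) / (t + b\<^sup>2))) \<longlongrightarrow> - 0) at_top"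
      proof (intro tendsto_minus real_tendsto_divide_at_top[OF tendsto_const])
        show "filterlim (\<lambda>t. t + b\<^sup>2) at_top at_top"
          using filterlim_tendsto_add_at_top[OF tendsto_const filterlim_ident, of "b\<^sup>2"]
          by (simp add: add.commute)
      qed
      then show "((\<lambda>t. - (x powr (- a) / (t + b\<^sup>2))) \<longlongrightarrow> 0) at_top" by simp
    qed auto
    then show "(\<integral>\<^sup>+t. ?f x t \<partial>lborel) = ennreal (x powr (- a) / (x\<^sup>2 + b\<^sup>2))" by simp
  qed
  also have "\<dots> = (\<integral>\<^sup>+t\<in>{0<..}. ennreal (t powr ((1 - a) / 2) / (1 - a) * (1 / (t + b\<^sup>2)\<^sup>2)) \<partial>lborel)"
  proof (intro nn_integral_cong)
    fix t :: real
    show "(\<integral>\<^sup>+x\<in>{0<..}. ?f x t \<partial>lborel) =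
       ennreal (t powr ((1 - a) / 2) / (1 - a) * (1 / (t + b\<^sup>2)\<^sup>2)) * indicator {0<..} t"
    proof (cases "t > 0")
      case True
      have iff: "x\<^sup>2 \<le> t \<longleftrightarrow> x \<le> sqrt t" if "x > 0" for x
        using that True by (metis abs_of_pos real_sqrt_abs real_sqrt_le_iff)
      have "(\<integral>\<^sup>+x\<in>{0<..}. ?f x t \<partial>lborel) =
          (\<integral>\<^sup>+x. (ennreal (x powr (- a)) * indicator {0..sqrt t} x) * ennreal (1 / (t + b\<^sup>2)\<^sup>2) \<partial>lborel)"
        by (intro nn_integral_cong) (auto simp: indicator_def iff ennreal_mult[symmetric])
      also have "\<dots> = (\<integral>\<^sup>+x. ennreal (x powr (- a)) * indicator {0..sqrt t} x \<partial>lborel) * ennreal (1 / (t + b\<^sup>2)\<^sup>2)"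
        by (rule nn_integral_multc) auto
      also have "(\<integral>\<^sup>+x. ennreal (x powr (- a)) * indicator {0..sqrt t} x \<partial>lborel) =
          ennreal (sqrt t powr (- a + 1) / (- a + 1))"
        by (rule nn_integral_has_integral_lebesgue'[OF _ has_integral_powr_from_0]) (use a True in auto)
      also have "sqrt t powr (- a + 1) = t powr ((1 - a) / 2)"
        using True by (simp add: powr_half_sqrt[symmetric] powr_powr)
      finally show ?thesis using True a by (simp add: ennreal_mult[symmetric])
    next
      case False
      have "?f x t * indicator {0<..} x = 0" for x
        using False by (auto simp: indicator_def) (metis less_le_trans not_le order_less_imp_le zero_less_power)
      with False show ?thesis by (subst nn_integral_cong[of _ _ "\<lambda>_. 0"]) simp_all
    qed
  qed
  also have "\<dots> = (\<integral>\<^sup>+v. (\<integral>\<^sup>+t\<in>{0<..}. ennreal (t powr ((1 - a) / 2) / (1 - a) *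
      (v powr (2 - 1) * exp (- ((t + b\<^sup>2) * v)))) * indicator {0<..} v \<partial>lborel) \<partial>lborel)"
  proof (rule nn_integral_swap)
    show "(\<lambda>(t, v). ennreal (t powr ((1 - a) / 2) / (1 - a) * (v powr (2 - 1) * exp (- ((t + b\<^sup>2) * v)))) *
        indicator {0<..} v) \<in> borel_measurable (lborel \<Otimes>\<^sub>M lborel)"
      by (auto simp: case_prod_unfold cong: measurable_cong_sets)
    fix t :: real assume t: "t > 0"
    let ?C = "t powr ((1 - a) / 2) / (1 - a)"
    have C: "?C \<ge> 0" using a by simp
    have tb: "t + b\<^sup>2 > 0" using t b by (simp add: add_pos_pos)
    have "(\<integral>\<^sup>+v. ennreal (?C * (v powr (2 - 1) * exp (- ((t + b\<^sup>2) * v)))) * indicator {0<..} v \<partial>lborel) =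
        (\<integral>\<^sup>+v. ennreal ?C * (ennreal (v powr (2 - 1) * exp (- ((t + b\<^sup>2) * v))) * indicator {0<..} v) \<partial>lborel)"
      using C by (intro nn_integral_cong) (auto simp: indicator_def ennreal_mult[symmetric])
    also have "\<dots> = ennreal ?C * (\<integral>\<^sup>+v\<in>{0<..}. ennreal (v powr (2 - 1) * exp (- ((t + b\<^sup>2) * v))) \<partial>lborel)"
      by (rule nn_integral_cmult) auto
    also have "\<dots> = ennreal ?C * ennreal (Gamma 2 * (t + b\<^sup>2) powr (- 2))"
      using tb by (subst nn_integral_Gamma_scaled) auto
    also have "Gamma 2 * (t + b\<^sup>2) powr (- 2) = 1 / (t + b\<^sup>2)\<^sup>2"
      using tb by (simp add: Gamma_numeral powr_minus powr_numeral divide_inverse)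
    finally show "(\<integral>\<^sup>+v. ennreal (?C * (v powr (2 - 1) * exp (- ((t + b\<^sup>2) * v)))) * indicator {0<..} v \<partial>lborel) =
        ennreal (?C * (1 / (t + b\<^sup>2)\<^sup>2))"
      using C by (simp add: ennreal_mult[symmetric])
  qed
  also have "\<dots> = (\<integral>\<^sup>+v. ennreal (Gamma ((3 - a) / 2) / (1 - a)) *
      (ennreal (v powr ((1 + a) / 2 - 1) * exp (- (b\<^sup>2 * v))) * indicator {0<..} v) \<partial>lborel)"
  proof (intro nn_integral_cong)
    fix v :: real
    show "(\<integral>\<^sup>+t\<in>{0<..}. ennreal (t powr ((1 - a) / 2) / (1 - a) *
      (v powr (2 - 1) * exp (- ((t + b\<^sup>2) * v)))) * indicator {0<..} v \<partial>lborel) =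
      ennreal (Gamma ((3 - a) / 2) / (1 - a)) *
      (ennreal (v powr ((1 + a) / 2 - 1) * exp (- (b\<^sup>2 * v))) * indicator {0<..} v)"
    proof (cases "v > 0")
      case True
      let ?C = "v * exp (- (b\<^sup>2 * v)) / (1 - a)"
      have C: "?C \<ge> 0" using a True by simp
      have "(\<integral>\<^sup>+t\<in>{0<..}. ennreal (t powr ((1 - a) / 2) / (1 - a) *
          (v powr (2 - 1) * exp (- ((t + b\<^sup>2) * v)))) * indicator {0<..} v \<partial>lborel) =
          (\<integral>\<^sup>+t. ennreal ?C * (ennreal (t powr ((3 - a) / 2 - 1) * exp (- (v * t))) * indicator {0<..} t) \<partial>lborel)"
      proof (intro nn_integral_cong)
        fix t :: real
        have "t powr ((1 - a) / 2) / (1 - a) * (v powr (2 - 1) * exp (- ((t + b\<^sup>2) * v))) =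
            ?C * (t powr ((3 - a) / 2 - 1) * exp (- (v * t)))"
        proof -
          have e1: "(3 - a) / 2 - 1 = (1 - a) / 2" by (simp add: field_simps)
          have e2: "exp (- ((t + b\<^sup>2) * v)) = exp (- (b\<^sup>2 * v)) * exp (- (v * t))"
            by (simp add: exp_add[symmetric] algebra_simps)
          show ?thesis unfolding e1 e2 using True by simp
        qed
        then show "ennreal (t powr ((1 - a) / 2) / (1 - a) *
          (v powr (2 - 1) * exp (- ((t + b\<^sup>2) * v)))) * indicator {0<..} v * indicator {0<..} t =
          ennreal ?C * (ennreal (t powr ((3 - a) / 2 - 1) * exp (- (v * t))) * indicator {0<..} t)"
          using C True by (simp only:) (auto simp: indicator_def ennreal_mult[symmetric])
      qed
      also have "\<dots> = ennreal ?C * (\<integral>\<^sup>+t\<in>{0<..}. ennreal (t powr ((3 - a) / 2 - 1) * exp (- (v * t))) \<partial>lborel)"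
        by (rule nn_integral_cmult) auto
      also have "\<dots> = ennreal ?C * ennreal (Gamma ((3 - a) / 2) * v powr (- ((3 - a) / 2)))"
        using a True by (subst nn_integral_Gamma_scaled) auto
      also have "\<dots> = ennreal (?C * (Gamma ((3 - a) / 2) * v powr (- ((3 - a) / 2))))"
        using C a Gamma_real_pos[of "(3 - a) / 2"] by (simp add: ennreal_mult[symmetric])
      also have "?C * (Gamma ((3 - a) / 2) * v powr (- ((3 - a) / 2))) =
          Gamma ((3 - a) / 2) / (1 - a) * (v powr ((1 + a) / 2 - 1) * exp (- (b\<^sup>2 * v)))"
      proof -
        have "v * v powr (- ((3 - a) / 2)) = v powr 1 * v powr (- ((3 - a) / 2))" using True by simp
        also have "\<dots> = v powr (1 + - ((3 - a) / 2))" by (rule powr_add[symmetric])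
        also have "1 + - ((3 - a) / 2) = (1 + a) / 2 - 1" by (simp add: field_simps)
        finally have *: "v * v powr (- ((3 - a) / 2)) = v powr ((1 + a) / 2 - 1)" .
        show ?thesis unfolding *[symmetric] by (simp only: divide_inverse mult_ac)
      qed
      finally show ?thesis
        using True a Gamma_real_pos[of "(3 - a) / 2"] by (simp add: ennreal_mult[symmetric])
    qed auto
  qed
  also have "\<dots> = ennreal (Gamma ((3 - a) / 2) / (1 - a)) *
      (\<integral>\<^sup>+v\<in>{0<..}. ennreal (v powr ((1 + a) / 2 - 1) * exp (- (b\<^sup>2 * v))) \<partial>lborel)"
    by (rule nn_integral_cmult) auto
  also have "\<dots> = ennreal (Gamma ((3 - a) / 2) / (1 - a)) *
      ennreal (Gamma ((1 + a) / 2) * (b\<^sup>2) powr (- ((1 + a) / 2)))"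
    using a b by (subst nn_integral_Gamma_scaled) auto
  also have "(b\<^sup>2) powr (- ((1 + a) / 2)) = b powr (- 1 - a)"
  proof -
    have "(b\<^sup>2) powr (- ((1 + a) / 2)) = (b powr 2) powr (- ((1 + a) / 2))"
      using b by (simp add: powr_numeral)
    also have "\<dots> = b powr (2 * - ((1 + a) / 2))" by (rule powr_powr)
    also have "2 * - ((1 + a) / 2) = - 1 - a" by (simp add: field_simps)
    finally show ?thesis .
  qed
  finally show ?thesis
    using a Gamma_real_pos[of "(3 - a) / 2"] Gamma_real_pos[of "(1 + a) / 2"]
    by (simp add: ennreal_mult[symmetric])
qed

section \<open>Partial fractions of tanh, and one Mellin integral evaluated in two ways\<close>

lemma Re_pos_not_nonpos_Int: "Re z > 0 \<Longrightarrow> z \<notin> \<int>\<^sub>\<le>\<^sub>0"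
  by (auto elim!: nonpos_Ints_cases)

lemma cos_i_times_of_real: "cos (\<i> * of_real y) = (of_real (cosh y) :: complex)"
  unfolding cosh_conv_cos[symmetric]
  by (simp add: cosh_def scaleR_conv_of_real flip: exp_of_real)

lemma sin_i_times_of_real: "sin (\<i> * of_real y) = \<i> * (of_real (sinh y) :: complex)"
proof -
  have "of_real (sinh y) = - \<i> * sin (\<i> * of_real y)"
    unfolding sinh_conv_sin[symmetric]
    by (simp add: sinh_def scaleR_conv_of_real flip: exp_of_real)
  then show ?thesis by simp
qed

text \<open>This is the logarithmic derivative of the reflection formula at z = 1/2 + i y/pi, where
  the sine and cosine of pi z are cosh y and -i sinh y. It gives i pi tanh y as a difference of two
  \<open>Digamma\<close> values, and the imaginary parts of the \<open>Digamma\<close> series are pi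
  times the stated terms.\<close>

lemma tanh_sums:
  fixes y :: real
  shows "(\<lambda>n. 2 * y / (y\<^sup>2 + ((real n + 1 / 2) * pi)\<^sup>2)) sums tanh y"
proof -
  define z :: complex where "z = Complex (1/2) (y / pi)"
  have Re: "Re z = 1/2" "Re (1 - z) = 1/2" by (auto simp: z_def)
  have nz: "z \<noteq> 0" "1 - z \<noteq> 0" using Re by (metis zero_complex.sel(1) divide_eq_0_iff zero_neq_one zero_neq_numeral)+
  have d1: "((\<lambda>z. rGamma z * rGamma (1 - z)) has_field_derivative
      rGamma z * rGamma (1 - z) * (Digamma (1 - z) - Digamma z)) (at z)"
  proof -
    have np: "z \<notin> \<int>\<^sub>\<le>\<^sub>0" "1 - z \<notin> \<int>\<^sub>\<le>\<^sub>0"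
      using Re_pos_not_nonpos_Int[of z] Re_pos_not_nonpos_Int[of "1 - z"] unfolding Re by auto
    have "((\<lambda>z. 1 - z) has_field_derivative - 1) (at z)"
      by (auto intro!: derivative_eq_intros)
    from DERIV_chain2[OF has_field_derivative_rGamma_no_nonpos_int[OF np(2)] this]
    have "((\<lambda>z. rGamma (1 - z)) has_field_derivative (- rGamma (1 - z) * Digamma (1 - z)) * (- 1)) (at z)" .
    from DERIV_mult[OF has_field_derivative_rGamma_no_nonpos_int[OF np(1)] this]
    show ?thesis by (simp add: algebra_simps)
  qed
  have "((\<lambda>z. sin (of_real pi * z) / of_real pi) has_field_derivative cos (of_real pi * z)) (at z)"
    by (auto intro!: derivative_eq_intros)
  moreover have "(\<lambda>z. sin (of_real pi * z) / of_real pi) = (\<lambda>z::complex. rGamma z * rGamma (1 - z))"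
    by (simp add: rGamma_reflection_complex)
  ultimately have "cos (of_real pi * z) = rGamma z * rGamma (1 - z) * (Digamma (1 - z) - Digamma z)"
    using d1 DERIV_unique by metis
  then have 1: "cos (of_real pi * z) = sin (of_real pi * z) / of_real pi * (Digamma (1 - z) - Digamma z)"
    by (simp add: rGamma_reflection_complex)
  have pz: "of_real pi * z = of_real (pi / 2) + \<i> * of_real y"
    by (simp add: z_def complex_eq_iff)
  have "sin (of_real pi * z) = of_real (cosh y)"
    unfolding pz sin_add cos_i_times_of_real by (simp add: cos_of_real sin_of_real)
  moreover have "cos (of_real pi * z) = - \<i> * of_real (sinh y)"
    unfolding pz cos_add sin_i_times_of_real by (simp add: cos_of_real sin_of_real)
  ultimately have "Digamma z - Digamma (1 - z) = \<i> * of_real (pi * tanh y)"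
    using 1 by (simp add: tanh_def field_simps)
  moreover have "(\<lambda>n. inverse (1 - z + of_nat n) - inverse (z + of_nat n)) sums (Digamma z - Digamma (1 - z))"
    using sums_diff[OF summable_sums[OF summable_Digamma[OF nz(1)]] summable_sums[OF summable_Digamma[OF nz(2)]]]
    by (simp add: Digamma_def)
  ultimately have "(\<lambda>n. Im (inverse (1 - z + of_nat n) - inverse (z + of_nat n))) sums (pi * tanh y)"
    using sums_Im by fastforce
  moreover have "Im (inverse (1 - z + of_nat n) - inverse (z + of_nat n)) =
      pi * (2 * y / (y\<^sup>2 + ((real n + 1 / 2) * pi)\<^sup>2))" for n
  proof -
    have "(real n + 1/2)\<^sup>2 + (y / pi)\<^sup>2 = (y\<^sup>2 + ((real n + 1 / 2) * pi)\<^sup>2) / pi\<^sup>2"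
      by (simp add: power_mult_distrib power_divide add_divide_distrib)
    then have "Im (inverse (1 - z + of_nat n) - inverse (z + of_nat n)) =
        2 * (y / pi) / ((y\<^sup>2 + ((real n + 1 / 2) * pi)\<^sup>2) / pi\<^sup>2)"
      by (simp add: z_def add.commute)
    then show ?thesis by (simp add: power2_eq_square)
  qed
  ultimately have "(\<lambda>n. pi * (2 * y / (y\<^sup>2 + ((real n + 1 / 2) * pi)\<^sup>2))) sums (pi * tanh y)"
    by simp
  then show ?thesis by (subst (asm) sums_mult_iff) auto
qed

text \<open>With q = exp (-x) this is a geometric series of ratio q^4. Its sum q (1 - q) / ((1 + q)
  (1 + q^2)) splits into the two tanh terms.\<close>

lemma exp_block_sums:
  fixes x :: real
  assumes x: "x > 0"
  shows "(\<lambda>j. exp (- (real (4 * j + 1) * x)) * (1 - exp (- x))\<^sup>2) sums ((tanh x - tanh (x / 2)) / 2)"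
proof -
  define q where "q = exp (- x)"
  have q: "0 < q" "q < 1" using x by (auto simp: q_def)
  have "(\<lambda>j. (q ^ 4) ^ j * (q * (1 - q)\<^sup>2)) sums (1 / (1 - q ^ 4) * (q * (1 - q)\<^sup>2))"
    using q by (intro sums_mult2 geometric_sums) (simp add: power_less_one_iff)
  moreover have "exp (- (real (4 * j + 1) * x)) = (q ^ 4) ^ j * q" for j
  proof -
    have "exp (- (real (4 * j + 1) * x)) = exp (real (4 * j + 1) * (- x))" by simp
    also have "\<dots> = q ^ (4 * j + 1)" unfolding q_def by (rule exp_of_nat_mult)
    also have "\<dots> = (q ^ 4) ^ j * q" by (simp add: power_mult)
    finally show ?thesis .
  qed
  moreover have "1 / (1 - q ^ 4) * (q * (1 - q)\<^sup>2) = (tanh x - tanh (x / 2)) / 2"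
  proof -
    have t: "tanh x = (1 - q\<^sup>2) / (1 + q\<^sup>2)" "tanh (x / 2) = (1 - q) / (1 + q)"
      by (simp_all add: tanh_real_altdef q_def exp_double[symmetric])
    have nz: "1 - q \<noteq> 0" "1 + q \<noteq> 0" "1 + q\<^sup>2 \<noteq> 0" using q by (auto simp: add_eq_0_iff2) 
       (smt (verit) zero_le_power2)
    have "1 - q ^ 4 = (1 - q) * (1 + q) * (1 + q\<^sup>2)" by algebra
    then have "1 / (1 - q ^ 4) * (q * (1 - q)\<^sup>2) = q * (1 - q) / ((1 + q) * (1 + q\<^sup>2))"
      using nz by (simp add: power2_eq_square)
    also have "\<dots> = ((1 - q\<^sup>2) / (1 + q\<^sup>2) - (1 - q) / (1 + q)) / 2"
      using nz by (simp add: divide_simps) algebra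
    finally show ?thesis by (simp only: t)
  qed
  ultimately show ?thesis unfolding q_def[symmetric] by (simp only: mult.assoc)
qed

text \<open>Both sides are the integral \<open>?K\<close>. Expanded into exponentials it gives the
  second differences \<open>D\<close>; with the partial fractions of tanh it gives the sum over
  \<open>b n\<close>, where the rescaled argument \<open>x / 2\<close> accounts for the term
  \<open>2 powr (- a)\<close>.\<close>

lemma block_series_identity:
  fixes a :: real
  assumes a: "0 < a" "a < 1"
  defines "D \<equiv> (\<lambda>j::nat. real (4 * j + 2) powr a - real (4 * j + 1) powr a -
             (real (4 * j + 3) powr a - real (4 * j + 2) powr a))"
  assumes D: "summable D"
  defines "C \<equiv> Gamma ((3 - a) / 2) * Gamma ((1 + a) / 2) / (1 - a)"
  defines "b \<equiv> (\<lambda>n::nat. (real n + 1 / 2) * pi)"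
  shows "Gamma (1 - a) / a * (\<Sum>j. D j) = (1 - 2 powr (- a)) * C * (\<Sum>n. b n powr (- 1 - a))"
proof -
  define g where "g = Gamma (1 - a) / a"
  have g: "g > 0" unfolding g_def using a by (intro divide_pos_pos Gamma_real_pos) auto
  have C: "C \<ge> 0" unfolding C_def
    using a Gamma_real_pos[of "(3 - a) / 2"] Gamma_real_pos[of "(1 + a) / 2"] by simp
  have b: "b n > 0" for n by (simp add: b_def add_nonneg_pos)
  have D0: "D j \<ge> 0" for j
    using nn_integral_second_difference(2)[OF a, of "real (4 * j + 1)"] unfolding D_def
    by (simp add: algebra_simps)
  have smb: "summable (\<lambda>n. b n powr (- 1 - a))"
  proof (rule summable_comparison_test')
    show "summable (\<lambda>n. 1 * real (Suc n) powr (- 1 - a) )"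
      using a by (intro summable_mult summable_Suc_powr) auto
    fix n :: nat assume "n \<ge> 0"
    have "b n \<ge> (real n + 1 / 2) * 2" unfolding b_def using pi_ge_two by (intro mult_left_mono) auto
    then have "b n \<ge> real (Suc n)" by simp
    then show "norm (b n powr (- 1 - a)) \<le> 1 * real (Suc n) powr (- 1 - a)"
      using a by (auto intro!: powr_mono2')
  qed
  let ?I = "\<integral>\<^sup>+x\<in>{0<..}. ennreal (tanh x * x powr (- a - 1)) \<partial>lborel"
  let ?K = "\<integral>\<^sup>+x\<in>{0<..}. ennreal ((tanh x - tanh (x / 2)) / 2 * x powr (- a - 1)) \<partial>lborel"
  have [measurable]: "(tanh :: real \<Rightarrow> real) \<in> borel_measurable borel"
    by (intro borel_measurable_continuous_onI continuous_intros) auto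
  have I: "?I = ennreal (2 * C * (\<Sum>n. b n powr (- 1 - a)))"
  proof -
    have "?I = (\<integral>\<^sup>+x. (\<Sum>n. ennreal 2 * (ennreal (x powr (- a) / (x\<^sup>2 + (b n)\<^sup>2)) * indicator {0<..} x)) \<partial>lborel)"
    proof (intro nn_integral_cong)
      fix x :: real
      show "ennreal (tanh x * x powr (- a - 1)) * indicator {0<..} x =
          (\<Sum>n. ennreal 2 * (ennreal (x powr (- a) / (x\<^sup>2 + (b n)\<^sup>2)) * indicator {0<..} x))"
      proof (cases "x > 0")
        case True
        have xa: "x powr (- a) = x powr (- a - 1) * x" using True powr_add[of x "- a - 1" 1] by simp
        have "(\<lambda>n. 2 * x / (x\<^sup>2 + (b n)\<^sup>2) * x powr (- a - 1)) sums (tanh x * x powr (- a - 1))"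
          unfolding b_def by (intro sums_mult2 tanh_sums)
        moreover have "2 * x / (x\<^sup>2 + (b n)\<^sup>2) * x powr (- a - 1) = 2 * (x powr (- a) / (x\<^sup>2 + (b n)\<^sup>2))" for n
          unfolding xa by simp
        ultimately have "(\<lambda>n. 2 * (x powr (- a) / (x\<^sup>2 + (b n)\<^sup>2))) sums (tanh x * x powr (- a - 1))"
          by (simp only:)
        then have s: "(\<Sum>n. ennreal (2 * (x powr (- a) / (x\<^sup>2 + (b n)\<^sup>2)))) = ennreal (tanh x * x powr (- a - 1))"
          by (intro suminf_ennreal_eq) auto
        have i: "indicator {0<..} x = (1 :: ennreal)" using True by simp
        have m: "ennreal 2 * ennreal (x powr (- a) / (x\<^sup>2 + (b n)\<^sup>2)) =
            ennreal (2 * (x powr (- a) / (x\<^sup>2 + (b n)\<^sup>2)))" for n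
          by (subst ennreal_mult) auto
        show ?thesis unfolding i mult_1_right m s ..
      qed simp
    qed
    also have "\<dots> = (\<Sum>n. (\<integral>\<^sup>+x. ennreal 2 * (ennreal (x powr (- a) / (x\<^sup>2 + (b n)\<^sup>2)) * indicator {0<..} x) \<partial>lborel))"
      by (rule nn_integral_suminf) auto
    also have "\<dots> = (\<Sum>n. ennreal (2 * C * b n powr (- 1 - a)))"
    proof (rule suminf_cong)
      fix n
      have "(\<integral>\<^sup>+x. ennreal 2 * (ennreal (x powr (- a) / (x\<^sup>2 + (b n)\<^sup>2)) * indicator {0<..} x) \<partial>lborel) =
          ennreal 2 * ennreal (C * b n powr (- 1 - a))"
        unfolding C_def nn_integral_powr_over_quadratic[OF a b, symmetric]
        by (rule nn_integral_cmult) auto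
      then show "(\<integral>\<^sup>+x. ennreal 2 * (ennreal (x powr (- a) / (x\<^sup>2 + (b n)\<^sup>2)) * indicator {0<..} x) \<partial>lborel) =
          ennreal (2 * C * b n powr (- 1 - a))"
        using C by (simp only: ennreal_mult mult.assoc mult_nonneg_nonneg powr_ge_zero zero_le_numeral)
    qed
    also have "\<dots> = ennreal (2 * C * (\<Sum>n. b n powr (- 1 - a)))"
      using C by (intro suminf_ennreal_eq sums_mult summable_sums smb) auto
    finally show ?thesis .
  qed
  have K: "?K = ennreal (g * (\<Sum>j. D j))"
  proof -
    let ?e = "\<lambda>j x. exp (- (real (4 * j + 1) * x)) * (1 - exp (- x))\<^sup>2 * x powr (- a - 1)"
    have "?K = (\<integral>\<^sup>+x. (\<Sum>j. ennreal (?e j x) * indicator {0<..} x) \<partial>lborel)"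
    proof (intro nn_integral_cong)
      fix x :: real
      show "ennreal ((tanh x - tanh (x / 2)) / 2 * x powr (- a - 1)) * indicator {0<..} x =
          (\<Sum>j. ennreal (?e j x) * indicator {0<..} x)"
      proof (cases "x > 0")
        case True
        have "(\<lambda>j. ?e j x) sums ((tanh x - tanh (x / 2)) / 2 * x powr (- a - 1))"
          by (intro sums_mult2 exp_block_sums True)
        then have "(\<Sum>j. ennreal (?e j x)) = ennreal ((tanh x - tanh (x / 2)) / 2 * x powr (- a - 1))"
          by (intro suminf_ennreal_eq) auto
        then show ?thesis using True by simp
      qed simp
    qed
    also have "\<dots> = (\<Sum>j. (\<integral>\<^sup>+x. ennreal (?e j x) * indicator {0<..} x \<partial>lborel))"
      by (rule nn_integral_suminf) auto
    also have "\<dots> = (\<Sum>j. ennreal (g * D j))"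
    proof (rule suminf_cong)
      fix j
      have e: "real (4 * j + 1) + 1 = real (4 * j + 2)" "real (4 * j + 1) + 2 = real (4 * j + 3)" by simp_all
      have "real (4 * j + 1) > 0" by simp
      from nn_integral_second_difference(1)[OF a this]
      show "(\<integral>\<^sup>+x. ennreal (?e j x) * indicator {0<..} x \<partial>lborel) = ennreal (g * D j)"
        unfolding e g_def D_def .
    qed
    also have "\<dots> = ennreal (g * (\<Sum>j. D j))"
      using g D0 by (intro suminf_ennreal_eq sums_mult summable_sums D) auto
    finally show ?thesis .
  qed
  have half: "(\<integral>\<^sup>+x\<in>{0<..}. ennreal (tanh (x / 2) * x powr (- a - 1)) \<partial>lborel) = ennreal (2 powr (- a)) * ?I"
  proof -
    let ?h = "\<lambda>x. ennreal (tanh x * x powr (- a - 1)) * indicator {0<..} x"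
    have "(\<integral>\<^sup>+x\<in>{0<..}. ennreal (tanh (x / 2) * x powr (- a - 1)) \<partial>lborel) =
        (\<integral>\<^sup>+x. ennreal (2 powr (- a)) * (ennreal (1 / 2) * ?h (0 + 1 / 2 * x)) \<partial>lborel)"
    proof (intro nn_integral_cong)
      fix x :: real
      show "ennreal (tanh (x / 2) * x powr (- a - 1)) * indicator {0<..} x =
          ennreal (2 powr (- a)) * (ennreal (1 / 2) * ?h (0 + 1 / 2 * x))"
      proof (cases "x > 0")
        case True
        have "2 powr (- a) * (1 / 2 * (tanh (1 / 2 * x) * (1 / 2 * x) powr (- a - 1))) =
            (2 powr (- a) * (1 / 2) * (1 / 2) powr (- a - 1)) * (tanh (x / 2) * x powr (- a - 1))"
          using True by (simp add: powr_mult powr_divide)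
        also have "2 powr (- a) * (1 / 2) * (1 / 2) powr (- a - 1) = (1::real)"
          by (simp add: powr_divide powr_diff)
        finally have e: "2 powr (- a) * (1 / 2 * (tanh (1 / 2 * x) * (1 / 2 * x) powr (- a - 1))) =
            tanh (x / 2) * x powr (- a - 1)" by (simp only: mult_1_left)
        have m: "ennreal A * (ennreal B * ennreal C) = ennreal (A * (B * C))"
          if "A \<ge> 0" "B \<ge> 0" "C \<ge> 0" for A B C
          using that by (simp add: ennreal_mult)
        have i: "indicator {0<..} x = (1 :: ennreal)" "indicator {0<..} (1 / 2 * x) = (1 :: ennreal)"
          using True by simp_all
        show ?thesis
          unfolding add_0_left i mult_1_right e[symmetric] by (rule m[symmetric]) (use True in auto)
      qed (auto simp: indicator_def)
    qed
    also have "\<dots> = ennreal (2 powr (- a)) * (ennreal (1 / 2) * (\<integral>\<^sup>+x. ?h (0 + 1 / 2 * x) \<partial>lborel))"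
      by (simp add: nn_integral_cmult)
    also have "ennreal (1 / 2) * (\<integral>\<^sup>+x. ?h (0 + 1 / 2 * x) \<partial>lborel) = ?I"
      using nn_integral_real_affine[of ?h "1 / 2" 0] by simp
    finally show ?thesis .
  qed
  \<comment> \<open>The relation is kept as a sum with \<open>?I\<close> on both sides and solved
    only after all terms are known to be finite reals, because cancellation in
    \<open>ennreal\<close> needs finiteness.\<close>
  have "?I = (\<integral>\<^sup>+x. 2 * (ennreal ((tanh x - tanh (x / 2)) / 2 * x powr (- a - 1)) * indicator {0<..} x) +
      ennreal (tanh (x / 2) * x powr (- a - 1)) * indicator {0<..} x \<partial>lborel)"
  proof (intro nn_integral_cong)
    fix x :: real
    show "ennreal (tanh x * x powr (- a - 1)) * indicator {0<..} x =
        2 * (ennreal ((tanh x - tanh (x / 2)) / 2 * x powr (- a - 1)) * indicator {0<..} x) +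
        ennreal (tanh (x / 2) * x powr (- a - 1)) * indicator {0<..} x"
    proof (cases "x > 0")
      case True
      have "2 * ennreal ((tanh x - tanh (x / 2)) / 2 * x powr (- a - 1)) =
          ennreal (2 * ((tanh x - tanh (x / 2)) / 2 * x powr (- a - 1)))"
        using True by (subst ennreal_mult) auto
      also have "\<dots> + ennreal (tanh (x / 2) * x powr (- a - 1)) =
          ennreal (2 * ((tanh x - tanh (x / 2)) / 2 * x powr (- a - 1)) + tanh (x / 2) * x powr (- a - 1))"
        using True by (intro ennreal_plus[symmetric]) auto
      also have "2 * ((tanh x - tanh (x / 2)) / 2 * x powr (- a - 1)) + tanh (x / 2) * x powr (- a - 1) =
          tanh x * x powr (- a - 1)" by (simp add: left_diff_distrib diff_divide_distrib)
      finally show ?thesis using True by simp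
    qed simp
  qed
  also have "\<dots> = 2 * ?K + ennreal (2 powr (- a)) * ?I"
    unfolding half[symmetric] by (subst nn_integral_add) (auto simp: nn_integral_cmult)
  finally have *: "?I = 2 * ?K + ennreal (2 powr (- a)) * ?I" .
  define S where "S = (\<Sum>n. b n powr (- 1 - a))"
  define E where "E = (\<Sum>j. D j)"
  have S0: "S \<ge> 0" unfolding S_def by (intro suminf_nonneg smb) auto
  have E0: "E \<ge> 0" unfolding E_def by (intro suminf_nonneg D D0)
  have "ennreal (2 * C * S) = ennreal (2 * (g * E) + 2 powr (- a) * (2 * C * S))"
    using * unfolding I K S_def[symmetric] E_def[symmetric] using S0 E0 C g
    by (simp add: ennreal_plus ennreal_mult)
  then have "2 * C * S = 2 * (g * E) + 2 powr (- a) * (2 * C * S)"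
    using S0 E0 C g by (subst (asm) ennreal_inj) auto
  then have "g * E = (1 - 2 powr (- a)) * C * S" by (simp add: algebra_simps)
  then show ?thesis by (simp only: g_def S_def E_def)
qed

section \<open>Regrouped Dirichlet series and their continuation to real part above -1\<close>

lemma zeta_group_sums:
  assumes s: "Re s > 1" and k: "k > 0"
  shows "(\<lambda>j. \<Sum>i<k. of_nat (k * j + Suc i) powr (- s)) sums zeta s"
proof -
  have "(\<lambda>j. \<Sum>i\<in>{j * k..<j * k + k}. of_nat (Suc i) powr (- s)) sums zeta s"
    by (rule sums_group[OF zeta_sums[OF s] k])
  moreover have "(\<Sum>i\<in>{j * k..<j * k + k}. of_nat (Suc i) powr (- s)) =
      (\<Sum>i<k. of_nat (k * j + Suc i) powr (- s) :: complex)" for j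
    by (rule sum.reindex_bij_witness[of _ "\<lambda>i. j * k + i" "\<lambda>i. i - j * k"]) (auto simp: mult.commute)
  ultimately show ?thesis by simp
qed

lemma zeta_odd_sums:
  assumes s: "Re s > 1"
  shows "(\<lambda>n. of_nat (2 * n + 1) powr (- s)) sums ((1 - 2 powr (- s)) * zeta s)"
proof -
  have "(\<lambda>n. of_nat (2 * Suc n) powr (- s)) sums (2 powr (- s) * zeta s)"
    using sums_mult[OF zeta_sums[OF s], of "2 powr (- s)"] unfolding powr_of_nat_mult by simp
  from sums_diff[OF zeta_group_sums[OF s, of 2] this]
  have "(\<lambda>n. of_nat (2 * n + 1) powr (- s)) sums (zeta s - 2 powr (- s) * zeta s)"
    by (simp add: eval_nat_numeral)
  then show ?thesis by (simp add: algebra_simps)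
qed

definition zeta_block :: "nat \<Rightarrow> complex \<Rightarrow> complex" where
  "zeta_block j s = of_nat (4 * j + 1) powr (- s) - 2 * of_nat (4 * j + 2) powr (- s) +
     of_nat (4 * j + 3) powr (- s)"

text \<open>With x = 2^(-s), the factor (1 - x) (1 - 2x) = 1 - 3x + 2x^2 gives the residues 1, 2, 3,
  0 modulo 4 the weights 1, -2, 1, 0.\<close>

lemma zeta_block_sums:
  assumes s: "Re s > 1"
  shows "(\<lambda>j. zeta_block j s) sums ((1 - 2 powr (- s)) * (1 - 2 * 2 powr (- s)) * zeta s)"
proof -
  let ?f = "\<lambda>n. of_nat n powr (- s) :: complex"
  have m: "2 powr (- s) * 2 powr (- s) = ?f 4" using powr_of_nat_mult[of 2 2 "- s"] by simp
  have 1: "(\<lambda>j. ?f (4 * j + 1) + ?f (4 * j + 2) + ?f (4 * j + 3) + ?f (4 * j + 4)) sums zeta s"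
    using zeta_group_sums[OF s, of 4] by (simp add: eval_nat_numeral add.assoc)
  have "(\<lambda>j. 2 powr (- s) * (?f (2 * j + 1) + ?f (2 * j + 2))) sums (2 powr (- s) * zeta s)"
    using zeta_group_sums[OF s, of 2] by (intro sums_mult) (simp add: eval_nat_numeral)
  moreover have "2 powr (- s) * (?f (2 * j + 1) + ?f (2 * j + 2)) = ?f (4 * j + 2) + ?f (4 * j + 4)" for j
  proof -
    have e: "4 * j + 2 = 2 * (2 * j + 1)" "4 * j + 4 = 2 * (2 * j + 2)" by simp_all
    show ?thesis unfolding e powr_of_nat_mult by (simp only: ring_distribs of_nat_numeral)
  qed
  ultimately have 2: "(\<lambda>j. ?f (4 * j + 2) + ?f (4 * j + 4)) sums (2 powr (- s) * zeta s)" by simp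
  have "(\<lambda>j. ?f 4 * ?f (Suc j)) sums (?f 4 * zeta s)"
    by (intro sums_mult zeta_sums s)
  moreover have "?f 4 * ?f (Suc j) = ?f (4 * j + 4)" for j
  proof -
    have e: "4 * j + 4 = 4 * Suc j" by simp
    show ?thesis unfolding e powr_of_nat_mult ..
  qed
  ultimately have 3: "(\<lambda>j. ?f (4 * j + 4)) sums (?f 4 * zeta s)" by simp
  have "(\<lambda>j. (?f (4 * j + 1) + ?f (4 * j + 2) + ?f (4 * j + 3) + ?f (4 * j + 4)) -
      3 * (?f (4 * j + 2) + ?f (4 * j + 4)) + 2 * ?f (4 * j + 4)) sums
      (zeta s - 3 * (2 powr (- s) * zeta s) + 2 * (?f 4 * zeta s))"
    by (intro sums_add sums_diff sums_mult 1 2 3)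
  moreover have "(?f (4 * j + 1) + ?f (4 * j + 2) + ?f (4 * j + 3) + ?f (4 * j + 4)) -
      3 * (?f (4 * j + 2) + ?f (4 * j + 4)) + 2 * ?f (4 * j + 4) = zeta_block j s" for j
    unfolding zeta_block_def by algebra
  moreover have "zeta s - 3 * (2 powr (- s) * zeta s) + 2 * (?f 4 * zeta s) =
      (1 - 2 powr (- s)) * (1 - 2 * 2 powr (- s)) * zeta s"
    unfolding m[symmetric] by algebra
  ultimately show ?thesis by (simp only:)
qed

text \<open>A block is a second difference around \<open>4 * j + 2\<close>: in the Taylor expansions
  the value and the linear term cancel, which gains two powers of \<open>j\<close>.\<close>

lemma zeta_block_bound:
  assumes s: "Re s \<ge> b" and b: "b > - 2"
  shows "norm (zeta_block j s) \<le> 2 * (norm s * norm (s + 1)) * real (Suc j) powr (- b - 2)"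
proof -
  define x where "x = real (4 * j + 2)"
  let ?f = "\<lambda>(i::nat) w. (if i = 0 then w powr (- s) else if i = 1 then - s * w powr (- s - 1)
      else s * (s + 1) * w powr (- s - 2)) :: complex"
  let ?S = "of_real ` {x - 1..x + 1} :: complex set"
  let ?B = "norm s * norm (s + 1) * real (Suc j) powr (- b - 2)"
  have taylor: "norm (?f 0 (of_real y) - (\<Sum>i\<le>1. ?f i (of_real x) * (of_real y - of_real x) ^ i / fact i)) \<le>
      ?B * norm (of_real y - of_real x :: complex) ^ Suc 1 / fact 1" if y: "y \<in> {x - 1..x + 1}" for y
  proof (rule complex_Taylor[where S = ?S and f = ?f and n = 1])
    show "convex ?S"
      by (intro convex_linear_image convex_real_interval linear_of_real)
    show "of_real x \<in> ?S" "of_real y \<in> ?S" using y by (auto intro!: imageI)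
  next
    fix i w assume w: "w \<in> ?S" "i \<le> (1::nat)"
    then have "w \<notin> \<real>\<^sub>\<le>\<^sub>0" by (auto simp: x_def)
    note d = has_field_derivative_powr[OF this]
    have "i = 0 \<or> i = 1" using w by auto
    then have "(?f i has_field_derivative ?f (Suc i) w) (at w)"
    proof
      assume "i = 0"
      then show ?thesis using d[of "- s"] by simp
    next
      assume "i = 1"
      then show ?thesis using DERIV_cmult[OF d[of "- s - 1"], of "- s"] by (simp add: algebra_simps)
    qed
    then show "(?f i has_field_derivative ?f (Suc i) w) (at w within ?S)"
      by (rule has_field_derivative_at_within)
  next
    fix w assume "w \<in> ?S"
    then obtain r where r: "w = of_real r" "r \<ge> real (Suc j)" by (auto simp: x_def)
    have "norm (w powr (- s - 2)) = r powr (- Re s - 2)"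
      using r by (subst norm_powr_real_powr) auto
    also have "\<dots> \<le> r powr (- b - 2)"
      using s r by (intro powr_mono) auto
    also have "\<dots> \<le> real (Suc j) powr (- b - 2)"
      using r b by (intro powr_mono2') auto
    finally show "norm (?f (Suc 1) w) \<le> ?B"
      by (simp add: norm_mult mult_left_mono)
  qed
  have 1: "norm (of_real (x - 1) powr (- s) - (of_real x powr (- s) + s * of_real x powr (- s - 1))) \<le> ?B"
    using taylor[of "x - 1"] by (simp add: algebra_simps)
  have 2: "norm (of_real (x + 1) powr (- s) - (of_real x powr (- s) - s * of_real x powr (- s - 1))) \<le> ?B"
    using taylor[of "x + 1"] by (simp add: algebra_simps)
  have "zeta_block j s = of_real (x - 1) powr (- s) - 2 * of_real x powr (- s) + of_real (x + 1) powr (- s)"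
  proof -
    have "of_real (x - 1) = (of_nat (4 * j + 1) :: complex)" "of_real x = (of_nat (4 * j + 2) :: complex)"
        "of_real (x + 1) = (of_nat (4 * j + 3) :: complex)" by (simp_all add: x_def)
    then show ?thesis unfolding zeta_block_def by (simp only:)
  qed
  also have "\<dots> = (of_real (x - 1) powr (- s) - (of_real x powr (- s) + s * of_real x powr (- s - 1))) +
      (of_real (x + 1) powr (- s) - (of_real x powr (- s) - s * of_real x powr (- s - 1)))"
    by simp
  also have "norm \<dots> \<le> ?B + ?B"
    by (rule norm_triangle_le[OF add_mono[OF 1 2]])
  finally show ?thesis by (simp add: algebra_simps)
qed

lemma summable_zeta_block_bound:
  "b > - 1 \<Longrightarrow> summable (\<lambda>j. C * real (Suc j) powr (- b - 2))"
  by (intro summable_mult summable_Suc_powr) auto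

lemma zeta_block_suminf:
  assumes Z: "Z holomorphic_on UNIV" "\<And>s. s \<noteq> 1 \<Longrightarrow> Z s = (s - 1) * zeta s"
    and s: "Re s > - 1"
  shows "(s - 1) * (\<Sum>j. zeta_block j s) = (1 - 2 powr (- s)) * (1 - 2 * 2 powr (- s)) * Z s"
proof (rule analytic_continuation_open[where s = "{s. Re s > 1}" and s' = "{s. Re s > - 1}"
          and f = "\<lambda>s. (s - 1) * (\<Sum>j. zeta_block j s)"
          and g = "\<lambda>s. (1 - 2 powr (- s)) * (1 - 2 * 2 powr (- s)) * Z s" and z = s])
  show "{s. Re s > 1} \<noteq> {}" by (auto intro: exI[of _ 2])
  show "connected {s. Re s > - 1}" by (intro convex_connected convex_halfspace_Re_gt)
  have "(\<lambda>s. \<Sum>j. zeta_block j s) holomorphic_on {s. Re s > - 1}"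
  proof (rule holomorphic_suminf[OF open_Re_greater])
    show "zeta_block j holomorphic_on {s. Re s > - 1}" for j
      unfolding zeta_block_def[abs_def] by (intro holomorphic_intros)
    fix K assume K: "compact K" "K \<subseteq> {s. Re s > - 1}"
    then obtain b where b: "b > - 1" "\<And>s. s \<in> K \<Longrightarrow> Re s \<ge> b"
      using compact_halfplane_gap[of K "- 1"] by metis
    have "continuous_on K (\<lambda>s. 2 * (s * (s + 1)))" by (intro continuous_intros)
    then have "bounded ((\<lambda>s. 2 * (s * (s + 1))) ` K)"
      using K compact_continuous_image compact_imp_bounded by blast
    then obtain C where C: "\<And>s. s \<in> K \<Longrightarrow> norm (2 * (s * (s + 1))) \<le> C"
      by (auto simp: bounded_iff)
    have "norm (zeta_block j s) \<le> C * real (Suc j) powr (- b - 2)" if "s \<in> K" for j s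
    proof -
      have "norm (zeta_block j s) \<le> 2 * (norm s * norm (s + 1)) * real (Suc j) powr (- b - 2)"
        using b that by (intro zeta_block_bound) auto
      also have "2 * (norm s * norm (s + 1)) = norm (2 * (s * (s + 1)))" by (simp add: norm_mult)
      also have "\<dots> * real (Suc j) powr (- b - 2) \<le> C * real (Suc j) powr (- b - 2)"
        using C[OF that] by (intro mult_right_mono) auto
      finally show ?thesis .
    qed
    then show "\<exists>M. summable M \<and> (\<forall>n. \<forall>s\<in>K. norm (zeta_block n s) \<le> M n)"
      using summable_zeta_block_bound[OF b(1), of C] by blast
  qed
  then show "(\<lambda>s. (s - 1) * (\<Sum>j. zeta_block j s)) holomorphic_on {s. Re s > - 1}"
    by (intro holomorphic_intros)
  show "(\<lambda>s. (1 - 2 powr (- s)) * (1 - 2 * 2 powr (- s)) * Z s) holomorphic_on {s. Re s > - 1}"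
    using Z(1) by (intro holomorphic_intros holomorphic_on_subset[OF Z(1)]) auto
next
  fix s :: complex assume "s \<in> {s. Re s > 1}"
  then have s: "Re s > 1" by simp
  have "Z s = (s - 1) * zeta s" using s by (intro Z(2)) auto
  then show "(s - 1) * (\<Sum>j. zeta_block j s) = (1 - 2 powr (- s)) * (1 - 2 * 2 powr (- s)) * Z s"
    using zeta_block_sums[OF s] by (simp add: sums_iff)
qed (use s in \<open>auto simp: open_Re_greater\<close>)

section \<open>The functional equation, from the real segment (-1, 0) to the whole plane\<close>

lemma Gamma_product_half:
  fixes a :: real
  assumes a: "0 < a" "a < 1"
  shows "Gamma ((3 - a) / 2) * Gamma ((1 + a) / 2) / (1 - a) = pi / 2 / cos (pi * a / 2)"
proof -
  have 1: "Gamma ((1 - a) / 2) * Gamma ((1 + a) / 2) = pi / cos (pi * a / 2)"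
  proof -
    have "complex_of_real (Gamma ((1 - a) / 2) * Gamma ((1 + a) / 2)) =
        Gamma (of_real ((1 - a) / 2)) * Gamma (1 - of_real ((1 - a) / 2))"
    proof -
      have "1 - of_real ((1 - a) / 2) = complex_of_real ((1 + a) / 2)" by (simp add: field_simps)
      then show ?thesis by (simp only: of_real_mult Gamma_complex_of_real)
    qed
    also have "\<dots> = of_real pi / sin (of_real pi * of_real ((1 - a) / 2))"
      by (rule Gamma_reflection_complex)
    also have "\<dots> = of_real (pi / sin (pi * ((1 - a) / 2)))"
      by (simp only: of_real_divide sin_of_real[symmetric] of_real_mult)
    also have "sin (pi * ((1 - a) / 2)) = cos (pi * a / 2)"
      by (simp add: cos_sin_eq algebra_simps diff_divide_distrib)
    finally show ?thesis by (simp only: of_real_eq_iff)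
  qed
  have 2: "Gamma ((3 - a) / 2) = (1 - a) / 2 * Gamma ((1 - a) / 2)"
  proof -
    have "(1 - a) / 2 \<notin> \<int>\<^sub>\<le>\<^sub>0" using a by (auto elim!: nonpos_Ints_cases)
    from Gamma_plus1[OF this] show ?thesis by (simp add: field_simps)
  qed
  have "Gamma ((3 - a) / 2) * Gamma ((1 + a) / 2) / (1 - a) = Gamma ((1 - a) / 2) * Gamma ((1 + a) / 2) / 2"
  proof -
    have "d / 2 * x * y / d = x * y / 2" if "d \<noteq> 0" for d x y :: real
      using that by simp
    from this[of "1 - a"] show ?thesis unfolding 2 using a by simp
  qed
  then show ?thesis unfolding 1 by simp
qed

text \<open>The form with \<open>Z\<close> and \<open>rGamma (s + 1)\<close> makes both sides entire
  in \<open>s\<close>, ready for the identity theorem.\<close>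

lemma zeta_functional_equation_real:
  fixes a :: real
  assumes Z: "Z holomorphic_on UNIV" "\<And>s. s \<noteq> 1 \<Longrightarrow> Z s = (s - 1) * zeta s"
    and a: "0 < a" "a < 1"
  defines "s \<equiv> - complex_of_real a"
  shows "- Z (1 - s) * (s - 1) * rGamma (s + 1) = 2 * (2 * of_real pi) powr (- s) * cos (of_real pi * s / 2) * Z s"
proof -
  define D where "D = (\<lambda>j::nat. real (4 * j + 2) powr a - real (4 * j + 1) powr a -
             (real (4 * j + 3) powr a - real (4 * j + 2) powr a))"
  \<comment> \<open>At \<open>s = - a\<close> the factor of the block series becomes
    \<open>(p - 1) * (2 * p - 1)\<close>. The same product arises on the other side,
    \<open>p - 1\<close> from the rescaling of the integral and \<open>2 * p - 1\<close> from the
    restriction to odd integers; being nonzero for \<open>p > 1\<close>, it cancels.\<close>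
  define p where "p = 2 powr a"
  define c where "c = cos (pi * a / 2)"
  have p: "p > 1" using a by (simp add: p_def)
  have c: "c > 0" unfolding c_def using a by (intro cos_gt_zero) auto
  have of_nat_powr: "of_nat n powr (- s) = (of_real (real n powr a) :: complex)" for n
    using powr_of_real[of "real n" a] by (simp add: s_def)
  have block: "zeta_block j s = of_real (- D j)" for j
    unfolding zeta_block_def of_nat_powr D_def by (simp del: of_nat_add of_nat_mult)
  have Re: "Re s > - 1" using a by (simp add: s_def)
  have "summable (\<lambda>j. norm (zeta_block j s))"
    by (rule summable_comparison_test'[OF summable_zeta_block_bound[of "- a"]])
       (use a zeta_block_bound[of "- a" s] in \<open>auto simp: s_def\<close>)
  then have smD: "summable D" unfolding block by (simp add: summable_norm_cancel)
  define E where "E = (\<Sum>j. D j)"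
  have "(\<Sum>j. zeta_block j s) = - of_real E"
    unfolding block E_def using smD by (simp add: suminf_minus suminf_of_real)
  with zeta_block_suminf[OF Z Re]
  have "(s - 1) * (- of_real E) = (1 - 2 powr (- s)) * (1 - 2 * 2 powr (- s)) * Z s" by simp
  moreover have "2 powr (- s) = (of_real p :: complex)" using of_nat_powr[of 2] by (simp add: p_def)
  ultimately have 1: "of_real ((a + 1) * E) = of_real ((p - 1) * (2 * p - 1)) * Z s"
    by (simp add: s_def algebra_simps)
  define S where "S = (\<Sum>n. ((real n + 1 / 2) * pi) powr (- 1 - a))"
  \<comment> \<open>The base \<open>(n + 1/2) * pi\<close> is \<open>pi / 2\<close> times the odd
    number \<open>2 * n + 1\<close>, so \<open>S\<close> is a multiple of the odd part of the
    Dirichlet series at \<open>1 - s\<close>, whose real part \<open>1 + a\<close> lies in the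
    region of convergence.\<close>
  have S: "of_real S = of_real ((pi / 2) powr (- 1 - a) * (1 - 1 / (2 * p))) * zeta (1 - s)"
  proof -
    have sm: "(\<lambda>n. of_nat (2 * n + 1) powr (- (1 - s))) sums ((1 - 2 powr (- (1 - s))) * zeta (1 - s))"
      by (rule zeta_odd_sums) (use a in \<open>simp add: s_def\<close>)
    have pw: "of_nat n powr (- (1 - s)) = (of_real (real n powr (- 1 - a)) :: complex)" for n
      using powr_of_real[of "real n" "- 1 - a"] by (simp add: s_def)
    have "2 powr (- (1 - s)) = (of_real (1 / (2 * p)) :: complex)"
      using pw[of 2] by (simp add: p_def powr_diff powr_minus field_simps)
    with sm have sm: "(\<lambda>n. of_real (real (2 * n + 1) powr (- 1 - a))) sums
        ((1 - of_real (1 / (2 * p))) * zeta (1 - s))" unfolding pw by simp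
    have "((real n + 1 / 2) * pi) powr (- 1 - a) = (pi / 2) powr (- 1 - a) * real (2 * n + 1) powr (- 1 - a)" for n
    proof -
      have "(real n + 1 / 2) * pi = (pi / 2) * real (2 * n + 1)" by (simp add: algebra_simps)
      then show ?thesis by (simp only: powr_mult)
    qed
    then have "(\<lambda>n. of_real (((real n + 1 / 2) * pi) powr (- 1 - a))) sums
        (of_real ((pi / 2) powr (- 1 - a)) * ((1 - of_real (1 / (2 * p))) * zeta (1 - s)))"
      using sums_mult[OF sm, of "of_real ((pi / 2) powr (- 1 - a))"] by (simp only: of_real_mult)
    moreover from this have "summable (\<lambda>n. ((real n + 1 / 2) * pi) powr (- 1 - a))"
      using summable_of_real_iff sums_summable by blast
    then have "(\<lambda>n. of_real (((real n + 1 / 2) * pi) powr (- 1 - a)) :: complex) sums of_real S"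
      unfolding S_def by (intro sums_of_real summable_sums)
    ultimately show ?thesis using sums_unique2 by fastforce
  qed
  have E: "Gamma (1 - a) / a * E = (1 - 2 powr (- a)) * (pi / 2 / c) * S"
    using block_series_identity[OF a smD[unfolded D_def]]
    unfolding E_def D_def S_def c_def Gamma_product_half[OF a] .
  have "E = a * rGamma (1 - a) * (Gamma (1 - a) / a * E)"
  proof -
    have "Gamma (1 - a) \<noteq> 0" using Gamma_real_pos[of "1 - a"] a by linarith
    then have "inverse (Gamma (1 - a)) * Gamma (1 - a) = 1" by (rule left_inverse)
    then show ?thesis using a by (simp add: rGamma_inverse_Gamma)
  qed
  also have "\<dots> = a * rGamma (1 - a) * ((1 - 1 / p) * (pi / 2 / c) * S)"
    unfolding E by (simp only: p_def powr_minus_divide)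
  finally have "E = a * rGamma (1 - a) * ((1 - 1 / p) * (pi / 2 / c) * S)" .
  then have "of_real E = of_real (a * rGamma (1 - a) * ((1 - 1 / p) * (pi / 2 / c))) *
      (of_real ((pi / 2) powr (- 1 - a) * (1 - 1 / (2 * p))) * zeta (1 - s))"
    unfolding S[symmetric] by simp
  also have "\<dots> = of_real (rGamma (1 - a) * ((1 - 1 / p) * (pi / 2 / c)) * ((pi / 2) powr (- 1 - a) * (1 - 1 / (2 * p)))) *
      (of_real a * zeta (1 - s))"
    by simp
  also have "of_real a * zeta (1 - s) = Z (1 - s)"
    using a by (subst Z(2)) (auto simp: s_def)
  also have "rGamma (1 - a) * ((1 - 1 / p) * (pi / 2 / c)) * ((pi / 2) powr (- 1 - a) * (1 - 1 / (2 * p))) =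
      ((p - 1) * (2 * p - 1)) * (rGamma (1 - a) * (pi / 2) powr (- a) / (2 * p\<^sup>2 * c))"
  proof -
    have "(pi / 2) powr (- 1 - a) = (pi / 2) powr (- a) / (pi / 2)"
    proof -
      have e: "- 1 - a = - a - 1" by simp
      show ?thesis unfolding e powr_diff by simp
    qed
    moreover have "r * ((1 - 1 / p) * (pi / 2 / c)) * (q / (pi / 2) * (1 - 1 / (2 * p))) =
        ((p - 1) * (2 * p - 1)) * (r * q / (2 * p\<^sup>2 * c))" for r q :: real
    proof -
      have e: "1 - 1 / p = (p - 1) / p" "1 - 1 / (2 * p) = (2 * p - 1) / (2 * p)"
        using p by (auto simp: field_simps)
      have "r * (u / p * (pi / 2 / c)) * (q / (pi / 2) * (v / (2 * p))) = (u * v) * (r * q / (2 * p\<^sup>2 * c))" for u v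
        by (simp add: power2_eq_square mult_ac)
      then show ?thesis unfolding e .
    qed
    ultimately show ?thesis by (simp only:)
  qed
  finally have 2: "of_real E = of_real ((p - 1) * (2 * p - 1)) *
      (of_real (rGamma (1 - a) * (pi / 2) powr (- a) / (2 * p\<^sup>2 * c)) * Z (1 - s))"
    by (simp only: of_real_mult mult.assoc)
  have "of_real ((p - 1) * (2 * p - 1)) * Z s = of_real ((p - 1) * (2 * p - 1)) *
      (of_real ((a + 1) * (rGamma (1 - a) * (pi / 2) powr (- a) / (2 * p\<^sup>2 * c))) * Z (1 - s))"
    unfolding 1[symmetric] of_real_mult[of "a + 1" E] 2 by (simp only: of_real_mult mult_ac)
  moreover have "complex_of_real ((p - 1) * (2 * p - 1)) \<noteq> 0" using p by (simp only: of_real_eq_0_iff) simp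
  ultimately have 3: "Z s = of_real ((a + 1) * (rGamma (1 - a) * (pi / 2) powr (- a) / (2 * p\<^sup>2 * c))) * Z (1 - s)"
    by (simp only: mult_cancel_left) simp
  have "2 * (2 * of_real pi) powr (- s) * cos (of_real pi * s / 2) = (of_real (2 * (2 * pi) powr a * c) :: complex)"
  proof -
    have "(2 * of_real pi) powr (- s) = (of_real ((2 * pi) powr a) :: complex)"
      using powr_of_real[of "2 * pi" a] by (simp add: s_def)
    moreover have "cos (of_real pi * s / 2) = (of_real c :: complex)"
      unfolding c_def cos_of_real[symmetric] by (simp add: s_def)
    ultimately show ?thesis by simp
  qed
  then have "2 * (2 * of_real pi) powr (- s) * cos (of_real pi * s / 2) * Z s =
      of_real ((2 * (2 * pi) powr a * c) * ((a + 1) * (rGamma (1 - a) * (pi / 2) powr (- a) / (2 * p\<^sup>2 * c)))) * Z (1 - s)"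
    by (subst 3) (simp only: of_real_mult mult.assoc)
  also have "(2 * (2 * pi) powr a * c) * ((a + 1) * (rGamma (1 - a) * (pi / 2) powr (- a) / (2 * p\<^sup>2 * c))) =
      ((2 * pi) powr a * (pi / 2) powr (- a) / p\<^sup>2) * (a + 1) * rGamma (1 - a)"
  proof -
    have "(2 * x * c) * (y * (r * q / (2 * p\<^sup>2 * c))) = (x * q / p\<^sup>2) * y * r" for x y r q
      using c by (simp add: mult_ac)
    then show ?thesis .
  qed
  also have "(2 * pi) powr a * (pi / 2) powr (- a) / p\<^sup>2 = 1"
    unfolding p_def by (simp add: powr_mult powr_divide powr_minus field_simps power2_eq_square)
  also have "of_real (1 * (a + 1) * rGamma (1 - a)) * Z (1 - s) = - Z (1 - s) * (s - 1) * rGamma (s + 1)"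
    unfolding of_real_mult rGamma_complex_of_real[symmetric] by (simp add: s_def algebra_simps)
  finally show ?thesis by simp
qed

text \<open>Identity theorem from the segment, with its inner point -1/2 as limit point. The factor
  \<open>s - 1\<close>, introduced by passing from zeta to \<open>Z\<close>, is divided out at the
  end.\<close>

theorem zeta_functional_equation:
  assumes "s \<noteq> 0" "s \<noteq> 1"
  shows "zeta (1 - s) * rGamma s = 2 * (2 * of_real pi) powr (- s) * cos (of_real pi * s / 2) * zeta s"
proof -
  obtain Z where Z: "Z holomorphic_on UNIV" "\<And>s. s \<noteq> 1 \<Longrightarrow> Z s = (s - 1) * zeta s"
    using zeta_times_entire by metis
  let ?F = "\<lambda>s. - Z (1 - s) * (s - 1) * rGamma (s + 1)"
  let ?G = "\<lambda>s. 2 * (2 * of_real pi) powr (- s) * cos (of_real pi * s / 2) * Z s"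
  have "(\<lambda>s. ?F s - ?G s) s = 0"
  proof (rule analytic_continuation[where f = "\<lambda>s. ?F s - ?G s" and w = s and S = UNIV and U = "(\<lambda>a. - of_real a) ` {0<..<1}" and \<xi> = "- of_real (1/2)"])
    have "(\<lambda>s. Z (1 - s)) holomorphic_on UNIV"
      by (rule holomorphic_on_compose_gen[OF _ Z(1), unfolded o_def]) (auto intro!: holomorphic_intros)
    then show "(\<lambda>s. ?F s - ?G s) holomorphic_on UNIV"
      by (intro holomorphic_intros Z(1)) auto
    show "- of_real (1/2) islimpt (\<lambda>a. - complex_of_real a) ` {0<..<1}"
    proof (rule islimpt_isCont_image)
      show "(1/2::real) islimpt {0<..<1}" by (intro interior_limit_point) (simp add: interior_open)
      show "\<forall>\<^sub>F y in at (1/2). - complex_of_real y \<noteq> - complex_of_real (1/2)"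
        unfolding neg_equal_iff_equal of_real_eq_iff by (rule eventually_neq_at_within)
    qed auto
  qed (use zeta_functional_equation_real[OF Z] in auto)
  then have "?F s = ?G s" by simp
  moreover have "Z (1 - s) = - s * zeta (1 - s)" using assms by (subst Z(2)) auto
  moreover have "Z s = (s - 1) * zeta s" using assms by (intro Z(2))
  moreover have "rGamma s = s * rGamma (s + 1)" by (rule rGamma_plus1[symmetric])
  ultimately have "(s - 1) * (zeta (1 - s) * rGamma s) =
      (s - 1) * (2 * (2 * of_real pi) powr (- s) * cos (of_real pi * s / 2) * zeta s)"
    by (simp add: mult_ac)
  then show ?thesis using assms by simp
qed

section \<open>Local analysis of holomorphic functions\<close>

text \<open>The Moebius map w / (2B - w) sends the half-plane Re w < B into the unit disc, so
  Schwarz's lemma applies to \<open>h\<close>; solving for \<open>g\<close> gives the bound.\<close>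

lemma Borel_Caratheodory:
  assumes f: "f holomorphic_on ball c R" and r: "0 < r" "r < R"
    and A: "\<And>z. z \<in> ball c R \<Longrightarrow> Re (f z) < A" and z: "z \<in> cball c r"
  shows "norm (f z - f c) \<le> 2 * (A - Re (f c)) * r / (R - r)"
proof -
  define B where "B = A - Re (f c)"
  have B: "B > 0" using A[of c] r by (simp add: B_def)
  define g where "g = (\<lambda>w. f (c + of_real R * w) - f c)"
  define h where "h = (\<lambda>w. g w / (of_real (2 * B) - g w))"
  have inb: "c + of_real R * w \<in> ball c R" if "w \<in> ball 0 1" for w
    using that r by (simp add: dist_norm norm_mult)
  have g: "g holomorphic_on ball 0 1"
    unfolding g_def
    by (intro holomorphic_intros holomorphic_on_compose_gen[OF _ f, unfolded o_def])
       (auto intro!: holomorphic_intros inb)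
  have Reg: "Re (g w) < B" if "w \<in> ball 0 1" for w
    using A[OF inb[OF that]] by (simp add: g_def B_def)
  have nz: "of_real (2 * B) - g w \<noteq> 0" if "w \<in> ball 0 1" for w
  proof
    assume "of_real (2 * B) - g w = 0"
    then have "g w = of_real (2 * B)" by simp
    then have "Re (g w) = 2 * B" by simp
    with Reg[OF that] B show False by simp
  qed
  have hlt: "norm (h w) < 1" if w: "norm w < 1" for w
  proof -
    have w': "w \<in> ball 0 1" using w by simp
    have "(norm (g w))\<^sup>2 < (norm (of_real (2 * B) - g w))\<^sup>2"
    proof -
      have "(norm (of_real (2 * B) - g w))\<^sup>2 = (norm (g w))\<^sup>2 + 4 * B * (B - Re (g w))"
        unfolding cmod_power2 by (simp add: power2_eq_square algebra_simps)
      moreover have "4 * B * (B - Re (g w)) > 0" using Reg[OF w'] B by simp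
      ultimately show ?thesis by linarith
    qed
    then have "norm (g w) < norm (of_real (2 * B) - g w)"
      by (rule power2_less_imp_less) simp
    then show ?thesis using nz[OF w'] by (simp add: h_def norm_divide)
  qed
  define w where "w = (z - c) / of_real R"
  have zw: "z = c + of_real R * w" using r by (simp add: w_def)
  have nw: "norm w \<le> r / R" using z r by (simp add: w_def norm_divide dist_norm norm_minus_commute divide_right_mono)
  have rR: "r / R < 1" using r by simp
  with nw have w1: "norm w < 1" by simp
  have "norm (h w) \<le> norm w"
  proof (rule Schwarz_Lemma)
    show "h holomorphic_on ball 0 1"
      unfolding h_def by (intro holomorphic_intros g nz)
    show "h 0 = 0" by (simp add: h_def g_def)
  qed (use hlt w1 in auto)
  then have hr: "norm (h w) \<le> r / R" using nw by simp
  have gh: "g w * (1 + h w) = of_real (2 * B) * h w"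
    using nz[of w] w1 by (simp add: h_def field_simps)
  have "norm (g w) * (1 - r / R) \<le> norm (g w) * norm (1 + h w)"
  proof (rule mult_left_mono)
    have "1 - norm (h w) \<le> norm (1 + h w)" using norm_triangle_ineq2[of 1 "- h w"] by simp
    then show "1 - r / R \<le> norm (1 + h w)" using hr by linarith
  qed simp
  also have "\<dots> = 2 * B * norm (h w)" using B by (simp add: norm_mult[symmetric] gh) (simp add: norm_mult)
  also have "\<dots> \<le> 2 * B * (r / R)" using hr B by (intro mult_left_mono) auto
  finally have le: "norm (g w) * (1 - r / R) \<le> 2 * B * (r / R)" .
  have "norm (g w) * (R - r) = R * (norm (g w) * (1 - r / R))" using r by (simp add: field_simps)
  also have "\<dots> \<le> R * (2 * B * (r / R))" using le r by (intro mult_left_mono) auto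
  also have "\<dots> = 2 * B * r" using r by simp
  finally have "norm (g w) * (R - r) \<le> 2 * B * r" .
  then have "norm (g w) \<le> 2 * B * r / (R - r)" using r by (simp add: field_simps)
  then show ?thesis by (simp add: g_def zw B_def)
qed

text \<open>Maximum modulus for \<open>f z / (z - c) ^ p\<close> on the annulus. An integer exponent
  keeps the quotient single-valued, and a large \<open>p\<close> shrinks the contribution of the
  outer circle at the price of the inner one; this replaces Hadamard's optimal exponent.\<close>

lemma three_circles:
  assumes f: "f holomorphic_on ball c R" and r: "0 < r1" "r1 < r2" "r2 < r3" "r3 < R"
    and A: "\<And>z. norm (z - c) = r1 \<Longrightarrow> norm (f z) \<le> A"
    and B: "\<And>z. norm (z - c) = r3 \<Longrightarrow> norm (f z) \<le> B"
    and z: "norm (z - c) = r2"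
  shows "norm (f z) \<le> max (A * (r2 / r1) ^ p) (B * (r2 / r3) ^ p)"
proof -
  define S where "S = {z. r1 < norm (z - c) \<and> norm (z - c) < r3}"
  have oS: "open S" unfolding S_def by (intro open_Collect_conj open_Collect_less continuous_intros)
  have clS: "closure S \<subseteq> {z. r1 \<le> norm (z - c) \<and> norm (z - c) \<le> r3}"
    by (rule closure_minimal) (auto simp: S_def intro!: closed_Collect_conj closed_Collect_le continuous_intros)
  have sub: "closure S \<subseteq> ball c R" "c \<notin> closure S"
    using clS r by (auto simp: dist_norm norm_minus_commute)
  let ?M = "max (A / r1 ^ p) (B / r3 ^ p)"
  have hol: "(\<lambda>z. f z / (z - c) ^ p) holomorphic_on ball c R - {c}"
    by (intro holomorphic_intros holomorphic_on_subset[OF f]) auto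
  have "norm (f z / (z - c) ^ p) \<le> ?M"
  proof (rule maximum_modulus_frontier[where S = S and \<xi> = z and f = "\<lambda>z. f z / (z - c) ^ p"])
    show "(\<lambda>z. f z / (z - c) ^ p) holomorphic_on interior S"
      using sub closure_subset interior_subset by (intro holomorphic_on_subset[OF hol]) blast
    show "continuous_on (closure S) (\<lambda>z. f z / (z - c) ^ p)"
      using sub by (intro holomorphic_on_imp_continuous_on holomorphic_on_subset[OF hol]) auto
    show "bounded S" by (rule bounded_subset[of "ball c r3"]) (auto simp: S_def dist_norm norm_minus_commute)
    show "z \<in> S" using r z by (simp add: S_def)
    fix w assume "w \<in> frontier S"
    then have "w \<in> closure S" "w \<notin> S" using oS by (auto simp: frontier_def interior_open)
    then have "norm (w - c) = r1 \<or> norm (w - c) = r3" using clS by (force simp: S_def)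
    then show "norm (f w / (w - c) ^ p) \<le> ?M"
    proof
      assume w: "norm (w - c) = r1"
      then have "norm (f w / (w - c) ^ p) \<le> A / r1 ^ p"
        using A[OF w] r by (simp add: norm_divide norm_power divide_right_mono)
      then show ?thesis by simp
    next
      assume w: "norm (w - c) = r3"
      then have "norm (f w / (w - c) ^ p) \<le> B / r3 ^ p"
        using B[OF w] r by (simp add: norm_divide norm_power divide_right_mono)
      then show ?thesis by simp
    qed
  qed
  then have "norm (f z) / r2 ^ p \<le> ?M" using z by (simp add: norm_divide norm_power)
  then have "norm (f z) \<le> ?M * r2 ^ p" using r by (simp add: field_simps)
  also have "\<dots> = max (A * (r2 / r1) ^ p) (B * (r2 / r3) ^ p)"
    using r by (simp add: max_mult_distrib_right power_divide)
  finally show ?thesis .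
qed

section \<open>Dividing out zeros, and Landau's lemma\<close>

lemma holomorphic_factor_zero_global:
  assumes f: "f holomorphic_on S" and S: "open S" "connected S" and nc: "\<not> f constant_on S"
    and a: "a \<in> S" "f a = 0"
  obtains n g where "0 < n" "g holomorphic_on S" "\<And>z. z \<in> S \<Longrightarrow> f z = (z - a) ^ n * g z" "g a \<noteq> 0"
proof -
  obtain g0 r n where g0: "0 < n" "0 < r" "ball a r \<subseteq> S" "g0 holomorphic_on ball a r"
    "\<And>w. w \<in> ball a r \<Longrightarrow> f w = (w - a) ^ n * g0 w" "\<And>w. w \<in> ball a r \<Longrightarrow> g0 w \<noteq> 0"
    by (rule holomorphic_factor_zero_nonconstant[OF f S a nc]) (rule that; assumption)
  define g where "g = (\<lambda>z. if z = a then g0 a else f z / (z - a) ^ n)"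
  have "g holomorphic_on S - {a}"
  proof (rule holomorphic_transform)
    show "(\<lambda>z. f z / (z - a) ^ n) holomorphic_on S - {a}"
      by (intro holomorphic_intros holomorphic_on_subset[OF f]) auto
  qed (auto simp: g_def)
  moreover have "g holomorphic_on ball a r"
    by (rule holomorphic_transform[OF g0(4)]) (use g0(5) in \<open>auto simp: g_def\<close>)
  ultimately have "g holomorphic_on (S - {a}) \<union> ball a r"
    using S by (intro holomorphic_on_Un) auto
  moreover have "(S - {a}) \<union> ball a r = S" using g0(2,3) by auto
  ultimately have "g holomorphic_on S" by simp
  moreover have "f z = (z - a) ^ n * g z" if "z \<in> S" for z
    using a g0(1) by (auto simp: g_def)
  moreover have "g a \<noteq> 0" using g0(2,6) by (simp add: g_def)
  ultimately show thesis by (intro that[OF g0(1)])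
qed

text \<open>Induction on the number of distinct zeros in \<open>K\<close>, removing one of them with
  its full multiplicity each time.\<close>

lemma holomorphic_factor_zeros:
  assumes f: "f holomorphic_on S" and S: "open S" "connected S" and nz: "\<exists>z\<in>S. f z \<noteq> 0"
    and K: "compact K" "K \<subseteq> S"
  shows "\<exists>m g. finite {z\<in>K. f z = 0} \<and> (\<forall>a\<in>{z\<in>K. f z = 0}. m a > (0::nat)) \<and> g holomorphic_on S \<and>
     (\<forall>z\<in>S. f z = (\<Prod>a\<in>{z\<in>K. f z = 0}. (z - a) ^ m a) * g z) \<and> (\<forall>z\<in>K. g z \<noteq> 0)"
  using f nz
proof (induction "card {z\<in>K. f z = 0}" arbitrary: f)
  case 0
  show ?case
  proof (cases "\<exists>a\<in>K. f a = 0")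
    case False
    then have e: "{z\<in>K. f z = 0} = {}" by auto
    show ?thesis unfolding e using 0(2) False by (intro exI[of _ "\<lambda>_. 0"] exI[of _ f]) auto
  next
    \<comment> \<open>Here \<open>card\<close> could be 0 only because an infinite set has
      cardinality 0 by convention; the identity theorem excludes this.\<close>
    case True
    then obtain a where a: "a \<in> K" "f a = 0" by auto
    have "\<not> f constant_on S"
    proof
      assume "f constant_on S"
      then obtain y where y: "\<forall>z\<in>S. f z = y" unfolding constant_on_def by blast
      with a K have "y = 0" by auto
      with y 0(3) show False by auto
    qed
    then have "finite {z\<in>K. f z = 0}" by (rule holomorphic_compact_finite_zeros[OF 0(2) S K])
    then show ?thesis using 0 a by auto
  qed
next
  case (Suc n)
  let ?Z = "{z\<in>K. f z = 0}"
  from Suc(2) have fin: "finite ?Z" by (metis card.infinite nat.distinct(1))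
  from Suc(2) obtain a where a: "a \<in> K" "f a = 0"
    by (metis (mono_tags, lifting) card.empty empty_Collect_eq nat.distinct(1))
  have nc: "\<not> f constant_on S"
  proof
    assume "f constant_on S"
    then obtain y where y: "\<forall>z\<in>S. f z = y" unfolding constant_on_def by blast
    with a K have "y = 0" by auto
    with y Suc(4) show False by auto
  qed
  obtain k g where g: "0 < k" "g holomorphic_on S" "\<And>z. z \<in> S \<Longrightarrow> f z = (z - a) ^ k * g z" "g a \<noteq> 0"
    by (rule holomorphic_factor_zero_global[OF Suc(3) S nc subsetD[OF K(2) a(1)] a(2)]) (rule that; assumption)
  have Zg: "{z\<in>K. g z = 0} = ?Z - {a}"
    using g K by auto
  have "n = card {z\<in>K. g z = 0}" unfolding Zg using Suc(2) fin a by simp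
  moreover have "\<exists>z\<in>S. g z \<noteq> 0" using g(4) a K by blast
  ultimately obtain m h where mh: "\<forall>b\<in>?Z - {a}. m b > 0" "h holomorphic_on S"
    "\<And>z. z \<in> S \<Longrightarrow> g z = (\<Prod>b\<in>?Z - {a}. (z - b) ^ m b) * h z" "\<And>z. z \<in> K \<Longrightarrow> h z \<noteq> 0"
    using Suc(1)[of g] g(2) unfolding Zg by blast
  have "f z = (\<Prod>b\<in>?Z. (z - b) ^ (m(a := k)) b) * h z" if "z \<in> S" for z
  proof -
    have "(\<Prod>b\<in>?Z. (z - b) ^ (m(a := k)) b) = (z - a) ^ k * (\<Prod>b\<in>?Z - {a}. (z - b) ^ (m(a := k)) b)"
      using fin a by (subst prod.remove[of _ a]) auto
    also have "(\<Prod>b\<in>?Z - {a}. (z - b) ^ (m(a := k)) b) = (\<Prod>b\<in>?Z - {a}. (z - b) ^ m b)"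
      by (intro prod.cong) auto
    finally show ?thesis using g(3)[OF that] mh(3)[OF that] by simp
  qed
  then show ?case using fin mh g(1) by (intro exI[of _ "m(a := k)"] exI[of _ h]) auto
qed

text \<open>A point on the circle of radius \<open>R\<close> is at least twice as far from a zero in
  \<open>Z\<close> as the centre \<open>c\<close> is. Dividing out the zeros therefore gains a
  factor \<open>2 ^ N\<close>, which counts them and at the same time bounds the quotient
  \<open>g\<close> relative to \<open>g c\<close>. The function \<open>E\<close> is the derivative
  of a logarithm of \<open>g\<close>.\<close>

lemma Landau_zeros:
  fixes f :: "complex \<Rightarrow> complex"
  assumes f: "f holomorphic_on ball c R'" and R: "0 < R" "R < R'" and fc: "f c \<noteq> 0" and M: "M > 0"
    and bound: "\<forall>z\<in>cball c R. norm (f z) \<le> exp M * norm (f c)"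
  defines "Z \<equiv> {z \<in> cball c (R / 3). f z = 0}"
  shows "\<exists>m E. finite Z \<and> (\<forall>a\<in>Z. m a > (0::nat)) \<and> real (\<Sum>a\<in>Z. m a) * ln 2 \<le> M \<and>
     E holomorphic_on ball c (R / 3) \<and>
     (\<forall>z\<in>ball c (R / 3). f z \<noteq> 0 \<longrightarrow> deriv f z / f z = (\<Sum>a\<in>Z. of_nat (m a) / (z - a)) + E z) \<and>
     (\<forall>z\<in>cball c (R / 4). norm (E z) \<le> 672 * M / R)"
proof -
  let ?S = "ball c R'"
  have K: "compact (cball c (R / 3))" "cball c (R / 3) \<subseteq> ?S" using R by auto
  have c: "c \<in> ?S" using R by simp
  have "\<exists>z\<in>?S. f z \<noteq> 0" using fc c by blast
  from holomorphic_factor_zeros[OF f open_ball connected_ball this K, folded Z_def]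
  obtain m g where mg: "finite Z" "\<forall>a\<in>Z. m a > 0" "g holomorphic_on ?S"
    "\<forall>z\<in>?S. f z = (\<Prod>a\<in>Z. (z - a) ^ m a) * g z" "\<forall>z\<in>cball c (R / 3). g z \<noteq> 0"
    by (elim exE conjE)
  note fin = mg(1) and g = mg(3)
  have m: "m a > 0" if "a \<in> Z" for a using mg(2) that by (rule bspec)
  have fg: "f z = (\<Prod>a\<in>Z. (z - a) ^ m a) * g z" if "z \<in> ?S" for z using mg(4) that by (rule bspec)
  have gnz: "g z \<noteq> 0" if "z \<in> cball c (R / 3)" for z using mg(5) that by (rule bspec)
  define N where "N = (\<Sum>a\<in>Z. m a)"
  have gc: "norm (g c) > 0" using gnz[of c] R by simp
  have sphere: "norm (g z) * 2 ^ N \<le> exp M * norm (g c)" if z: "norm (z - c) = R" for z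
  proof -
    have zS: "z \<in> ?S" and zc: "z \<in> cball c R" using z R by (auto simp: dist_norm norm_minus_commute)
    have pc: "norm (c - a) > 0" if "a \<in> Z" for a using that fc by (auto simp: Z_def)
    have pz: "2 * norm (c - a) \<le> norm (z - a)" if "a \<in> Z" for a
    proof -
      have "norm (c - a) \<le> R / 3" using that by (simp add: Z_def dist_norm)
      moreover have "R \<le> norm (z - a) + norm (c - a)"
        using norm_triangle_ineq4[of "z - a" "c - a"] z by simp
      ultimately show ?thesis by linarith
    qed
    have "(\<Prod>a\<in>Z. norm (c - a) ^ m a) * 2 ^ N = (\<Prod>a\<in>Z. (2 * norm (c - a)) ^ m a)"
      by (simp add: N_def power_mult_distrib prod.distrib power_sum mult.commute)
    also have "\<dots> \<le> (\<Prod>a\<in>Z. norm (z - a) ^ m a)"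
      using pz by (intro prod_mono conjI power_mono) auto
    finally have le: "(\<Prod>a\<in>Z. norm (c - a) ^ m a) * 2 ^ N \<le> (\<Prod>a\<in>Z. norm (z - a) ^ m a)" .
    have P: "(\<Prod>a\<in>Z. norm (c - a) ^ m a) > 0"
      using pc by (intro prod_pos) auto
    have nf: "norm (f w) = (\<Prod>a\<in>Z. norm (w - a) ^ m a) * norm (g w)" if "w \<in> ?S" for w
      using fg[OF that] by (simp add: norm_mult prod_norm[symmetric] norm_power)
    have "(\<Prod>a\<in>Z. norm (c - a) ^ m a) * (norm (g z) * 2 ^ N) \<le> (\<Prod>a\<in>Z. norm (z - a) ^ m a) * norm (g z)"
      using mult_right_mono[OF le, of "norm (g z)"] by (simp add: mult_ac)
    also have "\<dots> \<le> exp M * norm (f c)"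
      using bspec[OF bound zc] nf[OF zS] by simp
    also have "\<dots> = (\<Prod>a\<in>Z. norm (c - a) ^ m a) * (exp M * norm (g c))"
      using nf[OF c] by (simp add: mult_ac)
    finally show ?thesis using P by (simp only: mult_le_cancel_left_pos)
  qed
  have disc: "norm (g z) \<le> exp M * norm (g c) / 2 ^ N" if z: "z \<in> ball c R" for z
  proof (rule maximum_modulus_frontier[where S = "ball c R" and f = g and \<xi> = z])
    show "g holomorphic_on interior (ball c R)" using R by (intro holomorphic_on_subset[OF g]) auto
    show "continuous_on (closure (ball c R)) g"
      using R by (intro holomorphic_on_imp_continuous_on holomorphic_on_subset[OF g]) auto
    fix w assume "w \<in> frontier (ball c R)"
    then have "norm (w - c) = R" using R by (simp add: dist_norm norm_minus_commute)
    from sphere[OF this] show "norm (g w) \<le> exp M * norm (g c) / 2 ^ N"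
      by (simp add: field_simps)
  qed (use z in auto)
  have "norm (g c) * 2 ^ N \<le> norm (g c) * exp M" using disc[of c] R by (simp add: field_simps)
  then have "2 ^ N \<le> exp M" using gc by (simp only: mult_le_cancel_left_pos)
  then have "ln (2 ^ N) \<le> ln (exp M)" by (subst ln_le_cancel_iff) auto
  then have NM: "real N * ln 2 \<le> M" by (simp add: ln_realpow)
  have g3: "g holomorphic_on ball c (R / 3)" using R by (intro holomorphic_on_subset[OF g]) auto
  have con: "contractible (ball c (R / 3))"
    by (intro convex_imp_contractible convex_ball)
  have gnz3: "g z \<noteq> 0" if "z \<in> ball c (R / 3)" for z using gnz that by auto
  obtain h where h: "h holomorphic_on ball c (R / 3)" "\<And>z. z \<in> ball c (R / 3) \<Longrightarrow> g z = exp (h z)"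
    by (rule contractible_imp_holomorphic_log[OF g3 con gnz3]) (assumption, (rule that; assumption))
  define E where "E = deriv h"
  have E: "E holomorphic_on ball c (R / 3)"
    unfolding E_def using h(1) by (rule holomorphic_deriv) simp
  \<comment> \<open>\<open>2 * M\<close> instead of \<open>M\<close> makes the inequality strict, as
    \<open>Borel_Caratheodory\<close> requires.\<close>
  have Reh: "Re (h z) < 2 * M + Re (h c)" if z: "z \<in> ball c (R / 3)" for z
  proof -
    have c3: "c \<in> ball c (R / 3)" using R by simp
    have "norm (g z) \<le> exp M * norm (g c) / 2 ^ N" using z R by (intro disc) auto
    also have "\<dots> \<le> exp M * norm (g c) / 1" by (intro divide_left_mono) auto
    finally have "exp (Re (h z)) \<le> exp M * exp (Re (h c))"
      using h(2)[OF z] h(2)[OF c3] by (simp add: norm_exp_eq_Re)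
    then have "exp (Re (h z)) \<le> exp (M + Re (h c))" by (simp only: exp_add)
    then show ?thesis using M by simp
  qed
  have Ebound: "norm (E z) \<le> 672 * M / R" if z: "z \<in> cball c (R / 4)" for z
  proof -
    \<comment> \<open>The radii \<open>R / 4\<close>, \<open>7 * R / 24\<close> and
      \<open>R / 3\<close> are spaced by \<open>R / 24\<close>. The outer step serves
      Borel-Caratheodory, with the result \<open>28 * M\<close>; the inner one serves Cauchy's
      inequality, which multiplies by \<open>24 / R\<close>. Hence 672.\<close>
    have sub: "cball z (R / 24) \<subseteq> cball c (7 * R / 24)"
    proof
      fix w assume "w \<in> cball z (R / 24)"
      then show "w \<in> cball c (7 * R / 24)"
        using z dist_triangle[of c w z] by simp
    qed
    have sub3: "cball c (7 * R / 24) \<subseteq> ball c (R / 3)" using R by auto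
    have BC: "norm (h w - h c) \<le> 28 * M" if w: "w \<in> cball c (7 * R / 24)" for w
    proof -
      have "norm (h w - h c) \<le> 2 * (2 * M + Re (h c) - Re (h c)) * (7 * R / 24) / (R / 3 - 7 * R / 24)"
        by (rule Borel_Caratheodory[OF h(1) _ _ Reh w]) (use R in auto)
      also have "\<dots> = 28 * M" using R by (simp add: field_simps)
      finally show ?thesis .
    qed
    have "norm ((deriv ^^ 1) (\<lambda>w. h w - h c) z) \<le> fact 1 * (28 * M) / (R / 24) ^ 1"
    proof (rule Cauchy_inequality)
      have hol: "(\<lambda>w. h w - h c) holomorphic_on cball z (R / 24)"
        using sub sub3 by (intro holomorphic_intros holomorphic_on_subset[OF h(1)]) auto
      then show "(\<lambda>w. h w - h c) holomorphic_on ball z (R / 24)"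
        by (rule holomorphic_on_subset) auto
      show "continuous_on (cball z (R / 24)) (\<lambda>w. h w - h c)"
        using hol by (rule holomorphic_on_imp_continuous_on)
      fix x assume "norm (z - x) = R / 24"
      then have "x \<in> cball z (R / 24)" by (simp add: dist_norm)
      then show "norm (h x - h c) \<le> 28 * M" using sub by (intro BC) auto
    qed (use R in auto)
    moreover have "deriv (\<lambda>w. h w - h c) z = deriv h z"
    proof (rule DERIV_imp_deriv)
      have "z \<in> ball c (R / 3)" using z R by auto
      then have "(h has_field_derivative deriv h z) (at z)"
        by (intro holomorphic_derivI[OF h(1)]) auto
      then show "((\<lambda>w. h w - h c) has_field_derivative deriv h z) (at z)"
        by (auto intro!: derivative_eq_intros)
    qed
    ultimately show ?thesis by (simp add: E_def field_simps)
  qed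
  have log: "deriv f z / f z = (\<Sum>a\<in>Z. of_nat (m a) / (z - a)) + E z"
    if z: "z \<in> ball c (R / 3)" and fz: "f z \<noteq> 0" for z
  proof -
    have zS: "z \<in> ?S" using z R by auto
    have nz: "z - a \<noteq> 0" if "a \<in> Z" for a using that fz by (auto simp: Z_def)
    have dh: "(h has_field_derivative E z) (at z)"
      unfolding E_def by (rule holomorphic_derivI[OF h(1) _ z]) simp
    have dp: "((\<lambda>w. \<Prod>a\<in>Z. (w - a) ^ m a) has_field_derivative
        (\<Prod>a\<in>Z. (z - a) ^ m a) * (\<Sum>a\<in>Z. (of_nat (m a) * (z - a) ^ (m a - 1)) / (z - a) ^ m a)) (at z)"
      by (rule has_field_derivative_prod') (use nz in \<open>auto intro!: derivative_eq_intros\<close>)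
    have dm: "(of_nat (m a) * (z - a) ^ (m a - 1)) / (z - a) ^ m a = of_nat (m a) / (z - a)" if "a \<in> Z" for a
    proof -
      have "(z - a) ^ m a = (z - a) ^ (m a - 1) * (z - a)" using m[OF that] by (metis power_minus_mult)
      then show ?thesis using nz[OF that] by simp
    qed
    have "(\<Sum>a\<in>Z. (of_nat (m a) * (z - a) ^ (m a - 1)) / (z - a) ^ m a) = (\<Sum>a\<in>Z. of_nat (m a) / (z - a))"
      by (intro sum.cong refl dm)
    note dp = dp[unfolded this]
    have "((\<lambda>w. exp (h w)) has_field_derivative exp (h z) * E z) (at z)"
      using dh by (auto intro!: derivative_eq_intros)
    from DERIV_mult[OF dp this]
    have "((\<lambda>w. (\<Prod>a\<in>Z. (w - a) ^ m a) * exp (h w)) has_field_derivative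
        ((\<Prod>a\<in>Z. (z - a) ^ m a) * exp (h z)) * ((\<Sum>a\<in>Z. of_nat (m a) / (z - a)) + E z)) (at z)"
      by (simp add: algebra_simps)
    moreover have "(\<Prod>a\<in>Z. (w - a) ^ m a) * exp (h w) = f w" if "w \<in> ball c (R / 3)" for w
    proof -
      have "w \<in> ?S" using that R by auto
      then show ?thesis using fg h(2)[OF that] by simp
    qed
    ultimately have "(f has_field_derivative f z * ((\<Sum>a\<in>Z. of_nat (m a) / (z - a)) + E z)) (at z)"
      using z has_field_derivative_transform_within_open[OF _ open_ball z] by (metis (no_types, lifting))
    then show ?thesis using fz by (simp add: DERIV_imp_deriv)
  qed
  show ?thesis
    by (rule exI[of _ m], rule exI[of _ E]) (use fin m NM E Ebound log in \<open>auto simp: N_def\<close>)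
qed

section \<open>Zeros of zeta and gaps between ordinates\<close>

text \<open>For the lower bound all other factors of the 3-4-1 inequality are bounded by
  \<open>Q\<close>, which leaves \<open>1 \<le> (Q * x) ^ 4\<close> with
  \<open>x = norm (zeta s)\<close>.\<close>

lemma zeta_bounds_right:
  obtains Q where "Q \<ge> 1" "\<And>s. Re s \<ge> 3/2 \<Longrightarrow> norm (zeta s) \<le> Q" "\<And>s. Re s \<ge> 3/2 \<Longrightarrow> norm (zeta s) \<ge> 1 / Q"
proof -
  define Q where "Q = (\<Sum>n. real (Suc n) powr (- (3/2)))"
  have sm: "summable (\<lambda>n. real (Suc n) powr (- (3/2)))" by (rule summable_Suc_powr) simp
  have Q1: "Q \<ge> 1"
  proof -
    have "(\<Sum>n<1. real (Suc n) powr (- (3/2))) \<le> Q"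
      unfolding Q_def by (rule sum_le_suminf[OF sm]) auto
    then show ?thesis by simp
  qed
  have up: "norm (zeta s) \<le> Q" if "Re s \<ge> 3/2" for s
    unfolding Q_def using that by (rule norm_zeta_le)
  have lo: "norm (zeta s) \<ge> 1 / Q" if s: "Re s \<ge> 3/2" for s
  proof -
    define \<sigma> where "\<sigma> = Re s"
    define x where "x = norm (zeta s)"
    have s': "s = Complex \<sigma> (Im s)" by (simp add: \<sigma>_def)
    have "1 \<le> norm (zeta (Complex \<sigma> 0)) ^ 3 * norm (zeta (Complex \<sigma> (Im s))) ^ 4 * norm (zeta (Complex \<sigma> (2 * Im s)))"
      by (rule three_four_one) (use s in \<open>simp add: \<sigma>_def\<close>)
    also have "\<dots> \<le> Q ^ 3 * x ^ 4 * Q"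
      unfolding x_def s'[symmetric] using s Q1
      by (intro mult_mono power_mono up) (auto simp: \<sigma>_def)
    also have "\<dots> = (Q * x) ^ 4" by (simp add: power_mult_distrib power4_eq_xxxx power3_eq_cube mult_ac)
    finally have "1 ^ 4 \<le> (Q * x) ^ 4" by simp
    then have "1 \<le> Q * x" using Q1 by (subst (asm) power_mono_iff) (auto simp: x_def)
    then show ?thesis using Q1 by (simp add: x_def field_simps)
  qed
  show thesis using that[OF Q1 up lo] .
qed

text \<open>The exponent is irrelevant, since only the logarithm of the bound enters later. The
  ranges cover the disc of radius 11/2 around 4 + iT and the disc of radius 8 around 2 + iT;
  \<open>T \<ge> C\<close> absorbs the constant.\<close>

lemma zeta_growth:
  obtains N :: nat and T0 :: real where "T0 \<ge> 20"
    "\<And>T s. T \<ge> T0 \<Longrightarrow> Re s \<ge> - 6 \<Longrightarrow> Im s \<ge> 1 \<Longrightarrow> norm s \<le> T + 12 \<Longrightarrow> norm (zeta s) \<le> T ^ N"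
proof -
  obtain Z where Z: "Z holomorphic_on UNIV" "\<And>s. s \<noteq> 1 \<Longrightarrow> Z s = (s - 1) * zeta s"
    using zeta_times_entire by metis
  obtain C N where CN: "C \<ge> 0" "\<And>s. Re s \<ge> 3/2 - real 8 \<Longrightarrow> norm (Z s) \<le> C * (1 + norm s) ^ N"
    using poly_bounded_on_zeta[OF Z, of 8] unfolding poly_bounded_on_def by auto
  show thesis
  proof (rule that[of "max 20 C" "2 * N + 1"])
    fix T s assume T: "T \<ge> max 20 C" and s: "Re s \<ge> - 6" "Im s \<ge> 1" "norm s \<le> T + 12"
    have s1: "s \<noteq> 1" using s by auto
    have "1 \<le> \<bar>Im (s - 1)\<bar>" using s by simp
    also have "\<dots> \<le> norm (s - 1)" by (rule abs_Im_le_cmod)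
    finally have "1 * norm (zeta s) \<le> norm (s - 1) * norm (zeta s)" by (intro mult_right_mono) auto
    also have "\<dots> = norm (Z s)" using Z(2)[OF s1] by (simp add: norm_mult)
    also have "\<dots> \<le> C * (1 + norm s) ^ N" using s by (intro CN) auto
    also have "\<dots> \<le> T * (T\<^sup>2) ^ N"
    proof (intro mult_mono power_mono)
      have "20 * T \<le> T * T" using T by (intro mult_right_mono) auto
      moreover have "1 + norm s \<le> 20 * T" using s T by simp
      ultimately show "1 + norm s \<le> T\<^sup>2" unfolding power2_eq_square by linarith
    qed (use T CN in auto)
    also have "\<dots> = T ^ (2 * N + 1)" by (simp add: power_mult)
    finally show "norm (zeta s) \<le> T ^ (2 * N + 1)" by simp
  qed simp
qed

section \<open>Nonreal zeros, and zeta on the line of real part -1/2\<close>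

lemma cos_nonzero_Im: "Im z \<noteq> 0 \<Longrightarrow> cos z \<noteq> (0 :: complex)"
  by (auto simp: cos_eq_0)

text \<open>For \<open>Re s \<le> 0\<close> the functional equation at \<open>1 - s\<close>
  expresses \<open>zeta s * rGamma (1 - s)\<close> as a product of nonzero factors. As the Riemann
  Hypothesis speaks of the open strip, this is what puts all nonreal zeros on the critical
  line.\<close>

lemma zeta_zero_strip:
  assumes "zeta s = 0" "Im s \<noteq> 0"
  shows "0 < Re s" "Re s < 1"
proof -
  have s: "s \<noteq> 1" "1 - s \<noteq> 0" "1 - s \<noteq> 1" using assms by (auto simp: complex_eq_iff)
  show "Re s < 1" using zeta_nonzero[of s] assms s by force
  show "0 < Re s"
  proof (rule ccontr)
    assume "\<not> 0 < Re s"
    then have "zeta (1 - s) \<noteq> 0" using s by (intro zeta_nonzero) auto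
    moreover have "cos (of_real pi * (1 - s) / 2) \<noteq> 0"
      by (rule cos_nonzero_Im) (use assms in simp)
    moreover have "(2 * of_real pi) powr (- (1 - s)) \<noteq> (0 :: complex)" by simp
    ultimately show False
      using zeta_functional_equation[OF s(2,3)] assms(1) by simp
  qed
qed

lemma norm_cos_complex_squared:
  "(norm (cos z))\<^sup>2 = (cos (Re z))\<^sup>2 + (sinh (Im z))\<^sup>2"
proof -
  have "cos z = cos (of_real (Re z)) * cos (\<i> * of_real (Im z)) - sin (of_real (Re z)) * sin (\<i> * of_real (Im z))"
    by (subst cos_add[symmetric], subst complex_eq[of z]) simp
  also have "\<dots> = Complex (cos (Re z) * cosh (Im z)) (- (sin (Re z) * sinh (Im z)))"
    unfolding cos_i_times_of_real sin_i_times_of_real by (simp add: complex_eq_iff cos_of_real sin_of_real)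
  finally have "(norm (cos z))\<^sup>2 = (cos (Re z))\<^sup>2 * (cosh (Im z))\<^sup>2 + (sin (Re z))\<^sup>2 * (sinh (Im z))\<^sup>2"
    by (simp add: cmod_power2 power_mult_distrib)
  also have "\<dots> = (cos (Re z))\<^sup>2 + (sinh (Im z))\<^sup>2"
  proof -
    have 1: "(cosh (Im z))\<^sup>2 = (sinh (Im z))\<^sup>2 + 1" by (rule cosh_square_eq)
    have 2: "(sin (Re z))\<^sup>2 = 1 - (cos (Re z))\<^sup>2" by (rule sin_squared_eq)
    show ?thesis unfolding 1 2 by algebra
  qed
  finally show ?thesis .
qed

lemma norm_sin_complex_squared:
  "(norm (sin z))\<^sup>2 = (sin (Re z))\<^sup>2 + (sinh (Im z))\<^sup>2"
proof -
  have "sin z = cos (z - of_real (pi / 2))" by (simp add: cos_diff cos_of_real sin_of_real del: of_real_divide)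
  then have "(norm (sin z))\<^sup>2 = (norm (cos (z - of_real (pi / 2))))\<^sup>2" by (simp only:)
  then show ?thesis unfolding norm_cos_complex_squared by (simp add: cos_diff)
qed

text \<open>At real part 1/2 the reflected argument \<open>1 - z\<close> is \<open>cnj z\<close>, so
  the reflection formula evaluates \<open>Gamma z\<close> times its conjugate.\<close>

lemma norm_Gamma_half_line:
  "(norm (Gamma (Complex (1/2) t)))\<^sup>2 = pi / cosh (pi * t)"
proof -
  let ?z = "Complex (1/2) t"
  have "1 - ?z = cnj ?z" by (simp add: complex_eq_iff)
  then have "complex_of_real ((norm (Gamma ?z))\<^sup>2) = Gamma ?z * Gamma (1 - ?z)"
    by (simp only: cnj_Gamma[symmetric] complex_norm_square)
  also have "\<dots> = of_real pi / sin (of_real pi * ?z)" by (rule Gamma_reflection_complex)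
  also have "of_real pi * ?z = of_real (pi / 2) + \<i> * of_real (pi * t)" by (simp add: complex_eq_iff)
  also have "sin \<dots> = of_real (cosh (pi * t))"
    unfolding sin_add cos_i_times_of_real by (simp add: cos_of_real sin_of_real del: of_real_divide)
  finally show ?thesis by (simp only: of_real_divide[symmetric] of_real_eq_iff)
qed

text \<open>The functional equation is used at 3/2 - iT, with the Gamma factor written as
  \<open>w * Gamma w\<close> for w = 1/2 - iT. The moduli of \<open>Gamma w\<close> and of the
  cosine multiply to exactly \<open>sqrt (pi / 2)\<close>, so no Stirling estimate is needed and the
  growth is that of \<open>norm w\<close>.\<close>

lemma zeta_lower_left:
  obtains c where "c > 0" "\<And>T. T \<ge> 1 \<Longrightarrow> norm (zeta (Complex (- 1/2) T)) \<ge> c * T"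
proof -
  obtain Q where Q: "Q \<ge> 1" "\<And>s. Re s \<ge> 3/2 \<Longrightarrow> norm (zeta s) \<ge> 1 / Q"
    using zeta_bounds_right by metis
  define d where "d = 2 * (2 * pi) powr (- 3/2) * sqrt (pi / 2)"
  have d: "d > 0" by (simp add: d_def)
  show thesis
  proof (rule that[of "d / Q"])
    show "d / Q > 0" using d Q by simp
    fix T :: real assume T: "T \<ge> 1"
    define s where "s = Complex (3/2) (- T)"
    have s: "s \<noteq> 0" "s \<noteq> 1" "1 - s = Complex (- 1/2) T" by (auto simp: s_def complex_eq_iff)
    define w where "w = Complex (1/2) (- T)"
    have w: "w \<noteq> 0" "w + 1 = s" "w \<notin> \<int>\<^sub>\<le>\<^sub>0" 
      using T by (auto simp: s_def w_def complex_eq_iff elim!: nonpos_Ints_cases)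
    have G: "Gamma s = w * Gamma w" using Gamma_plus1[OF w(3)] w(2) by simp
    have Gs: "Gamma s * rGamma s = 1"
    proof -
      have "s \<notin> \<int>\<^sub>\<le>\<^sub>0" by (rule Re_pos_not_nonpos_Int) (simp add: s_def)
      then show ?thesis by (simp add: Gamma_def rGamma_eq_zero_iff)
    qed
    have "zeta (1 - s) = (Gamma s * rGamma s) * zeta (1 - s)" unfolding Gs by simp
    also have "\<dots> = Gamma s * (zeta (1 - s) * rGamma s)" by (simp only: mult_ac)
    also have "\<dots> = w * Gamma w * (2 * (2 * of_real pi) powr (- s) * cos (of_real pi * s / 2) * zeta s)"
      unfolding G zeta_functional_equation[OF s(1,2)] ..
    finally have "norm (zeta (1 - s)) = norm w * 2 * norm ((2 * of_real pi) powr (- s) :: complex) *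
        (norm (Gamma w) * norm (cos (of_real pi * s / 2))) * norm (zeta s)"
      by (simp add: norm_mult mult_ac)
    also have "norm ((2 * of_real pi) powr (- s) :: complex) = (2 * pi) powr (- 3/2)"
      by (subst norm_powr_real_powr) (auto simp: s_def)
    also have "norm (Gamma w) * norm (cos (of_real pi * s / 2)) = sqrt (pi / 2)"
    proof -
      have "(norm (cos (of_real pi * s / 2)))\<^sup>2 = (cos (3 / 4 * pi))\<^sup>2 + (sinh (pi * T / 2))\<^sup>2"
        unfolding norm_cos_complex_squared by (simp add: s_def mult_ac)
      also have "(cos (3 / 4 * pi))\<^sup>2 = 1 / 2"
      proof -
        have "cos (3 / 4 * pi) = - cos (pi / 4)" using cos_pi_minus[of "pi / 4"] by (simp add: field_simps)
        then show ?thesis by (simp add: cos_45 power_divide)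
      qed
      also have "1 / 2 + (sinh (pi * T / 2))\<^sup>2 = cosh (pi * T) / 2"
        using cosh_double[of "pi * T / 2"] cosh_square_eq[of "pi * T / 2"] by simp
      finally have "(norm (Gamma w) * norm (cos (of_real pi * s / 2)))\<^sup>2 = pi / cosh (pi * - T) * (cosh (pi * T) / 2)"
        unfolding power_mult_distrib w_def norm_Gamma_half_line by (simp only:)
      also have "\<dots> = pi / 2" using cosh_real_pos[of "pi * T"] by simp
      finally have "(norm (Gamma w) * norm (cos (of_real pi * s / 2)))\<^sup>2 = pi / 2" .
      then show ?thesis by (metis abs_of_nonneg mult_nonneg_nonneg norm_ge_zero real_sqrt_abs)
    qed
    finally have eq: "norm (zeta (1 - s)) = norm w * d * norm (zeta s)" by (simp add: d_def)
    have "T \<le> norm w" using abs_Im_le_cmod[of w] T by (simp add: w_def)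
    moreover have "norm (zeta s) \<ge> 1 / Q" by (rule Q) (simp add: s_def)
    ultimately have "T * d * (1 / Q) \<le> norm w * d * norm (zeta s)"
      using d Q(1) T by (intro mult_mono) auto
    then show "d / Q * T \<le> norm (zeta (Complex (- 1/2) T))"
      unfolding eq[symmetric] s(3) by (simp add: mult_ac)
  qed
qed

text \<open>Without an ordinate within 6 of \<open>T\<close>, zeta has a logarithm \<open>h\<close>
  on the disc of radius 11/2 around 4 + iT. Its increment from the centre is O(1) at radius 1 and
  O(ln T) at radius 5; interpolated to radius 9/2 it is at most about half of \<open>ln T\<close>,
  while the point -1/2 + iT on that circle forces at least \<open>ln T - O(1)\<close>.\<close>

lemma zeta_zero_gap:
  assumes RH: riemann_hypothesis
  obtains T0 where "\<And>T. T \<ge> T0 \<Longrightarrow> \<exists>y. \<bar>y - T\<bar> < 6 \<and> zeta (Complex (1/2) y) = 0"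
proof -
  obtain Q where Q: "Q \<ge> 1" "\<And>s. Re s \<ge> 3/2 \<Longrightarrow> norm (zeta s) \<le> Q" "\<And>s. Re s \<ge> 3/2 \<Longrightarrow> norm (zeta s) \<ge> 1 / Q"
    using zeta_bounds_right by metis
  obtain N T1 where N: "T1 \<ge> 20"
    "\<And>T s. T \<ge> T1 \<Longrightarrow> Re s \<ge> - 6 \<Longrightarrow> Im s \<ge> 1 \<Longrightarrow> norm s \<le> T + 12 \<Longrightarrow> norm (zeta s) \<le> T ^ N"
    using zeta_growth by metis
  obtain c0 where c0: "c0 > 0" "\<And>T. T \<ge> 1 \<Longrightarrow> norm (zeta (Complex (- 1/2) T)) \<ge> c0 * T"
    using zeta_lower_left by metis
  define q where "q = ln Q"
  have q: "q \<ge> 0" using Q by (simp add: q_def)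
  \<comment> \<open>The factor 20 is 2 times 5 divided by 1/2, from Borel-Caratheodory between the
    radii 5 and 11/2.\<close>
  define B where "B = (\<lambda>T. 20 * (real N * ln T + 1 + q))"
  \<comment> \<open>9/10 is the ratio of the radii 9/2 and 5. This \<open>p\<close> brings the
    leading part \<open>20 * N * ln T\<close> of the outer bound down to at most
    \<open>ln T / 2\<close>.\<close>
  obtain p where p: "(9 / 10) ^ p < 1 / (40 * (real N + 1))"
    using real_arch_pow_inv[of "1 / (40 * (real N + 1))" "9 / 10 :: real"] by auto
  define A where "A = 2 * (2 * q + 1)"
  have lim: "filterlim (\<lambda>T. ln T :: real) at_top at_top" by (rule ln_at_top)
  then have "eventually (\<lambda>T. ln T > max 0 (max (q - ln c0 + A * (9 / 2) ^ p) (2 * (q - ln c0 + 20 * (1 + q))))) at_top"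
    unfolding filterlim_at_top_dense by blast
  then obtain T2 where T2: "\<And>T. T \<ge> T2 \<Longrightarrow> ln T > 0 \<and> ln T > q - ln c0 + A * (9 / 2) ^ p \<and> ln T > 2 * (q - ln c0 + 20 * (1 + q))"
    by (auto simp: eventually_at_top_linorder)
  show thesis
  proof (rule that[of "max T1 T2"], rule ccontr)
    fix T assume T: "T \<ge> max T1 T2" and none: "\<not> (\<exists>y. \<bar>y - T\<bar> < 6 \<and> zeta (Complex (1/2) y) = 0)"
    have T20: "T \<ge> 20" using T N by auto
    define c where "c = Complex 4 T"
    let ?R = "11 / 2 :: real"
    have coord: "\<bar>Re s - 4\<bar> \<le> r" "\<bar>Im s - T\<bar> \<le> r" if "norm (s - c) \<le> r" for s r
      using that abs_Re_le_cmod[of "s - c"] abs_Im_le_cmod[of "s - c"] by (auto simp: c_def)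
    have in_ball: "norm (s - c) < ?R" if "s \<in> ball c ?R" for s using that by (simp add: dist_norm norm_minus_commute)
    have nz: "zeta s \<noteq> 0" if s: "s \<in> ball c ?R" for s
    proof
      assume z: "zeta s = 0"
      have im: "\<bar>Im s - T\<bar> \<le> ?R" using in_ball[OF s] by (intro coord) simp
      then have "Im s \<noteq> 0" using T20 by auto
      from zeta_zero_strip[OF z this] RH z have "Re s = 1/2" unfolding riemann_hypothesis_def by blast
      then have "s = Complex (1/2) (Im s)" by (simp add: complex_eq_iff)
      with z have "zeta (Complex (1/2) (Im s)) = 0" by (simp only:)
      moreover have "\<bar>Im s - T\<bar> < 6" using im by simp
      ultimately show False using none by blast
    qed
    have hol: "zeta holomorphic_on ball c ?R"
    proof (rule zeta_holomorphic)
      show "1 \<notin> ball c ?R" using in_ball[of 1] coord(2)[of 1 ?R] T20 by auto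
    qed
    have con: "contractible (ball c ?R)" by (intro convex_imp_contractible convex_ball)
    obtain h where h: "h holomorphic_on ball c ?R" "\<And>z. z \<in> ball c ?R \<Longrightarrow> zeta z = exp (h z)"
      by (rule contractible_imp_holomorphic_log[OF hol con nz]) (assumption, (rule that; assumption))
    have Reh: "Re (h z) = ln (norm (zeta z))" if "z \<in> ball c ?R" for z
      using h(2)[OF that] by (simp add: norm_exp_eq_Re)
    have Q0: "ln (1 / Q) = - q" using Q by (simp add: q_def ln_div)
    have Qb: "Re (h z) \<le> q" "Re (h z) \<ge> - q" if "z \<in> ball c ?R" "Re z \<ge> 3/2" for z
    proof -
      have "norm (zeta z) > 0" using nz that by simp
      then show "Re (h z) \<le> q" unfolding Reh[OF that(1)] q_def
        using Q(1,2) that(2) by (subst ln_le_cancel_iff) auto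
      show "Re (h z) \<ge> - q" unfolding Reh[OF that(1)] Q0[symmetric]
        using Q(1) Q(3)[OF that(2)] \<open>norm (zeta z) > 0\<close> by (subst ln_le_cancel_iff) auto
    qed
    have c: "c \<in> ball c ?R" "Re c \<ge> 3/2" by (auto simp: c_def)
    have b1: "norm (h z - h c) \<le> A" if z: "norm (z - c) = 1" for z
    proof -
      have "norm (h z - h c) \<le> 2 * ((q + 1) - Re (h c)) * 1 / (2 - 1)"
      proof (rule Borel_Caratheodory[where f = h and A = "q + 1"])
        show "h holomorphic_on ball c 2" by (rule holomorphic_on_subset[OF h(1)]) auto
        fix w assume w: "w \<in> ball c 2"
        then have "norm (w - c) \<le> 2" by (simp add: dist_norm norm_minus_commute)
        from coord(1)[OF this] have "Re w \<ge> 3/2" by simp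
        moreover have "w \<in> ball c ?R" using w by auto
        ultimately show "Re (h w) < q + 1" using Qb(1)[of w] by simp
      qed (use z in \<open>auto simp: dist_norm norm_minus_commute\<close>)
      also have "\<dots> \<le> A" using Qb(2)[OF c] by (simp add: A_def)
      finally show ?thesis .
    qed
    have lnT: "ln (T ^ N) = real N * ln T" using T20 by (simp add: ln_realpow)
    have b3: "norm (h z - h c) \<le> B T" if z: "norm (z - c) = 5" for z
    proof -
      have "norm (h z - h c) \<le> 2 * ((real N * ln T + 1) - Re (h c)) * 5 / (11 / 2 - 5)"
      proof (rule Borel_Caratheodory[OF h(1), where A = "real N * ln T + 1"])
        fix w assume w: "w \<in> ball c (11 / 2)"
        have wc: "norm (w - c) \<le> ?R" using in_ball[OF w] by simp
        have "norm w \<le> norm (w - c) + norm c" using norm_triangle_ineq[of "w - c" c] by simp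
        also have "norm c \<le> 4 + T" using cmod_le[of c] T20 by (simp add: c_def)
        finally have "norm w \<le> T + 12" using wc by simp
        moreover have "Re w \<ge> - 6" using coord(1)[OF wc] by linarith
        moreover have "Im w \<ge> 1" using coord(2)[OF wc] T20 by linarith
        ultimately have "norm (zeta w) \<le> T ^ N" using T by (intro N) auto
        then have "ln (norm (zeta w)) \<le> ln (T ^ N)" using nz[OF w] T20 by (subst ln_le_cancel_iff) auto
        then show "Re (h w) < real N * ln T + 1" using Reh[OF w] lnT by simp
      qed (use z in \<open>auto simp: dist_norm norm_minus_commute\<close>)
      also have "\<dots> \<le> B T" using Qb(2)[OF c] by (simp add: B_def)
      finally show ?thesis .
    qed
    define z where "z = Complex (- 1/2) T"
    have zc: "norm (z - c) = 9/2" by (simp add: z_def c_def cmod_def)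
    have zb: "z \<in> ball c ?R" using zc by (simp add: dist_norm norm_minus_commute)
    have "norm (h z - h c) \<le> max (A * ((9/2) / 1) ^ p) (B T * ((9/2) / 5) ^ p)"
      by (rule three_circles[where f = "\<lambda>z. h z - h c" and R = ?R and c = c])
         (use b1 b3 zc in \<open>auto intro!: holomorphic_intros h(1)\<close>)
    moreover have "ln T + ln c0 - q \<le> norm (h z - h c)"
    proof -
      have "ln (c0 * T) \<le> ln (norm (zeta z))"
        using c0 T20 c0(2)[of T] nz[OF zb] by (subst ln_le_cancel_iff) (auto simp: z_def)
      then have "ln T + ln c0 \<le> Re (h z)" unfolding Reh[OF zb] using c0(1) T20 by (simp add: ln_mult)
      moreover have "Re (h c) \<le> q" by (rule Qb(1)[OF c])
      ultimately have "ln T + ln c0 - q \<le> Re (h z - h c)" by simp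
      also have "\<dots> \<le> norm (h z - h c)" by (rule complex_Re_le_cmod)
      finally show ?thesis .
    qed
    moreover have "A * ((9/2) / 1) ^ p < ln T + ln c0 - q" using T2[of T] T by simp
    moreover have "B T * ((9/2) / 5) ^ p < ln T + ln c0 - q"
    proof -
      have L0: "ln T > 0" and L2: "ln T > 2 * (q - ln c0 + 20 * (1 + q))" using T2[of T] T by auto
      have "real N * ln T * (9 / 10) ^ p \<le> (real N + 1) * ln T * (1 / (40 * (real N + 1)))"
        using p L0 by (intro mult_mono) auto
      also have "\<dots> = ln T / 40" by (simp add: field_simps)
      finally have 1: "20 * (real N * ln T * (9 / 10) ^ p) \<le> ln T / 2" by simp
      have "(9 / 10 :: real) ^ p \<le> 1" by (intro power_le_one) auto
      then have "20 * (1 + q) * (9 / 10) ^ p \<le> 20 * (1 + q) * 1"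
        using q by (intro mult_left_mono) auto
      moreover have "B T * (9 / 10) ^ p = 20 * (real N * ln T * (9 / 10) ^ p) + 20 * (1 + q) * (9 / 10) ^ p"
        by (simp add: B_def algebra_simps)
      ultimately show ?thesis using 1 L2 by simp
    qed
    ultimately show False by simp
  qed
qed

section \<open>The logarithmic derivative on the critical line\<close>

text \<open>The series is compared term by term with half of a harmonic sum of length about
  \<open>t\<close>, up to a convergent error. Giving away half of the true size \<open>ln t\<close>
  avoids asymptotic formulas; this is why the critical-line estimate has
  \<open>ln t / 4\<close>.\<close>

lemma Re_Digamma_half_line:
  obtains C where "\<And>t. t \<ge> 1 \<Longrightarrow> Re (Digamma (Complex (1/2) t)) \<ge> ln t / 2 - C"
proof -
  have sm2: "summable (\<lambda>k. 1 / (real (Suc k))\<^sup>2)"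
    using inverse_squares_sums by (simp add: sums_iff add.commute)
  define S where "S = (\<Sum>k. 1 / (real (Suc k))\<^sup>2)"
  show thesis
  proof (rule that[of "S + Re euler_mascheroni"])
    fix t :: real assume t: "t \<ge> 1"
    define z where "z = Complex (1/2) t"
    have z0: "z \<noteq> 0" by (simp add: z_def complex_eq_iff)
    define n where "n = nat \<lfloor>t\<rfloor>"
    have n: "real n \<le> t" "t < real n + 1" using t by (auto simp: n_def)
    define f where "f = (\<lambda>k. Re (inverse (of_nat (Suc k)) - inverse (z + of_nat k)))"
    define g where "g = (\<lambda>k. (if k \<in> {..<n} then inverse (real (Suc k)) / 2 else 0) + - (1 / (real (Suc k))\<^sup>2))"
    have smf: "f sums (Re (Digamma z) + Re euler_mascheroni)"
    proof -
      have "(\<lambda>k. inverse (of_nat (Suc k)) - inverse (z + of_nat k)) sums (Digamma z + euler_mascheroni)"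
        using summable_sums[OF summable_Digamma[OF z0]] by (simp add: Digamma_def)
      from sums_Re[OF this] show ?thesis by (simp add: f_def)
    qed
    have "(\<lambda>k. if k \<in> {..<n} then inverse (real (Suc k)) / 2 else 0) sums (\<Sum>k<n. inverse (real (Suc k)) / 2)"
      by (rule sums_If_finite_set) simp
    moreover have "(\<Sum>k<n. inverse (real (Suc k)) / 2) = harm n / 2"
      unfolding sum_divide_distrib[symmetric] harm_def by (simp only: sum.atLeast1_atMost_eq One_nat_def)
    ultimately have smg: "g sums (harm n / 2 + - S)"
      unfolding g_def S_def by (intro sums_add sums_minus summable_sums sm2) (simp only:)
    have "g k \<le> f k" for k
    proof -
      define a where "a = real k + 1/2"
      have a: "a > 0" by (simp add: a_def add_nonneg_pos)
      have fk: "f k = 1 / real (Suc k) - a / (a\<^sup>2 + t\<^sup>2)"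
      proof -
        have "Re (inverse (of_nat (Suc k))) = 1 / real (Suc k)"
          by (simp add: inverse_eq_divide power2_eq_square)
        moreover have "Re (inverse (z + of_nat k)) = a / (a\<^sup>2 + t\<^sup>2)"
          by (simp add: z_def a_def add.commute)
        ultimately show ?thesis by (simp only: f_def minus_complex.sel)
      qed
      have at: "a\<^sup>2 + t\<^sup>2 > 0" using a by (simp add: add_pos_nonneg)
      have "a / (a\<^sup>2 + t\<^sup>2) = 1 / a - t\<^sup>2 / (a * (a\<^sup>2 + t\<^sup>2))"
      proof -
        have "1 / a - t\<^sup>2 / (a * w) = (w - t\<^sup>2) / (a * w)" if "w > 0" for w
          using a that by (simp add: diff_divide_distrib)
        from this[OF at] show ?thesis using a by (simp add: power2_eq_square)
      qed
      \<comment> \<open>Splitting off \<open>1 / a\<close> isolates the effect of \<open>t\<close>: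
        the difference of reciprocals is of order k^(-2), and the remaining term is nonnegative and
        at least \<open>1 / (2 * a)\<close> as long as \<open>a \<le> t\<close>.\<close>
      then have fk2: "f k = (1 / real (Suc k) - 1 / a) + t\<^sup>2 / (a * (a\<^sup>2 + t\<^sup>2))" unfolding fk by simp
      have 1: "1 / real (Suc k) - 1 / a \<ge> - (1 / (real (Suc k))\<^sup>2)"
      proof -
        have "1 / real (Suc k) - 1 / a = - (1 / (real (Suc k) * (2 * a)))"
        proof -
          have "1 / b - 1 / a = - (1 / (b * (2 * a)))" if b: "b > 0" "b = a + 1/2" for b
          proof -
            have "1 / b - 1 / a = (a - b) / (b * a)" using a b(1) by (simp add: diff_divide_distrib)
            also have "a - b = - (1 / 2)" using b(2) by simp
            finally show ?thesis by (simp add: mult_ac)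
          qed
          from this[of "real (Suc k)"] show ?thesis by (simp add: a_def)
        qed
        moreover have "1 / (real (Suc k) * (2 * a)) \<le> 1 / (real (Suc k))\<^sup>2"
          unfolding power2_eq_square by (intro divide_left_mono mult_left_mono mult_pos_pos) (auto simp: a_def add_nonneg_pos)
        ultimately show ?thesis by simp
      qed
      have 2: "(if k \<in> {..<n} then inverse (real (Suc k)) / 2 else 0) \<le> t\<^sup>2 / (a * (a\<^sup>2 + t\<^sup>2))"
      proof (cases "k < n")
        case True
        then have "a \<le> t" using n by (simp add: a_def)
        then have "a\<^sup>2 \<le> t\<^sup>2" using a by (intro power_mono) auto
        have "inverse (real (Suc k)) / 2 = 1 / (2 * real (Suc k))" by (simp add: field_simps)
        also have "\<dots> \<le> 1 / (2 * a)"
          using a by (intro divide_left_mono) (auto simp: a_def)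
        also have "\<dots> = t\<^sup>2 / (a * (t\<^sup>2 + t\<^sup>2))" using t by (simp add: power2_eq_square)
        also have "\<dots> \<le> t\<^sup>2 / (a * (a\<^sup>2 + t\<^sup>2))"
          using a at t \<open>a\<^sup>2 \<le> t\<^sup>2\<close> by (intro divide_left_mono mult_left_mono mult_pos_pos) auto
        finally show ?thesis using True by simp
      next
        case False
        then show ?thesis using a at by simp
      qed
      show ?thesis unfolding fk2 g_def using 1 2 by simp
    qed
    then have "harm n / 2 + - S \<le> Re (Digamma z) + Re euler_mascheroni"
      by (rule sums_le[OF _ smg smf])
    moreover have "ln t \<le> harm n"
    proof -
      have "ln t \<le> ln (real n + 1)" using t n by simp
      also have "\<dots> \<le> harm n" by (rule ln_le_harm)
      finally show ?thesis .
    qed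
    ultimately show "Re (Digamma (Complex (1/2) t)) \<ge> ln t / 2 - (S + Re euler_mascheroni)"
      by (simp add: z_def)
  qed
qed

lemma zeta_has_field_derivative: "s \<noteq> 1 \<Longrightarrow> (zeta has_field_derivative deriv zeta s) (at s)"
  by (rule holomorphic_derivI[where S = "- {1}"]) (auto intro: zeta_holomorphic)

lemma deriv_zeta_cnj:
  assumes "s \<noteq> 1"
  shows "deriv zeta (cnj s) = cnj (deriv zeta s)"
proof (rule DERIV_imp_deriv)
  have "(cnj \<circ> zeta \<circ> cnj has_field_derivative cnj (deriv zeta s)) (at (cnj s))"
    using zeta_has_field_derivative[OF assms] by (intro has_field_derivative_cnj_cnj) simp
  moreover have "cnj \<circ> zeta \<circ> cnj = zeta" by (simp add: fun_eq_iff zeta_cnj)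
  ultimately show "(zeta has_field_derivative cnj (deriv zeta s)) (at (cnj s))" by simp
qed

text \<open>The logarithmic derivative of the functional equation at a point \<open>s\<close> with \<open>1 - s = cnj s\<close>
  determines the real part of \<open>zeta' / zeta\<close>.\<close>

lemma Re_logderiv_zeta_critical_line:
  obtains C where "\<And>t. t \<ge> 1 \<Longrightarrow> zeta (Complex (1/2) t) \<noteq> 0 \<Longrightarrow>
    Re (deriv zeta (Complex (1/2) t) / zeta (Complex (1/2) t)) \<le> C - ln t / 4"
proof -
  obtain C where C: "\<And>t. t \<ge> 1 \<Longrightarrow> Re (Digamma (Complex (1/2) t)) \<ge> ln t / 2 - C"
    using Re_Digamma_half_line by metis
  show thesis
  proof (rule that[of "(ln (2 * pi) + pi / 2 + C) / 2"])
    fix t :: real assume t: "t \<ge> 1" and nz: "zeta (Complex (1/2) t) \<noteq> 0"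
    define s where "s = Complex (1/2) t"
    have s: "s \<noteq> 0" "s \<noteq> 1" "1 - s = cnj s" "1 - s \<noteq> 1" by (auto simp: s_def complex_eq_iff)
    let ?X = "\<lambda>s. 2 * (2 * of_real pi) powr (- s) * cos (of_real pi * s / 2) :: complex"
    define T where "T = sin (of_real pi * s / 2) / cos (of_real pi * s / 2)"
    have cos0: "cos (of_real pi * s / 2) \<noteq> 0" by (rule cos_nonzero_Im) (use t in \<open>simp add: s_def\<close>)
    have dX: "(?X has_field_derivative ?X s * (- of_real (ln (2 * pi)) - of_real (pi / 2) * T)) (at s)"
    proof -
      have ln: "ln (2 * of_real pi) = complex_of_real (ln (2 * pi))"
        using Ln_of_real[of "2 * pi"] by simp
      have "((\<lambda>s. - s) has_field_derivative - 1) (at s)" by (auto intro!: derivative_eq_intros)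
      from DERIV_chain2[OF has_field_derivative_powr_right this, of "2 * of_real pi"]
      have p: "((\<lambda>s. (2 * of_real pi) powr (- s)) has_field_derivative
          of_real (ln (2 * pi)) * (2 * of_real pi) powr (- s) * - 1) (at s)"
        unfolding ln by simp
      have c: "((\<lambda>s. cos (of_real pi * s / 2)) has_field_derivative
          - sin (of_real pi * s / 2) * (of_real pi / 2)) (at s)"
        by (rule DERIV_chain2[where f = cos]) (auto intro!: derivative_eq_intros)
      have "(?X has_field_derivative (2 * (of_real (ln (2 * pi)) * (2 * of_real pi) powr (- s) * - 1)) * cos (of_real pi * s / 2) +
          - sin (of_real pi * s / 2) * (of_real pi / 2) * (2 * (2 * of_real pi) powr (- s))) (at s)"
        by (rule DERIV_mult[OF DERIV_cmult[OF p] c])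
      then show ?thesis
      proof (rule DERIV_cong)
        have "sin (of_real pi * s / 2) = T * cos (of_real pi * s / 2)" using cos0 by (simp add: T_def)
        then show "2 * (of_real (ln (2 * pi)) * (2 * of_real pi) powr (- s) * - 1) * cos (of_real pi * s / 2) +
            - sin (of_real pi * s / 2) * (of_real pi / 2) * (2 * (2 * of_real pi) powr (- s)) =
            ?X s * (- of_real (ln (2 * pi)) - of_real (pi / 2) * T)"
          by (simp add: algebra_simps)
      qed
    qed
    have np: "s \<notin> \<int>\<^sub>\<le>\<^sub>0" by (rule Re_pos_not_nonpos_Int) (simp add: s_def)
    have "((\<lambda>s. 1 - s) has_field_derivative - 1) (at s)" by (auto intro!: derivative_eq_intros)
    from DERIV_chain2[OF zeta_has_field_derivative[OF s(4)] this]
    have d1: "((\<lambda>s. zeta (1 - s)) has_field_derivative - deriv zeta (1 - s)) (at s)" by simp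
    have dL: "((\<lambda>s. zeta (1 - s) * rGamma s) has_field_derivative
        - deriv zeta (1 - s) * rGamma s + (- rGamma s * Digamma s) * zeta (1 - s)) (at s)"
      by (rule DERIV_mult[OF d1 has_field_derivative_rGamma_no_nonpos_int[OF np]])
    have dR: "((\<lambda>s. ?X s * zeta s) has_field_derivative
        ?X s * (- of_real (ln (2 * pi)) - of_real (pi / 2) * T) * zeta s + deriv zeta s * ?X s) (at s)"
      by (rule DERIV_mult[OF dX zeta_has_field_derivative[OF s(2)]])
    have "((\<lambda>s. zeta (1 - s) * rGamma s) has_field_derivative
        ?X s * (- of_real (ln (2 * pi)) - of_real (pi / 2) * T) * zeta s + deriv zeta s * ?X s) (at s)"
      by (rule has_field_derivative_transform_within_open[OF dR, of "- {0, 1}"])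
         (use s zeta_functional_equation in \<open>auto intro: finite_imp_closed\<close>)
    from DERIV_unique[OF dL this]
    have eq: "- deriv zeta (1 - s) * rGamma s - zeta (1 - s) * rGamma s * Digamma s =
        ?X s * zeta s * (- of_real (ln (2 * pi)) - of_real (pi / 2) * T) + deriv zeta s * ?X s"
      by (simp add: algebra_simps)
    have fe: "?X s * zeta s = zeta (1 - s) * rGamma s"
      by (rule zeta_functional_equation[symmetric]) (use s in auto)
    have z1: "zeta (1 - s) = cnj (zeta s)" "deriv zeta (1 - s) = cnj (deriv zeta s)"
      unfolding s(3) using s(2) by (simp_all add: zeta_cnj deriv_zeta_cnj)
    have rG: "rGamma s \<noteq> 0" using np by (simp add: rGamma_eq_zero_iff)
    have nzs: "zeta s \<noteq> 0" using nz by (simp add: s_def)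
    define V where "V = zeta (1 - s) * rGamma s"
    have V: "V \<noteq> 0" using rG nzs by (simp add: V_def z1)
    define L where "L = deriv zeta s / zeta s"
    have L1: "deriv zeta (1 - s) * rGamma s = V * cnj L" unfolding V_def L_def z1 using nzs by simp
    have L2: "deriv zeta s * ?X s = V * L" unfolding V_def fe[symmetric] L_def using nzs by simp
    have "V * (- cnj L - Digamma s) = V * (- of_real (ln (2 * pi)) - of_real (pi / 2) * T + L)"
      using eq unfolding L2 fe V_def[symmetric] mult_minus_left L1 by (simp add: algebra_simps)
    then have "- cnj L - Digamma s = - of_real (ln (2 * pi)) - of_real (pi / 2) * T + L" using V by simp
    then have "Re (- cnj L - Digamma s) = Re (- of_real (ln (2 * pi)) - of_real (pi / 2) * T + L)" by (simp only:)
    then have "2 * Re L = ln (2 * pi) + pi / 2 * Re T - Re (Digamma s)" by simp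
    \<comment> \<open>\<open>T\<close> is the tangent of a number with real part
      \<open>pi / 4\<close>, where sine and cosine have equal modulus; hence
      \<open>norm T = 1\<close>.\<close>
    moreover have "Re T \<le> 1"
    proof -
      have "(norm (sin (of_real pi * s / 2)))\<^sup>2 = (norm (cos (of_real pi * s / 2)))\<^sup>2"
        unfolding norm_cos_complex_squared norm_sin_complex_squared by (simp add: s_def sin_45 cos_45)
      then have "norm (sin (of_real pi * s / 2)) = norm (cos (of_real pi * s / 2))"
        by (simp add: power2_eq_iff_nonneg)
      then have "norm T = 1" using cos0 by (simp add: T_def norm_divide)
      then show ?thesis using complex_Re_le_cmod[of T] by simp
    qed
    then have "pi / 2 * Re T \<le> pi / 2 * 1" by (intro mult_left_mono) auto
    moreover have "Re (Digamma s) \<ge> ln t / 2 - C" unfolding s_def by (rule C[OF t])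
    ultimately have "2 * Re L \<le> ln (2 * pi) + pi / 2 * 1 - (ln t / 2 - C)" by linarith
    then show "Re (deriv zeta (Complex (1/2) t) / zeta (Complex (1/2) t)) \<le> (ln (2 * pi) + pi / 2 + C) / 2 - ln t / 4"
      unfolding s_def[symmetric] L_def[symmetric] by (simp add: field_simps)
  qed
qed

section \<open>Gaps and zeros of the derivative\<close>

text \<open>Isolated from zeta: \<open>X\<close> and \<open>\<mu>\<close> may be any finite system
  of points and weights with these bounds. Membership of the endpoint \<open>a\<close> is assumed
  only when it is within 2 of \<open>t\<close>, because the local zeros are listed only near
  \<open>t\<close>; that it is so close is derived on the way.\<close>

lemma left_gap_inequality:
  fixes X :: "real set" and \<mu> :: "real \<Rightarrow> nat"
  assumes fin: "finite X" and \<mu>: "\<And>y. y \<in> X \<Longrightarrow> \<mu> y > 0"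
    and C: "C \<ge> 1" and L: "L \<ge> 20" and \<eta>: "0 < \<eta>" "\<eta> \<le> 1 / (2 * C * L)"
    and t: "a \<le> t" "t \<le> b" "t - a \<le> b - t" "a < b" "b - a \<le> 12"
    and gap: "\<And>y. y \<in> X \<Longrightarrow> y \<le> a \<or> b \<le> y" and aX: "t - a \<le> 2 \<Longrightarrow> a \<in> X"
    and n: "(\<Sum>y\<in>X. real (\<mu> y)) \<le> C * L"
    and re1: "(\<Sum>y\<in>X. real (\<mu> y) * \<eta> / (\<eta>\<^sup>2 + (t - y)\<^sup>2)) \<le> C * L"
    and re2: "(\<Sum>y\<in>X. real (\<mu> y) * \<eta> / (\<eta>\<^sup>2 + (t - y)\<^sup>2)) \<ge> L / 8"
    and im: "(\<Sum>y\<in>X. real (\<mu> y) * (t - y) / (\<eta>\<^sup>2 + (t - y)\<^sup>2)) \<le> C * L"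
  shows "b - a \<le> 144 * C * sqrt (2 * C) * sqrt (\<eta> * L)"
proof -
  define w where "w = (\<lambda>y. real (\<mu> y) / (\<eta>\<^sup>2 + (t - y)\<^sup>2))"
  define d where "d = t - a"
  define \<Delta> where "\<Delta> = b - a"
  define R where "R = {y \<in> X. b \<le> y}"
  define Lf where "Lf = X - R"
  have CL: "C * L > 0" using C L by simp
  have dd: "0 \<le> d" "d \<le> \<Delta>" "0 < \<Delta>" "\<Delta> \<le> 12" "\<Delta> / 2 \<le> b - t" using t by (auto simp: d_def \<Delta>_def)
  have w0: "w y \<ge> 0" for y by (simp add: w_def)
  have finR: "finite R" "R \<subseteq> X" using fin by (auto simp: R_def)
  have split: "sum f X = sum f Lf + sum f R" for f :: "real \<Rightarrow> real"
    unfolding Lf_def using sum.subset_diff[OF finR(2) fin, of f] .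
  have nR: "(\<Sum>y\<in>R. real (\<mu> y)) \<le> C * L"
    using n sum_mono2[OF fin finR(2), of "\<lambda>y. real (\<mu> y)"] by simp
  have R1: "(\<Sum>y\<in>R. w y * (y - t)) \<le> 2 * (C * L) / \<Delta>"
  proof -
    have "(\<Sum>y\<in>R. w y * (y - t)) \<le> (\<Sum>y\<in>R. real (\<mu> y) * (2 / \<Delta>))"
    proof (rule sum_mono)
      fix y assume "y \<in> R"
      then have y: "y - t \<ge> \<Delta> / 2" using dd(5) by (simp add: R_def)
      then have yp: "y - t > 0" using dd by linarith
      have "(y - t) / (\<eta>\<^sup>2 + (t - y)\<^sup>2) \<le> (y - t) / (y - t)\<^sup>2"
        using yp by (intro divide_left_mono mult_pos_pos add_nonneg_pos) (auto simp: power2_commute)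
      also have "\<dots> = 1 / (y - t)" using yp by (simp add: power2_eq_square)
      also have "\<dots> \<le> 1 / (\<Delta> / 2)" using y dd by (intro divide_left_mono) auto
      finally have "(y - t) / (\<eta>\<^sup>2 + (t - y)\<^sup>2) \<le> 2 / \<Delta>" by simp
      from mult_left_mono[OF this, of "real (\<mu> y)"] show "w y * (y - t) \<le> real (\<mu> y) * (2 / \<Delta>)"
        by (simp add: w_def)
    qed
    also have "\<dots> = (\<Sum>y\<in>R. real (\<mu> y)) * (2 / \<Delta>)" by (rule sum_distrib_right[symmetric])
    also have "\<dots> \<le> C * L * (2 / \<Delta>)" using nR dd by (intro mult_right_mono) auto
    finally show ?thesis by (simp add: mult_ac)
  qed
  have R2: "(\<Sum>y\<in>R. w y) \<le> 4 * (C * L) / \<Delta>\<^sup>2"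
  proof -
    have "(\<Sum>y\<in>R. w y) \<le> (\<Sum>y\<in>R. real (\<mu> y) * (4 / \<Delta>\<^sup>2))"
    proof (rule sum_mono)
      fix y assume "y \<in> R"
      then have y: "y - t \<ge> \<Delta> / 2" using dd(5) by (simp add: R_def)
      then have "(\<Delta> / 2)\<^sup>2 \<le> (y - t)\<^sup>2" using dd by (intro power_mono) auto
      also have "\<dots> \<le> \<eta>\<^sup>2 + (t - y)\<^sup>2" by (simp add: power2_commute)
      finally have "1 / (\<eta>\<^sup>2 + (t - y)\<^sup>2) \<le> 1 / (\<Delta> / 2)\<^sup>2"
        using dd \<eta> by (intro divide_left_mono mult_pos_pos add_pos_nonneg) auto
      from mult_left_mono[OF this, of "real (\<mu> y)"] show "w y \<le> real (\<mu> y) * (4 / \<Delta>\<^sup>2)"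
        by (simp add: w_def power_divide)
    qed
    also have "\<dots> = (\<Sum>y\<in>R. real (\<mu> y)) * (4 / \<Delta>\<^sup>2)" by (rule sum_distrib_right[symmetric])
    also have "\<dots> \<le> C * L * (4 / \<Delta>\<^sup>2)" using nR dd by (intro mult_right_mono) auto
    finally show ?thesis by (simp add: mult_ac)
  qed
  have "(\<Sum>y\<in>X. w y * (t - y)) \<le> C * L" using im by (simp add: w_def)
  moreover have "(\<Sum>y\<in>X. w y * (t - y)) = (\<Sum>y\<in>Lf. w y * (t - y)) - (\<Sum>y\<in>R. w y * (y - t))"
    unfolding split sum_negf[symmetric] diff_conv_add_uminus[of "sum _ Lf"]
    by (intro arg_cong2[where f = "(+)"] sum.cong refl) (simp add: algebra_simps)
  ultimately have "(\<Sum>y\<in>Lf. w y * (t - y)) \<le> C * L + 2 * (C * L) / \<Delta>" using R1 by linarith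
  \<comment> \<open>The bounded length of the gap lets the plain bound \<open>C * L\<close> be
    absorbed into one of order \<open>C * L / \<Delta>\<close>.\<close>
  moreover have "C * L \<le> 12 * (C * L) / \<Delta>"
  proof -
    have "C * L * \<Delta> \<le> C * L * 12" using dd CL by (intro mult_left_mono) auto
    then show ?thesis using dd by (simp add: pos_le_divide_eq mult_ac)
  qed
  moreover have "12 * (C * L) / \<Delta> + 2 * (C * L) / \<Delta> = 14 * (C * L) / \<Delta>"
    by (simp add: add_divide_distrib[symmetric])
  ultimately have L1: "(\<Sum>y\<in>Lf. w y * (t - y)) \<le> 14 * (C * L) / \<Delta>" by linarith
  have L2: "d * (\<Sum>y\<in>Lf. w y) \<le> (\<Sum>y\<in>Lf. w y * (t - y))"
    unfolding sum_distrib_left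
  proof (rule sum_mono)
    fix y assume "y \<in> Lf"
    then have "d \<le> t - y" using gap[of y] by (auto simp: Lf_def R_def d_def)
    then show "d * w y \<le> w y * (t - y)" using w0[of y] by (subst mult.commute) (rule mult_left_mono)
  qed
  have re3: "L / (8 * \<eta>) \<le> (\<Sum>y\<in>X. w y)"
  proof -
    have "L / 8 \<le> (\<Sum>y\<in>X. w y) * \<eta>" using re2 by (simp add: w_def sum_distrib_right)
    then show ?thesis using \<eta> by (simp add: field_simps)
  qed
  have "d * (L / (8 * \<eta>)) \<le> d * (\<Sum>y\<in>X. w y)" using re3 dd by (intro mult_left_mono)
  also have "\<dots> = d * (\<Sum>y\<in>Lf. w y) + d * (\<Sum>y\<in>R. w y)" unfolding split by (rule distrib_left)
  also have "\<dots> \<le> 14 * (C * L) / \<Delta> + \<Delta> * (4 * (C * L) / \<Delta>\<^sup>2)"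
    using L1 L2 R2 dd w0 by (intro add_mono mult_mono) (auto intro: sum_nonneg)
  also have "\<Delta> * (4 * (C * L) / \<Delta>\<^sup>2) = 4 * (C * L) / \<Delta>" using dd by (simp add: power2_eq_square)
  finally have "d * (L / (8 * \<eta>)) \<le> 18 * (C * L) / \<Delta>" by (simp add: add_divide_distrib[symmetric])
  then have "d * (L / (8 * \<eta>)) * (8 * \<eta> * \<Delta> / L) \<le> 18 * (C * L) / \<Delta> * (8 * \<eta> * \<Delta> / L)"
    using \<eta> dd L by (intro mult_right_mono) auto
  \<comment> \<open>144 is 8 times 18, and 18 = 12 + 2 + 4: 12 from absorbing \<open>C * L\<close>,
    2 from \<open>R1\<close>, 4 from \<open>R2\<close>.\<close>
  then have d\<Delta>: "d * \<Delta> \<le> 144 * C * \<eta>" using \<eta> dd L by (simp add: mult_ac)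
  have "2 * C * L * \<eta> \<le> 1" using \<eta> CL by (simp add: field_simps)
  then have C\<eta>: "C * L * \<eta> \<le> 1 / 2" by simp
  have "d\<^sup>2 \<le> 4"
  proof -
    have "d\<^sup>2 \<le> d * \<Delta>" using dd by (simp add: power2_eq_square mult_left_mono)
    \<comment> \<open>\<open>L \<ge> 20\<close> enters here: together with
      \<open>C * L * \<eta> \<le> 1 / 2\<close> it makes \<open>144 * C * \<eta>\<close> at most
      3.6, hence \<open>d \<le> 2\<close>.\<close>
    moreover have "20 * (C * \<eta>) \<le> L * (C * \<eta>)" using L C \<eta> by (intro mult_right_mono) auto
    ultimately show ?thesis using d\<Delta> C\<eta> by (simp add: mult_ac)
  qed
  then have "d\<^sup>2 \<le> 2\<^sup>2" by simp
  then have "d \<le> 2" by (rule power2_le_imp_le) simp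
  then have a: "a \<in> X" using aX by (simp add: d_def)
  have "1 * \<eta> / (\<eta>\<^sup>2 + d\<^sup>2) \<le> real (\<mu> a) * \<eta> / (\<eta>\<^sup>2 + (t - a)\<^sup>2)"
    unfolding d_def using \<mu>[OF a] \<eta> by (intro divide_right_mono mult_right_mono) auto
  also have "\<dots> \<le> (\<Sum>y\<in>X. real (\<mu> y) * \<eta> / (\<eta>\<^sup>2 + (t - y)\<^sup>2))"
    using \<eta> by (intro member_le_sum a fin) auto
  finally have "\<eta> / (\<eta>\<^sup>2 + d\<^sup>2) \<le> C * L" using re1 by simp
  moreover have "\<eta>\<^sup>2 + d\<^sup>2 > 0" using \<eta> by (simp add: add_pos_nonneg)
  ultimately have "\<eta> \<le> C * L * (\<eta>\<^sup>2 + d\<^sup>2)" by (simp add: field_simps)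
  \<comment> \<open>The part coming from \<open>\<eta>\<close> itself is at most
    \<open>\<eta> / 2\<close> and is absorbed, so the endpoint cannot be too close to
    \<open>t\<close>.\<close>
  also have "\<dots> = (C * L * \<eta>) * \<eta> + C * L * d\<^sup>2" by (simp add: power2_eq_square algebra_simps)
  also have "\<dots> \<le> 1 / 2 * \<eta> + C * L * d\<^sup>2" using C\<eta> \<eta> by (intro add_right_mono mult_right_mono) auto
  finally have dlow: "\<eta> \<le> 2 * (C * L) * d\<^sup>2" by simp
  have "\<Delta>\<^sup>2 * \<eta> \<le> \<Delta>\<^sup>2 * (2 * (C * L) * d\<^sup>2)" using dlow by (intro mult_left_mono) auto
  also have "\<dots> = 2 * (C * L) * (d * \<Delta>)\<^sup>2" by (simp add: power_mult_distrib)
  also have "\<dots> \<le> 2 * (C * L) * (144 * C * \<eta>)\<^sup>2"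
    using d\<Delta> dd CL by (intro mult_left_mono power_mono) auto
  also have "\<dots> = ((144 * C)\<^sup>2 * (2 * C) * (\<eta> * L)) * \<eta>" by (simp add: power2_eq_square)
  finally have "\<Delta>\<^sup>2 \<le> (144 * C)\<^sup>2 * (2 * C) * (\<eta> * L)" using \<eta>(1) by (rule mult_right_le_imp_le)
  also have "\<dots> = (144 * C * sqrt (2 * C) * sqrt (\<eta> * L))\<^sup>2"
    using C \<eta> L by (simp add: power_mult_distrib)
  finally show ?thesis unfolding \<Delta>_def
    by (rule power2_le_imp_le) (use C \<eta> L in auto)
qed

text \<open>The reflection y to -y exchanges the endpoints and changes the sign of the last sum,
  which is why that sum is bounded here in absolute value.\<close>

lemma gap_inequality:
  fixes X :: "real set" and \<mu> :: "real \<Rightarrow> nat"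
  assumes fin: "finite X" and \<mu>: "\<And>y. y \<in> X \<Longrightarrow> \<mu> y > 0"
    and C: "C \<ge> 1" and L: "L \<ge> 20" and \<eta>: "0 < \<eta>" "\<eta> \<le> 1 / (2 * C * L)"
    and t: "a \<le> t" "t \<le> b" "a < b" "b - a \<le> 12"
    and gap: "\<And>y. y \<in> X \<Longrightarrow> y \<le> a \<or> b \<le> y"
    and aX: "t - a \<le> 2 \<Longrightarrow> a \<in> X" and bX: "b - t \<le> 2 \<Longrightarrow> b \<in> X"
    and n: "(\<Sum>y\<in>X. real (\<mu> y)) \<le> C * L"
    and re1: "(\<Sum>y\<in>X. real (\<mu> y) * \<eta> / (\<eta>\<^sup>2 + (t - y)\<^sup>2)) \<le> C * L"
    and re2: "(\<Sum>y\<in>X. real (\<mu> y) * \<eta> / (\<eta>\<^sup>2 + (t - y)\<^sup>2)) \<ge> L / 8"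
    and im: "\<bar>\<Sum>y\<in>X. real (\<mu> y) * (t - y) / (\<eta>\<^sup>2 + (t - y)\<^sup>2)\<bar> \<le> C * L"
  shows "b - a \<le> 144 * C * sqrt (2 * C) * sqrt (\<eta> * L)"
proof (cases "t - a \<le> b - t")
  case True
  show ?thesis
    by (rule left_gap_inequality[where X = X and \<mu> = \<mu> and t = t])
       (use assms True in \<open>auto simp: abs_le_iff\<close>)
next
  case False
  have refl: "(\<Sum>y\<in>uminus ` X. f y) = (\<Sum>y\<in>X. f (- y))" for f :: "real \<Rightarrow> real"
    by (subst sum.reindex) auto
  have sq: "(- t - - y)\<^sup>2 = (t - y)\<^sup>2" for y by (simp add: power2_commute)
  have "(- a) - (- b) \<le> 144 * C * sqrt (2 * C) * sqrt (\<eta> * L)"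
  proof (rule left_gap_inequality[where X = "uminus ` X" and \<mu> = "\<lambda>y. \<mu> (- y)" and t = "- t"])
    fix y assume "y \<in> uminus ` X"
    then have "- y \<in> X" by auto
    from gap[OF this] show "y \<le> - b \<or> - a \<le> y" by linarith
  next
    show "- t - - b \<le> 2 \<Longrightarrow> - b \<in> uminus ` X" using bX by auto
    show "(\<Sum>y\<in>uminus ` X. real (\<mu> (- y)) * \<eta> / (\<eta>\<^sup>2 + (- t - y)\<^sup>2)) \<le> C * L"
      "(\<Sum>y\<in>uminus ` X. real (\<mu> (- y)) * \<eta> / (\<eta>\<^sup>2 + (- t - y)\<^sup>2)) \<ge> L / 8"
      unfolding refl sq using re1 re2 by simp_all
    have "(\<Sum>y\<in>X. real (\<mu> y) * (- t - - y) / (\<eta>\<^sup>2 + (t - y)\<^sup>2)) =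
        - (\<Sum>y\<in>X. real (\<mu> y) * (t - y) / (\<eta>\<^sup>2 + (t - y)\<^sup>2))"
    proof -
      have e: "- t - - y = - (t - y)" for y by simp
      show ?thesis unfolding sum_negf[symmetric] e by (simp only: mult_minus_right minus_divide_left)
    qed
    then show "(\<Sum>y\<in>uminus ` X. real (\<mu> (- y)) * (- t - y) / (\<eta>\<^sup>2 + (- t - y)\<^sup>2)) \<le> C * L"
      unfolding refl sq using im by simp
  qed (use assms False in \<open>auto simp: refl\<close>)
  then show ?thesis by simp
qed

section \<open>Ordinates as a discrete set\<close>

lemma finite_ordinates: "finite {y \<in> {a..b}. zeta (Complex (1/2) y) = 0}"
proof (cases "\<exists>y. zeta (Complex (1/2) y) = 0")
  case False
  then show ?thesis by simp
next
  case True
  then obtain y0 where y0: "zeta (Complex (1/2) y0) = 0" by blast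
  have "\<not> zeta constant_on (- {1})"
  proof
    assume "zeta constant_on (- {1})"
    then obtain k where k: "\<And>s. s \<noteq> 1 \<Longrightarrow> zeta s = k" by (auto simp: constant_on_def)
    have "k = 0" using k[of "Complex (1/2) y0"] y0 by (simp add: complex_eq_iff)
    moreover have "zeta 2 = k" by (rule k) simp
    ultimately show False using zeta_nonzero[of 2] by simp
  qed
  moreover have "compact (Complex (1/2) ` {a..b})"
    by (intro compact_continuous_image) (auto intro!: continuous_intros simp: Complex_eq)
  moreover have "Complex (1/2) ` {a..b} \<subseteq> - {1}" by (auto simp: complex_eq_iff)
  ultimately have "finite {s \<in> Complex (1/2) ` {a..b}. zeta s = 0}"
    by (intro holomorphic_compact_finite_zeros[where S = "- {1}"] zeta_holomorphic)
       (auto intro!: connected_punctured_universe)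
  then have "finite (Im ` {s \<in> Complex (1/2) ` {a..b}. zeta s = 0})" by (rule finite_imageI)
  moreover have "{y \<in> {a..b}. zeta (Complex (1/2) y) = 0} \<subseteq> Im ` {s \<in> Complex (1/2) ` {a..b}. zeta s = 0}"
  proof
    fix y assume "y \<in> {y \<in> {a..b}. zeta (Complex (1/2) y) = 0}"
    then show "y \<in> Im ` {s \<in> Complex (1/2) ` {a..b}. zeta s = 0}"
      by (intro rev_image_eqI[of "Complex (1/2) y"]) auto
  qed
  ultimately show ?thesis by (rule rev_finite_subset)
qed

text \<open>\<open>LEAST\<close> on the reals is meaningful only if the minimum is attained. Given
  some ordinate above \<open>\<gamma>\<close>, finiteness in a bounded interval provides it.\<close>

lemma next_ordinate:
  assumes "y > \<gamma>" "zeta (Complex (1/2) y) = 0"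
  shows "next_ordinate \<gamma> > \<gamma>" "zeta (Complex (1/2) (next_ordinate \<gamma>)) = 0"
    "\<And>t. t > \<gamma> \<Longrightarrow> zeta (Complex (1/2) t) = 0 \<Longrightarrow> next_ordinate \<gamma> \<le> t"
proof -
  define S where "S = {t \<in> {\<gamma>..y}. zeta (Complex (1/2) t) = 0} - {\<gamma>}"
  have fin: "finite S" unfolding S_def by (intro finite_Diff finite_ordinates)
  have "y \<in> S" using assms by (auto simp: S_def)
  then have ne: "S \<noteq> {}" by blast
  have "next_ordinate \<gamma> = Min S"
    unfolding next_ordinate_def
  proof (rule Least_equality)
    show "\<gamma> < Min S \<and> zeta (Complex (1/2) (Min S)) = 0"
      using Min_in[OF fin ne] by (auto simp: S_def)
    fix t assume t: "\<gamma> < t \<and> zeta (Complex (1/2) t) = 0"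
    show "Min S \<le> t"
    proof (cases "t \<le> y")
      case True
      with t show ?thesis by (intro Min_le fin) (auto simp: S_def)
    next
      case False
      moreover have "Min S \<le> y" using assms by (intro Min_le fin) (auto simp: S_def)
      ultimately show ?thesis by simp
    qed
  qed
  then have eq: "next_ordinate \<gamma> = Min S" .
  show "next_ordinate \<gamma> > \<gamma>" "zeta (Complex (1/2) (next_ordinate \<gamma>)) = 0"
    unfolding eq using Min_in[OF fin ne] by (auto simp: S_def)
  fix t assume t: "t > \<gamma>" "zeta (Complex (1/2) t) = 0"
  then have "\<not> t < Min S"
    using Min_le[OF fin, of t] assms Min_in[OF fin ne] by (cases "t \<le> y") (auto simp: S_def)
  then show "next_ordinate \<gamma> \<le> t" unfolding eq by simp
qed

text \<open>\<open>\<mu> y\<close> is the multiplicity of the zero \<open>1/2 + i y\<close>. The sums over \<open>y\<close> are the real and imaginary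
  parts of the contribution of these zeros to \<open>zeta' / zeta\<close> at \<open>1/2 + \<eta> + i t\<close>.\<close>

definition local_zeros :: "real \<Rightarrow> real \<Rightarrow> real \<Rightarrow> real set \<Rightarrow> (real \<Rightarrow> nat) \<Rightarrow> bool" where
  "local_zeros C t \<eta> X \<mu> \<longleftrightarrow> finite X \<and> (\<forall>y\<in>X. zeta (Complex (1/2) y) = 0 \<and> \<mu> y > 0) \<and>
        (\<forall>y. \<bar>y - t\<bar> \<le> 2 \<and> zeta (Complex (1/2) y) = 0 \<longrightarrow> y \<in> X) \<and>
        (\<Sum>y\<in>X. real (\<mu> y)) \<le> C * ln t \<and>
        (\<Sum>y\<in>X. real (\<mu> y) * \<eta> / (\<eta>\<^sup>2 + (t - y)\<^sup>2)) \<le> C * ln t \<and>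
        (\<Sum>y\<in>X. real (\<mu> y) * \<eta> / (\<eta>\<^sup>2 + (t - y)\<^sup>2)) \<ge> ln t / 8 \<and>
        \<bar>\<Sum>y\<in>X. real (\<mu> y) * (t - y) / (\<eta>\<^sup>2 + (t - y)\<^sup>2)\<bar> \<le> C * ln t"

text \<open>Landau's lemma on the disc of radius 8 around 2 + it. Since the derivative vanishes at
  \<open>s1\<close>, the two sums over zeros equal \<open>- Re (E s1)\<close> and
  \<open>Im (E s1)\<close>, so the clauses become bounds on \<open>E\<close>; the lower bound is
  transported from \<open>s0\<close> on the critical line.\<close>

lemma zeta_local:
  assumes RH: riemann_hypothesis
  obtains C T0 where "C \<ge> 1"
    "\<And>t \<eta>. t \<ge> T0 \<Longrightarrow> 0 < \<eta> \<Longrightarrow> \<eta> \<le> 1 / (2 * C * ln t) \<Longrightarrow> deriv zeta (Complex (1/2 + \<eta>) t) = 0 \<Longrightarrow>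
      \<exists>X \<mu>. local_zeros C t \<eta> X \<mu>"
proof -
  obtain Q where Q: "Q \<ge> 1" "\<And>s. Re s \<ge> 3/2 \<Longrightarrow> norm (zeta s) \<ge> 1 / Q"
    using zeta_bounds_right by metis
  obtain N T1 where N: "T1 \<ge> 20"
    "\<And>T s. T \<ge> T1 \<Longrightarrow> Re s \<ge> - 6 \<Longrightarrow> Im s \<ge> 1 \<Longrightarrow> norm s \<le> T + 12 \<Longrightarrow> norm (zeta s) \<le> T ^ N"
    using zeta_growth by metis
  obtain D where D: "\<And>t. t \<ge> 1 \<Longrightarrow> zeta (Complex (1/2) t) \<noteq> 0 \<Longrightarrow>
    Re (deriv zeta (Complex (1/2) t) / zeta (Complex (1/2) t)) \<le> D - ln t / 4"
    using Re_logderiv_zeta_critical_line by metis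
  define B where "B = real N + ln Q + 1"
  have B: "B \<ge> 1" using Q by (simp add: B_def)
  \<comment> \<open>84 is 672 / 8, the constant of \<open>Landau_zeros\<close> at radius 8.\<close>
  define C where "C = 84 * B"
  have C: "C \<ge> 84" using B by (simp add: C_def)
  \<comment> \<open>The margin turns \<open>L / 4 - D - 2\<close> into at least
    \<open>L / 8\<close>; the 2 bounds the change of \<open>E\<close> between \<open>s0\<close> and
    \<open>s1\<close>.\<close>
  have "eventually (\<lambda>t. ln t > max 1 (8 * (D + 2))) at_top"
    using ln_at_top unfolding filterlim_at_top_dense by blast
  then obtain T2 where T2: "\<And>t. t \<ge> T2 \<Longrightarrow> ln t > 1 \<and> ln t > 8 * (D + 2)"
    by (auto simp: eventually_at_top_linorder)
  show thesis
  proof (rule that[of C "max T1 T2"])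
    show "C \<ge> 1" using C by simp
    fix t \<eta> assume t: "t \<ge> max T1 T2" and \<eta>: "0 < \<eta>" "\<eta> \<le> 1 / (2 * C * ln t)"
      and d0: "deriv zeta (Complex (1/2 + \<eta>) t) = 0"
    define L where "L = ln t"
    have t20: "t \<ge> 20" using t N by auto
    have L: "L > 1" "L > 8 * (D + 2)" using T2[of t] t by (auto simp: L_def)
    have CL: "C * L > 84"
    proof -
      have "C * 1 < C * L" using C L by (intro mult_strict_left_mono) auto
      then show ?thesis using C by linarith
    qed
    have \<eta>2: "2 * C * L * \<eta> \<le> 1" using \<eta> CL by (simp add: L_def[symmetric] field_simps)
    have \<eta>4: "\<eta> \<le> 1/4"
    proof -
      have "2 * 84 * \<eta> \<le> 2 * (C * L) * \<eta>" using CL \<eta> by (intro mult_right_mono) auto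
      then show ?thesis using \<eta>2 by (simp add: mult_ac)
    qed
    define M where "M = real N * L + ln Q + 1"
    have M: "M > 0" "M \<le> B * L"
    proof -
      have "ln Q \<ge> 0" using Q by simp
      then show "M > 0" using L by (simp add: M_def add_nonneg_pos)
      have "(ln Q + 1) * 1 \<le> (ln Q + 1) * L" using \<open>ln Q \<ge> 0\<close> L by (intro mult_left_mono) auto
      then show "M \<le> B * L" by (simp add: M_def B_def algebra_simps)
    qed
    define c where "c = Complex 2 t"
    have coord: "\<bar>Re s - 2\<bar> \<le> r" "\<bar>Im s - t\<bar> \<le> r" if "norm (s - c) \<le> r" for s r
      using that abs_Re_le_cmod[of "s - c"] abs_Im_le_cmod[of "s - c"] by (auto simp: c_def)
    have hol: "zeta holomorphic_on ball c 9"
    proof (rule zeta_holomorphic)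
      have "\<bar>Im 1 - t\<bar> > 9" using t20 by simp
      then show "1 \<notin> ball c 9" using coord(2)[of 1 9] by (auto simp: dist_norm norm_minus_commute)
    qed
    have c0: "norm (zeta c) \<ge> 1 / Q" by (rule Q) (simp add: c_def)
    then have cpos: "norm (zeta c) > 0" using Q(1) by (meson divide_pos_pos less_le_trans zero_less_one)
    have bound: "\<forall>z\<in>cball c 8. norm (zeta z) \<le> exp M * norm (zeta c)"
    proof
      fix z assume z: "z \<in> cball c 8"
      have zc: "norm (z - c) \<le> 8" using z by (simp add: dist_norm norm_minus_commute)
      have "norm z \<le> norm (z - c) + norm c" using norm_triangle_ineq[of "z - c" c] by simp
      also have "norm c \<le> 2 + t" using cmod_le[of c] t20 by (simp add: c_def)
      finally have "norm z \<le> t + 12" using zc by simp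
      moreover have "Re z \<ge> - 6" using coord(1)[OF zc] by linarith
      moreover have "Im z \<ge> 1" using coord(2)[OF zc] t20 by linarith
      ultimately have "norm (zeta z) \<le> t ^ N" using t by (intro N) auto
      also have "t ^ N = exp (real N * L)" using t20 by (simp add: L_def exp_of_nat_mult)
      also have "\<dots> \<le> exp (M - ln Q)" by (simp add: M_def)
      also have "\<dots> = exp M * (1 / Q)" using Q(1) by (simp add: exp_diff)
      also have "\<dots> \<le> exp M * norm (zeta c)" using c0 by (intro mult_left_mono) auto
      finally show "norm (zeta z) \<le> exp M * norm (zeta c)" .
    qed
    define Z where "Z = {z \<in> cball c (8 / 3). zeta z = 0}"
    have R: "(0::real) < 8" "(8::real) < 9" "zeta c \<noteq> 0" using cpos by auto
    from Landau_zeros[OF hol R M(1) bound, folded Z_def]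
    obtain m E where mE: "finite Z" "\<forall>a\<in>Z. m a > (0::nat)" "real (\<Sum>a\<in>Z. m a) * ln 2 \<le> M"
      "E holomorphic_on ball c (8 / 3)"
      "\<forall>z\<in>ball c (8 / 3). zeta z \<noteq> 0 \<longrightarrow> deriv zeta z / zeta z = (\<Sum>a\<in>Z. of_nat (m a) / (z - a)) + E z"
      "\<forall>z\<in>cball c (8 / 4). norm (E z) \<le> 672 * M / 8"
      by (elim exE conjE)
    have Ebound: "norm (E z) \<le> 84 * M" if "norm (z - c) \<le> 2" for z
      using mE(6) that by (auto simp: dist_norm norm_minus_commute)
    define X where "X = Im ` Z"
    define \<mu> where "\<mu> = (\<lambda>y. m (Complex (1/2) y))"
    have ReZ: "a = Complex (1/2) (Im a)" if "a \<in> Z" for a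
    proof -
      have "norm (a - c) \<le> 8 / 3" "zeta a = 0" using that by (auto simp: Z_def dist_norm norm_minus_commute)
      moreover from this have "Im a \<noteq> 0" using coord(2)[of a "8/3"] t20 by auto
      ultimately have "Re a = 1/2" using zeta_zero_strip RH unfolding riemann_hypothesis_def by blast
      then show ?thesis by (simp add: complex_eq_iff)
    qed
    have inj: "inj_on Im Z" using ReZ by (intro inj_onI) metis
    have sumX: "(\<Sum>y\<in>X. F (Complex (1/2) y)) = (\<Sum>a\<in>Z. F a)" for F :: "complex \<Rightarrow> 'b :: comm_monoid_add"
      unfolding X_def by (subst sum.reindex[OF inj]) (auto intro!: sum.cong arg_cong[where f = F] simp: ReZ[symmetric])
    define s1 where "s1 = Complex (1/2 + \<eta>) t"
    define s0 where "s0 = Complex (1/2) t"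
    have s0c: "norm (s0 - c) = 3/2" by (simp add: s0_def c_def cmod_def)
    have s10: "norm (s1 - s0) = \<eta>" using \<eta> by (simp add: s0_def s1_def cmod_def)
    have s1c: "norm (s1 - c) \<le> 2" using norm_triangle_ineq[of "s1 - s0" "s0 - c"] s0c s10 \<eta>4 by simp
    have z1: "zeta s1 \<noteq> 0"
    proof
      assume z: "zeta s1 = 0"
      have "Im s1 \<noteq> 0" using t20 by (simp add: s1_def)
      then have "Re s1 = 1/2" using zeta_zero_strip[OF z] RH z unfolding riemann_hypothesis_def by blast
      then show False using \<eta> by (simp add: s1_def)
    qed
    have "s1 \<in> ball c (8 / 3)" using s1c by (simp add: dist_norm norm_minus_commute)
    then have "(\<Sum>a\<in>Z. of_nat (m a) / (s1 - a)) + E s1 = 0"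
      using mE(5) z1 d0 by (metis div_0 s1_def)
    then have E1: "(\<Sum>y\<in>X. of_nat (\<mu> y) / (s1 - Complex (1/2) y)) = - E s1"
      unfolding \<mu>_def sumX[of "\<lambda>a. of_nat (m a) / (s1 - a)"] by (simp add: eq_neg_iff_add_eq_0)
    have quot: "of_nat (\<mu> y) / (s1 - Complex (1/2) y) =
        Complex (real (\<mu> y) * \<eta> / (\<eta>\<^sup>2 + (t - y)\<^sup>2)) (- (real (\<mu> y) * (t - y) / (\<eta>\<^sup>2 + (t - y)\<^sup>2)))" for y
      by (simp add: s1_def complex_eq_iff Re_divide Im_divide)
    have re: "(\<Sum>y\<in>X. real (\<mu> y) * \<eta> / (\<eta>\<^sup>2 + (t - y)\<^sup>2)) = - Re (E s1)"
      using arg_cong[OF E1, of Re] unfolding quot by simp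
    have im: "(\<Sum>y\<in>X. real (\<mu> y) * (t - y) / (\<eta>\<^sup>2 + (t - y)\<^sup>2)) = Im (E s1)"
      using arg_cong[OF E1, of Im] unfolding quot by (simp add: sum_negf)
    have ME: "84 * M \<le> C * L" using M(2) by (simp add: C_def)
    then have E1b: "norm (E s1) \<le> C * L" using Ebound[OF s1c] by simp
    have finX: "finite X" unfolding X_def using mE(1) by simp
    have \<mu>0: "\<mu> y > 0" if "y \<in> X" for y
      using that mE(2) ReZ unfolding X_def \<mu>_def by fastforce
    have Xz: "zeta (Complex (1/2) y) = 0" if "y \<in> X" for y
      using that ReZ unfolding X_def Z_def by fastforce
    \<comment> \<open>The disc of radius 8/3 around 2 + it contains these zeros because 9/4 + 4 is
      less than 64/9.\<close>
    have near: "y \<in> X" if y: "\<bar>y - t\<bar> \<le> 2" "zeta (Complex (1/2) y) = 0" for y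
    proof -
      have "(norm (Complex (1/2) y - c))\<^sup>2 = 9/4 + \<bar>y - t\<bar>\<^sup>2" unfolding cmod_power2 by (simp add: c_def power_divide)
      also have "\<bar>y - t\<bar>\<^sup>2 \<le> 2\<^sup>2" using y by (intro power_mono) auto
      also have "9/4 + 2\<^sup>2 \<le> ((8 / 3)\<^sup>2 :: real)" by (simp add: power2_eq_square)
      finally have le: "(norm (Complex (1/2) y - c))\<^sup>2 \<le> (8 / 3)\<^sup>2" by simp
      have "norm (Complex (1/2) y - c) \<le> 8 / 3" by (rule power2_le_imp_le[OF le]) (simp only: divide_nonneg_nonneg zero_le_numeral)
      then have "Complex (1/2) y \<in> Z" using y by (simp add: Z_def dist_norm norm_minus_commute)
      then show ?thesis unfolding X_def by (rule rev_image_eqI) simp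
    qed
    have count: "(\<Sum>y\<in>X. real (\<mu> y)) \<le> C * L"
    proof -
      have e: "(\<Sum>y\<in>X. real (\<mu> y)) = real (\<Sum>a\<in>Z. m a)"
        unfolding \<mu>_def sumX[of "\<lambda>a. real (m a)"] by simp
      have "real (\<Sum>a\<in>Z. m a) * (2 / 3) \<le> real (\<Sum>a\<in>Z. m a) * ln 2"
        by (rule mult_left_mono[OF ln2_ge_two_thirds of_nat_0_le_iff])
      also have "\<dots> \<le> M" by (rule mE(3))
      finally show ?thesis unfolding e using ME M(1) by linarith
    qed
    \<comment> \<open>A zero at height exactly \<open>t\<close> would contribute at least
      \<open>1 / \<eta>\<close>, which is at least \<open>2 * C * L\<close> and so exceeds the bound
      for the whole sum. Hence the critical-line estimate applies at \<open>s0\<close>.\<close>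
    have z0: "zeta s0 \<noteq> 0"
    proof
      assume "zeta s0 = 0"
      then have tX: "t \<in> X" by (intro near) (auto simp: s0_def)
      have "1 / \<eta> = 1 * \<eta> / (\<eta>\<^sup>2 + (t - t)\<^sup>2)" using \<eta> by (simp add: power2_eq_square)
      also have "\<dots> \<le> real (\<mu> t) * \<eta> / (\<eta>\<^sup>2 + (t - t)\<^sup>2)"
        using \<mu>0[OF tX] \<eta> by (intro divide_right_mono mult_right_mono) auto
      also have "\<dots> \<le> (\<Sum>y\<in>X. real (\<mu> y) * \<eta> / (\<eta>\<^sup>2 + (t - y)\<^sup>2))"
        using \<eta> by (intro member_le_sum tX finX) auto
      also have "\<dots> \<le> C * L" unfolding re using E1b abs_Re_le_cmod[of "E s1"] by linarith
      finally have "1 \<le> C * L * \<eta>" using \<eta> by (simp add: field_simps)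
      with \<eta>2 show False by simp
    qed
    have "s0 \<in> ball c (8 / 3)" using s0c by (simp add: dist_norm norm_minus_commute)
    then have "deriv zeta s0 / zeta s0 = (\<Sum>a\<in>Z. of_nat (m a) / (s0 - a)) + E s0"
      using mE(5) z0 by blast
    also have "(\<Sum>a\<in>Z. of_nat (m a) / (s0 - a)) = (\<Sum>y\<in>X. of_nat (\<mu> y) / (s0 - Complex (1/2) y))"
      unfolding \<mu>_def sumX[of "\<lambda>a. of_nat (m a) / (s0 - a)"] ..
    finally have "Re (deriv zeta s0 / zeta s0) =
        (\<Sum>y\<in>X. Re (of_nat (\<mu> y) / (s0 - Complex (1/2) y))) + Re (E s0)" by simp
    \<comment> \<open>\<open>s0\<close> lies on the same vertical line as the zeros, so each term is
      purely imaginary.\<close>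
    also have "(\<Sum>y\<in>X. Re (of_nat (\<mu> y) / (s0 - Complex (1/2) y))) = 0"
      by (intro sum.neutral ballI) (simp add: s0_def Re_divide)
    finally have ReE0: "Re (E s0) \<le> D - L / 4"
      using D[of t] z0 t20 by (simp add: s0_def L_def)
    \<comment> \<open>As 3/2 + 1/4 + 1/4 = 2, every point within 1/4 of \<open>s0\<close> has a disc
      of radius 1/4 on which \<open>Ebound\<close> holds; Cauchy's inequality multiplies 84 by
      4.\<close>
    have diff: "norm (E s1 - E s0) \<le> 336 * M * norm (s1 - s0)"
    proof (rule field_differentiable_bound[where S = "cball s0 (1/4)" and f' = "deriv E"])
      fix z assume z: "z \<in> cball s0 (1/4)"
      have zc: "norm (w - c) \<le> 2" if "w \<in> cball z (1/4)" for w
      proof -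
        have "dist w c \<le> dist w z + dist z s0 + dist s0 c"
          using dist_triangle[of w c z] dist_triangle[of z c s0] by simp
        moreover have "dist w z \<le> 1/4" "dist z s0 \<le> 1/4" using that z by (simp_all add: dist_commute)
        ultimately show ?thesis using s0c by (simp add: dist_norm)
      qed
      have sub: "cball z (1/4) \<subseteq> ball c (8 / 3)"
        using zc by (force simp: dist_norm norm_minus_commute)
      have "z \<in> ball c (8 / 3)" by (rule subsetD[OF sub]) simp
      then have "(E has_field_derivative deriv E z) (at z)"
        by (intro holomorphic_derivI[OF mE(4)]) auto
      then show "(E has_field_derivative deriv E z) (at z within cball s0 (1/4))"
        by (rule has_field_derivative_at_within)
      have "norm ((deriv ^^ 1) E z) \<le> fact 1 * (84 * M) / (1/4) ^ 1"
      proof (rule Cauchy_inequality)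
        show "E holomorphic_on ball z (1/4)" by (rule holomorphic_on_subset[OF mE(4)]) (use sub in auto)
        show "continuous_on (cball z (1/4)) E"
          by (intro holomorphic_on_imp_continuous_on holomorphic_on_subset[OF mE(4)] sub)
        fix x assume "norm (z - x) = 1/4"
        then show "norm (E x) \<le> 84 * M" by (intro Ebound zc) (simp add: dist_norm)
      qed simp
      then show "norm (deriv E z) \<le> 336 * M" by simp
    qed (use s10 \<eta> \<eta>4 in \<open>auto simp: dist_norm norm_minus_commute\<close>)
    have "336 * M * \<eta> \<le> 4 * (C * L) * \<eta>" using ME \<eta> by (intro mult_right_mono) auto
    also have "\<dots> \<le> 2" using \<eta>2 by (simp add: mult_ac)
    finally have "norm (E s1 - E s0) \<le> 2" using diff unfolding s10 by linarith
    then have "Re (E s1) - Re (E s0) \<le> 2" using complex_Re_le_cmod[of "E s1 - E s0"] by simp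
    then have "- Re (E s1) \<ge> L / 8" using ReE0 L by simp
    moreover have "\<bar>Re (E s1)\<bar> \<le> C * L" "\<bar>Im (E s1)\<bar> \<le> C * L"
      using E1b abs_Re_le_cmod[of "E s1"] abs_Im_le_cmod[of "E s1"] by linarith+
    ultimately show "\<exists>X \<mu>. local_zeros C t \<eta> X \<mu>"
      using finX \<mu>0 Xz near count
      unfolding local_zeros_def L_def[symmetric]
      by (intro exI[of _ X] exI[of _ \<mu>]) (auto simp: re im abs_le_iff)
  qed
qed

text \<open>The liminf implication follows on multiplying the gap bound by
  \<open>ln \<gamma>\<close>, which is at most \<open>L\<close>: the product is at most K sqrt
  (\<eta> L^3).\<close>

theorem theorem3:
  assumes RH: riemann_hypothesis
  shows "(\<exists>K::real. K > 0 \<and> (\<exists>T::real. \<forall>\<rho>' \<gamma>.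
            \<rho>' \<in> right_deriv_zeros \<and> Im \<rho>' \<ge> T \<and> \<gamma> \<in> zeta_ordinates \<and>
            \<gamma> \<le> Im \<rho>' \<and> Im \<rho>' < next_ordinate \<gamma> \<longrightarrow>
              next_ordinate \<gamma> - \<gamma> \<le> K * sqrt ((Re \<rho>' - 1/2) * ln (Im \<rho>')))) \<and>
         (Liminf (inf (filtercomap Im at_top) (principal right_deriv_zeros))
            (\<lambda>\<rho>'. ereal ((Re \<rho>' - 1/2) * (ln (Im \<rho>')) ^ 3)) = 0 \<longrightarrow>
          Liminf (inf at_top (principal zeta_ordinates))
            (\<lambda>\<gamma>. ereal ((next_ordinate \<gamma> - \<gamma>) * ln \<gamma>)) = 0)"
proof -
  obtain T0 where T0: "\<And>T. T \<ge> T0 \<Longrightarrow> \<exists>y. \<bar>y - T\<bar> < 6 \<and> zeta (Complex (1/2) y) = 0"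
    using zeta_zero_gap[OF RH] by metis
  have ahead: "\<exists>y. x < y \<and> y < x + 12 \<and> zeta (Complex (1/2) y) = 0" if x: "x \<ge> T0" for x
  proof -
    obtain y where "\<bar>y - (x + 6)\<bar> < 6" "zeta (Complex (1/2) y) = 0"
      using T0[of "x + 6"] x by auto
    then show ?thesis by (intro exI[of _ y]) (auto simp: abs_if split: if_splits)
  qed
  obtain C T1 where C: "C \<ge> 1" and loc:
    "\<And>t \<eta>. t \<ge> T1 \<Longrightarrow> 0 < \<eta> \<Longrightarrow> \<eta> \<le> 1 / (2 * C * ln t) \<Longrightarrow> deriv zeta (Complex (1/2 + \<eta>) t) = 0 \<Longrightarrow>
      \<exists>X \<mu>. local_zeros C t \<eta> X \<mu>"
    using zeta_local[OF RH] by metis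
  define T where "T = max (max (T0 + 12) T1) (exp 20)"
  define K where "K = 144 * C * sqrt (2 * C)"
  have K: "K > 0" "12 * sqrt (2 * C) \<le> K"
  proof -
    show "K > 0" using C by (simp add: K_def)
    have "12 * sqrt (2 * C) \<le> (144 * C) * sqrt (2 * C)" using C by (intro mult_right_mono) auto
    then show "12 * sqrt (2 * C) \<le> K" by (simp add: K_def)
  qed
  have main: "next_ordinate \<gamma> - \<gamma> \<le> K * sqrt ((Re \<rho> - 1/2) * ln (Im \<rho>))"
    if \<rho>: "\<rho> \<in> right_deriv_zeros" and t: "Im \<rho> \<ge> T" and \<gamma>: "\<gamma> \<in> zeta_ordinates"
      and b: "\<gamma> \<le> Im \<rho>" "Im \<rho> < next_ordinate \<gamma>" for \<rho> \<gamma>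
  proof -
    define \<eta> where "\<eta> = Re \<rho> - 1/2"
    define L where "L = ln (Im \<rho>)"
    have \<eta>: "\<eta> > 0" using \<rho> by (simp add: right_deriv_zeros_def \<eta>_def)
    have tT: "Im \<rho> \<ge> T0 + 12" "Im \<rho> \<ge> T1" "Im \<rho> \<ge> exp 20" using t by (auto simp: T_def)
    have L: "L \<ge> 20"
    proof -
      have "ln (exp 20) \<le> ln (Im \<rho>)" using tT(3) by (subst ln_le_cancel_iff) (auto intro: less_le_trans[OF exp_gt_zero])
      then show ?thesis by (simp add: L_def)
    qed
    \<comment> \<open>Otherwise an ordinate between \<open>T0\<close> and \<open>T0 + 12\<close>
      would lie above \<open>\<gamma>\<close> and below \<open>Im \<rho>\<close>, before the next
      ordinate.\<close>
    have \<gamma>T: "\<gamma> \<ge> T0"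
    proof (rule ccontr)
      assume "\<not> \<gamma> \<ge> T0"
      moreover obtain y where y: "T0 < y" "y < T0 + 12" "zeta (Complex (1/2) y) = 0"
        using ahead[of T0] by auto
      ultimately have "next_ordinate \<gamma> \<le> y" by (intro next_ordinate(3)[of \<gamma> y]) auto
      then show False using y b tT by simp
    qed
    obtain y where y: "\<gamma> < y" "y < \<gamma> + 12" "zeta (Complex (1/2) y) = 0"
      using ahead[OF \<gamma>T] by auto
    note nx = next_ordinate[OF y(1,3)]
    have gap12: "next_ordinate \<gamma> - \<gamma> \<le> 12" using nx(3)[OF y(1,3)] y(2) by simp
    have "next_ordinate \<gamma> - \<gamma> \<le> K * sqrt (\<eta> * L)"
    proof (cases "\<eta> \<le> 1 / (2 * C * L)")
      case True
      have "Complex (1/2 + \<eta>) (Im \<rho>) = \<rho>" by (simp add: \<eta>_def complex_eq_iff)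
      then have "deriv zeta (Complex (1/2 + \<eta>) (Im \<rho>)) = 0"
        using \<rho> by (simp add: right_deriv_zeros_def)
      from loc[OF tT(2) \<eta> True[unfolded L_def] this, unfolded local_zeros_def, folded L_def]
      obtain X \<mu> where X: "finite X" "\<forall>y\<in>X. zeta (Complex (1/2) y) = 0 \<and> \<mu> y > 0"
        "\<forall>y. \<bar>y - Im \<rho>\<bar> \<le> 2 \<and> zeta (Complex (1/2) y) = 0 \<longrightarrow> y \<in> X"
        "(\<Sum>y\<in>X. real (\<mu> y)) \<le> C * L"
        "(\<Sum>y\<in>X. real (\<mu> y) * \<eta> / (\<eta>\<^sup>2 + (Im \<rho> - y)\<^sup>2)) \<le> C * L"
        "(\<Sum>y\<in>X. real (\<mu> y) * \<eta> / (\<eta>\<^sup>2 + (Im \<rho> - y)\<^sup>2)) \<ge> L / 8"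
        "\<bar>\<Sum>y\<in>X. real (\<mu> y) * (Im \<rho> - y) / (\<eta>\<^sup>2 + (Im \<rho> - y)\<^sup>2)\<bar> \<le> C * L"
        by (elim exE conjE)
      show ?thesis unfolding K_def
      proof (rule gap_inequality[where X = X and \<mu> = \<mu> and t = "Im \<rho>"])
        fix y assume y: "y \<in> X"
        show "\<mu> y > 0" using X(2) y by blast
        show "y \<le> \<gamma> \<or> next_ordinate \<gamma> \<le> y" using nx(3)[of y] X(2) y by force
      next
        assume "Im \<rho> - \<gamma> \<le> 2"
        then show "\<gamma> \<in> X" using X(3) \<gamma> b by (auto simp: zeta_ordinates_def abs_if)
      next
        assume "next_ordinate \<gamma> - Im \<rho> \<le> 2"
        then show "next_ordinate \<gamma> \<in> X" using X(3) nx(2) b by (auto simp: abs_if)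
      qed (use X C L \<eta> True b gap12 nx(1) in auto)
    next
      \<comment> \<open>For \<open>\<eta>\<close> above the threshold the right-hand side is at
        least 12, which already bounds every gap at this height.\<close>
      case False
      have "1 / (2 * C) \<le> \<eta> * L"
      proof -
        have "1 / (2 * C * L) * L \<le> \<eta> * L" using False L by (intro mult_right_mono) auto
        then show ?thesis using L by simp
      qed
      then have "1 \<le> 2 * C * (\<eta> * L)" using C by (simp add: field_simps)
      then have "sqrt 1 \<le> sqrt (2 * C * (\<eta> * L))" by (rule real_sqrt_le_mono)
      then have "1 \<le> sqrt (2 * C) * sqrt (\<eta> * L)" by (simp only: real_sqrt_one real_sqrt_mult)
      then have "12 \<le> 12 * sqrt (2 * C) * sqrt (\<eta> * L)" by simp
      also have "\<dots> \<le> K * sqrt (\<eta> * L)" using K \<eta> L by (intro mult_right_mono) auto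
      finally show ?thesis using gap12 by simp
    qed
    then show ?thesis by (simp add: \<eta>_def L_def)
  qed
  moreover have "Liminf (inf at_top (principal zeta_ordinates)) (\<lambda>\<gamma>. ereal ((next_ordinate \<gamma> - \<gamma>) * ln \<gamma>)) = 0"
    if lim: "Liminf (inf (filtercomap Im at_top) (principal right_deriv_zeros))
            (\<lambda>\<rho>'. ereal ((Re \<rho>' - 1/2) * (ln (Im \<rho>')) ^ 3)) = 0"
  proof (rule antisym)
    show "0 \<le> Liminf (inf at_top (principal zeta_ordinates)) (\<lambda>\<gamma>. ereal ((next_ordinate \<gamma> - \<gamma>) * ln \<gamma>))"
    proof (rule Liminf_bounded)
      show "eventually (\<lambda>\<gamma>. 0 \<le> ereal ((next_ordinate \<gamma> - \<gamma>) * ln \<gamma>)) (inf at_top (principal zeta_ordinates))"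
        unfolding eventually_inf_principal eventually_at_top_linorder
      proof (intro exI[of _ "max 1 T0"] allI impI)
        fix \<gamma> assume \<gamma>: "max 1 T0 \<le> \<gamma>"
        then obtain y where y: "\<gamma> < y" "zeta (Complex (1/2) y) = 0" using ahead[of \<gamma>] by auto
        from next_ordinate(1)[OF y] \<gamma> show "0 \<le> ereal ((next_ordinate \<gamma> - \<gamma>) * ln \<gamma>)" by simp
      qed
    qed
  next
    show "Liminf (inf at_top (principal zeta_ordinates)) (\<lambda>\<gamma>. ereal ((next_ordinate \<gamma> - \<gamma>) * ln \<gamma>)) \<le> 0"
    proof (rule ccontr)
      assume "\<not> ?thesis"
      then have "0 < Liminf (inf at_top (principal zeta_ordinates)) (\<lambda>\<gamma>. ereal ((next_ordinate \<gamma> - \<gamma>) * ln \<gamma>))"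
        by (simp only: not_le)
      from ereal_dense2[OF this] obtain \<epsilon> where \<epsilon>: "0 < ereal \<epsilon>"
        "ereal \<epsilon> < Liminf (inf at_top (principal zeta_ordinates)) (\<lambda>\<gamma>. ereal ((next_ordinate \<gamma> - \<gamma>) * ln \<gamma>))"
        by (elim exE conjE)
      from less_LiminfD[OF \<epsilon>(2)]
      obtain \<gamma>0 where \<gamma>0: "\<And>\<gamma>. \<gamma> \<ge> \<gamma>0 \<Longrightarrow> \<gamma> \<in> zeta_ordinates \<Longrightarrow> \<epsilon> < (next_ordinate \<gamma> - \<gamma>) * ln \<gamma>"
        unfolding eventually_inf_principal eventually_at_top_linorder by auto
      \<comment> \<open>By contraposition: if the normalised gaps stay above
        \<open>\<epsilon>\<close>, the gap bound forces \<eta> L^3 \<ge> (\<epsilon> / K)^2 at every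
        high zero of the derivative.\<close>
      define \<delta> where "\<delta> = (\<epsilon> / K)\<^sup>2"
      have \<delta>: "\<delta> > 0" using \<epsilon>(1) K by (simp add: \<delta>_def)
      have "ereal \<delta> \<le> Liminf (inf (filtercomap Im at_top) (principal right_deriv_zeros))
            (\<lambda>\<rho>'. ereal ((Re \<rho>' - 1/2) * (ln (Im \<rho>')) ^ 3))"
      proof (rule Liminf_bounded)
        show "eventually (\<lambda>\<rho>'. ereal \<delta> \<le> ereal ((Re \<rho>' - 1/2) * (ln (Im \<rho>')) ^ 3))
          (inf (filtercomap Im at_top) (principal right_deriv_zeros))"
          unfolding eventually_inf_principal eventually_filtercomap_at_top_linorder
        \<comment> \<open>An ordinate exists less than 12 below \<open>Im \<rho>\<close>; the added
          12 keeps the ordinate \<open>\<gamma>\<close> chosen below above \<open>T0\<close>,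
          \<open>\<gamma>0\<close> and 1.\<close>
        proof (intro exI[of _ "max (max T (T0 + 12)) (max 1 \<gamma>0 + 12)"] allI impI)
          fix \<rho> assume t: "max (max T (T0 + 12)) (max 1 \<gamma>0 + 12) \<le> Im \<rho>" and \<rho>: "\<rho> \<in> right_deriv_zeros"
          obtain y where y: "Im \<rho> - 12 < y" "y < Im \<rho>" "zeta (Complex (1/2) y) = 0"
            using ahead[of "Im \<rho> - 12"] t by auto
          define S where "S = {y' \<in> {y..Im \<rho>}. zeta (Complex (1/2) y') = 0}"
          have fin: "finite S" unfolding S_def by (rule finite_ordinates)
          have yS: "y \<in> S" using y by (simp add: S_def)
          then have ne: "S \<noteq> {}" by blast
          \<comment> \<open>The largest ordinate not exceeding \<open>Im \<rho>\<close>; its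
            maximality gives \<open>Im \<rho> < next_ordinate \<gamma>\<close>, as the gap bound
            demands.\<close>
          define \<gamma> where "\<gamma> = Max S"
          have \<gamma>S: "\<gamma> \<in> S" unfolding \<gamma>_def by (rule Max_in[OF fin ne])
          have \<gamma>1: "\<gamma> \<ge> 1" "\<gamma> \<ge> \<gamma>0" "\<gamma> \<le> Im \<rho>" "\<gamma> \<ge> T0" using \<gamma>S y t by (auto simp: S_def)
          have \<gamma>o: "\<gamma> \<in> zeta_ordinates" using \<gamma>S \<gamma>1 by (simp add: S_def zeta_ordinates_def)
          obtain z where z: "\<gamma> < z" "zeta (Complex (1/2) z) = 0" using ahead[OF \<gamma>1(4)] by auto
          note nx = next_ordinate[OF z]
          have nxt: "Im \<rho> < next_ordinate \<gamma>"
          proof (rule ccontr)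
            assume "\<not> ?thesis"
            then have "next_ordinate \<gamma> \<in> S" using nx \<gamma>S by (auto simp: S_def)
            then have "next_ordinate \<gamma> \<le> \<gamma>" unfolding \<gamma>_def by (rule Max_ge[OF fin])
            then show False using nx(1) by simp
          qed
          define \<eta> where "\<eta> = Re \<rho> - 1/2"
          define L where "L = ln (Im \<rho>)"
          have \<eta>: "\<eta> > 0" using \<rho> by (simp add: right_deriv_zeros_def \<eta>_def)
          have L: "L \<ge> 0" "ln \<gamma> \<le> L" "ln \<gamma> \<ge> 0" using \<gamma>1 by (auto simp: L_def)
          have "next_ordinate \<gamma> - \<gamma> \<le> K * sqrt (\<eta> * L)"
            using main[OF \<rho> _ \<gamma>o \<gamma>1(3) nxt] t by (simp add: \<eta>_def L_def)
          then have "(next_ordinate \<gamma> - \<gamma>) * ln \<gamma> \<le> (K * sqrt (\<eta> * L)) * L"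
            using L \<eta> K nx(1) by (intro mult_mono) auto
          with \<gamma>0[OF \<gamma>1(2) \<gamma>o] have "\<epsilon> \<le> K * (sqrt (\<eta> * L) * L)" by (simp add: mult_ac)
          then have "\<epsilon> / K \<le> sqrt (\<eta> * L) * L" using K by (simp add: field_simps)
          then have "(\<epsilon> / K)\<^sup>2 \<le> (sqrt (\<eta> * L) * L)\<^sup>2"
            using \<epsilon>(1) K by (intro power_mono) auto
          also have "\<dots> = \<eta> * L ^ 3" using \<eta> L by (simp add: power_mult_distrib power2_eq_square power3_eq_cube)
          finally show "ereal \<delta> \<le> ereal ((Re \<rho> - 1/2) * (ln (Im \<rho>)) ^ 3)"
            by (simp add: \<delta>_def \<eta>_def L_def)
        qed
      qed
      with lim \<delta> show False by simp
    qed
  qed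
  ultimately show ?thesis using K(1) by blast
qed

end
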